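(* Let $F\in\mathrm{Diff}(\mathbb{C}^2,0)$. Consider an irreducible formal curve $\Gamma$ at $0$, invariant by $F$, such that the multiplier of $F|_{\Gamma}$ is a Bruno number. Then $F$ does not satisfy the finite orbits property.
   Context: $\mathrm{Diff}(\mathbb{C}^2,0)$ is the group of germs at $0$ of biholomorphisms of $\mathbb{C}^2$ fixing $0$. For a representative $F:U\to V$ (a biholomorphism between open neighborhoods of $0$ with $F(0)=0$), $A\subset U\cap V$ and $p\in A$, put $O^+_{F,A}(p)=\{F^j(p): j\ge 0,\ F^k(p)\in A\text{ for all }0\le k\le j\}$ and $O_{F,A}(p)=O^+_{F,A}(p)\cup O^+_{F^{-1},A}(p)$. $F$ has the finite orbits property in $A$ if $O_{F,A}(p)$ is finite for all $p\in A$. A germ $F$ has the finite orbits property if there exist a representative $F:U\to V$ and a neighborhood $A\subset U\cap V$ of $0$ such that $F$ has the finite orbits property in $A$. A formal curve at $0\in\mathbb{C}^2$ is a (non-zero) proper radical ideal $\Gamma=(f)$ of $\mathbb{C}[[x,y]]$; it is irreducible if $f$ is irreducible. $\Gamma$ is invariant by $F$ if $f$ divides $f\circ F$. If $\gamma(t)$ is a Puiseux parametrization of an irreducible invariant formal curve $\Gamma$, then $F(\gamma(t))=\gamma(h(t))$ for some formal diffeomorphism $h$ in one variable, and the multiplier of $F|_\Gamma$ is $h'(0)$. A number $\lambda\in\mathbb{C}$ is a Bruno number if $|\lambda|=1$ and there is a sequence of integers $1<q_1<q_2<\cdots$ such that $\sum_{k=1}^\infty\frac{1}{q_k}\log\frac{1}{\Omega_\lambda(q_{k+1})}<+\infty$,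 where $\Omega_\lambda(m)=\min_{2\le k\le m}|\lambda^k-\lambda|$ for $m\ge2$ (with $\log(1/0)=+\infty$). *)

theory Defs
  imports
    "HOL-Complex_Analysis.Complex_Analysis"
    "HOL-Computational_Algebra.Computational_Algebra"
begin

unbundle no vec_syntax
unbundle fps_syntax

text \<open>
  Holomorphy on an open subset of \<open>\<complex>\<^sup>2\<close>: real Frechet differentiability with a
  complex linear differential at every point.
\<close>

definition holomorphic2_on :: "(complex \<times> complex \<Rightarrow> complex) \<Rightarrow> (complex \<times> complex) set \<Rightarrow> bool" where
  "holomorphic2_on g U \<longleftrightarrow>
     (\<forall>p\<in>U. \<exists>a b. (g has_derivative (\<lambda>(h, k). a * h + b * k)) (at p))"

definition holomorphic_map_on ::
    "(complex \<times> complex \<Rightarrow> complex \<times> complex) \<Rightarrow> (complex \<times> complex) set \<Rightarrow> bool" where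
  "holomorphic_map_on F U \<longleftrightarrow> holomorphic2_on (fst \<circ> F) U \<and> holomorphic2_on (snd \<circ> F) U"

definition biholomorphism ::
    "(complex \<times> complex \<Rightarrow> complex \<times> complex) \<Rightarrow> (complex \<times> complex) set \<Rightarrow> (complex \<times> complex) set \<Rightarrow> bool" where
  "biholomorphism F U V \<longleftrightarrow>
     open U \<and> open V \<and> bij_betw F U V \<and>
     holomorphic_map_on F U \<and> holomorphic_map_on (inv_into U F) V"

definition local_diffeo ::
    "(complex \<times> complex \<Rightarrow> complex \<times> complex) \<Rightarrow> (complex \<times> complex) set \<Rightarrow> (complex \<times> complex) set \<Rightarrow> bool" where
  "local_diffeo F U V \<longleftrightarrow> biholomorphism F U V \<and> 0 \<in> U \<and> 0 \<in> V \<and> F 0 = 0"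

text \<open>
  An element of \<open>Diff(\<complex>\<^sup>2,0)\<close> is handled through a total function \<open>F\<close> whose germ at 0 it is;
  the values of \<open>F\<close> away from 0 are irrelevant. The representatives of the germ are the triples
  \<open>G, U, V\<close> such that \<open>G : U \<rightarrow> V\<close> is a biholomorphism fixing 0 and \<open>G\<close> agrees with \<open>F\<close> near 0.
\<close>

definition diff_germ :: "(complex \<times> complex \<Rightarrow> complex \<times> complex) \<Rightarrow> bool" where
  "diff_germ F \<longleftrightarrow> (\<exists>U V. local_diffeo F U V)"

definition represents_germ ::
    "(complex \<times> complex \<Rightarrow> complex \<times> complex) \<Rightarrow> (complex \<times> complex \<Rightarrow> complex \<times> complex) \<Rightarrow>
     (complex \<times> complex) set \<Rightarrow> (complex \<times> complex) set \<Rightarrow> bool" where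
  "represents_germ F G U V \<longleftrightarrow> local_diffeo G U V \<and> (\<forall>\<^sub>F p in nhds 0. G p = F p)"

text \<open>
  Iterating the total function is harmless: for \<open>A \<subseteq> U\<close> the condition on the iterates
  of index \<open>< j\<close> ensures that the \<open>j\<close>-th one only uses values of \<open>F\<close> on \<open>U\<close>.
\<close>

definition forward_orbit :: "('a \<Rightarrow> 'a) \<Rightarrow> 'a set \<Rightarrow> 'a \<Rightarrow> 'a set" where
  "forward_orbit F A p = {(F ^^ j) p |j. \<forall>k\<le>j. (F ^^ k) p \<in> A}"

definition orbit_in :: "('a \<Rightarrow> 'a) \<Rightarrow> 'a set \<Rightarrow> 'a set \<Rightarrow> 'a \<Rightarrow> 'a set" where
  "orbit_in F U A p = forward_orbit F A p \<union> forward_orbit (inv_into U F) A p"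

definition finite_orbits_in :: "('a \<Rightarrow> 'a) \<Rightarrow> 'a set \<Rightarrow> 'a set \<Rightarrow> bool" where
  "finite_orbits_in F U A \<longleftrightarrow> (\<forall>p\<in>A. finite (orbit_in F U A p))"

definition finite_orbits_property :: "(complex \<times> complex \<Rightarrow> complex \<times> complex) \<Rightarrow> bool" where
  "finite_orbits_property F \<longleftrightarrow>
     (\<exists>G U V A. represents_germ F G U V \<and> A \<subseteq> U \<inter> V \<and> 0 \<in> interior A \<and> finite_orbits_in G U A)"

text \<open>
  \<open>\<complex>[[x,y]]\<close> is represented by \<^typ>\<open>complex fps fps\<close>; \<open>f $ i $ j\<close> is the coefficient
  of \<open>x\<^sup>i y\<^sup>j\<close>.
\<close>

definition taylor2 :: "(complex \<times> complex \<Rightarrow> complex) \<Rightarrow> complex fps fps" where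
  "taylor2 g = Abs_fps (\<lambda>i. Abs_fps (\<lambda>j.
     (deriv ^^ i) (\<lambda>x. (deriv ^^ j) (\<lambda>y. g (x, y)) 0) 0 / (fact i * fact j)))"

text \<open>
  Substitution \<open>f(u,v)\<close> for \<open>u\<close>, \<open>v\<close> with zero constant term, into \<open>\<complex>[[x,y]]\<close> and into
  \<open>\<complex>[[t]]\<close>. Since \<open>u\<^sup>i v\<^sup>j\<close> has order at least \<open>i + j\<close>, only the terms with
  \<open>i + j \<le> m + n\<close> (respectively \<open>i + j \<le> n\<close>) contribute to the coefficient in question.
\<close>

definition subst2 :: "complex fps fps \<Rightarrow> complex fps fps \<Rightarrow> complex fps fps \<Rightarrow> complex fps fps" where
  "subst2 f u v = Abs_fps (\<lambda>m. Abs_fps (\<lambda>n.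
     \<Sum>(i, j) \<in> {(i, j). i + j \<le> m + n}. f $ i $ j * (u ^ i * v ^ j) $ m $ n))"

definition subst1 :: "complex fps fps \<Rightarrow> complex fps \<Rightarrow> complex fps \<Rightarrow> complex fps" where
  "subst1 f u v = Abs_fps (\<lambda>n.
     \<Sum>(i, j) \<in> {(i, j). i + j \<le> n}. f $ i $ j * (u ^ i * v ^ j) $ n)"

definition compose_germ :: "complex fps fps \<Rightarrow> (complex \<times> complex \<Rightarrow> complex \<times> complex) \<Rightarrow> complex fps fps" where
  "compose_germ f F = subst2 f (taylor2 (fst \<circ> F)) (taylor2 (snd \<circ> F))"

definition principal_ideal :: "'a::comm_semiring_1 \<Rightarrow> 'a set" where
  "principal_ideal f = {f * g |g. True}"

definition formal_curve :: "complex fps fps set \<Rightarrow> bool" where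
  "formal_curve \<Gamma> \<longleftrightarrow>
     (\<exists>f. \<Gamma> = principal_ideal f) \<and> \<Gamma> \<noteq> {0} \<and> \<Gamma> \<noteq> UNIV \<and> (\<forall>g n. g ^ n \<in> \<Gamma> \<longrightarrow> g \<in> \<Gamma>)"

definition irreducible_formal_curve :: "complex fps fps set \<Rightarrow> bool" where
  "irreducible_formal_curve \<Gamma> \<longleftrightarrow>
     formal_curve \<Gamma> \<and> (\<exists>f. \<Gamma> = principal_ideal f \<and> irreducible f)"

text \<open>
  Generators of a principal ideal differ by a unit, so neither this notion nor the previous one
  depends on the choice of \<open>f\<close>.
\<close>

definition invariant_curve :: "(complex \<times> complex \<Rightarrow> complex \<times> complex) \<Rightarrow> complex fps fps set \<Rightarrow> bool" where
  "invariant_curve F \<Gamma> \<longleftrightarrow> (\<exists>f. \<Gamma> = principal_ideal f \<and> f dvd compose_germ f F)"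

text \<open>
  A Puiseux parametrization is \<open>(t\<^sup>n, \<phi>(t))\<close>, or \<open>(\<phi>(t), t\<^sup>n)\<close> (needed for the curve \<open>x = 0\<close>),
  with \<open>n \<ge> 1\<close> and \<open>\<phi>(0) = 0\<close>. The gcd condition says that it is not a
  parametrization in a power \<open>t\<^sup>d\<close> with \<open>d \<ge> 2\<close>; without it the multiplier would only be determined
  up to a \<open>d\<close>-th root.
\<close>

definition primitive_pair :: "nat \<Rightarrow> complex fps \<Rightarrow> bool" where
  "primitive_pair n \<phi> \<longleftrightarrow> n \<ge> 1 \<and> \<phi> $ 0 = 0 \<and> Gcd (insert n {k. \<phi> $ k \<noteq> 0}) = 1"

definition puiseux_parametrization :: "complex fps fps set \<Rightarrow> complex fps \<times> complex fps \<Rightarrow> bool" where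
  "puiseux_parametrization \<Gamma> \<gamma> \<longleftrightarrow>
     (\<exists>n \<phi>. primitive_pair n \<phi> \<and> (\<gamma> = (fps_X ^ n, \<phi>) \<or> \<gamma> = (\<phi>, fps_X ^ n))) \<and>
     (\<forall>f\<in>\<Gamma>. subst1 f (fst \<gamma>) (snd \<gamma>) = 0)"

definition germ_along ::
    "(complex \<times> complex \<Rightarrow> complex \<times> complex) \<Rightarrow> complex fps \<times> complex fps \<Rightarrow> complex fps \<times> complex fps" where
  "germ_along F \<gamma> =
     (subst1 (taylor2 (fst \<circ> F)) (fst \<gamma>) (snd \<gamma>), subst1 (taylor2 (snd \<circ> F)) (fst \<gamma>) (snd \<gamma>))"

definition formal_diffeo :: "complex fps \<Rightarrow> bool" where
  "formal_diffeo h \<longleftrightarrow> h $ 0 = 0 \<and> h $ 1 \<noteq> 0"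

text \<open>
  The multiplier as a relation: for an irreducible invariant \<open>\<Gamma>\<close> there is exactly one such \<open>\<mu>\<close>,
  independent of \<open>\<gamma>\<close>.
\<close>

definition is_multiplier ::
    "(complex \<times> complex \<Rightarrow> complex \<times> complex) \<Rightarrow> complex fps fps set \<Rightarrow> complex \<Rightarrow> bool" where
  "is_multiplier F \<Gamma> \<mu> \<longleftrightarrow>
     (\<exists>\<gamma> h. puiseux_parametrization \<Gamma> \<gamma> \<and> formal_diffeo h \<and>
        germ_along F \<gamma> = (fst \<gamma> oo h, snd \<gamma> oo h) \<and> \<mu> = h $ 1)"

definition bruno_Omega :: "complex \<Rightarrow> nat \<Rightarrow> real" where
  "bruno_Omega \<mu> m = Min ((\<lambda>k. cmod (\<mu> ^ k - \<mu>)) ` {2..m})"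

text \<open>
  The sequence is indexed from 0 instead of 1. Since \<open>ln (1 / 0) = 0\<close> here, the convention
  \<open>log(1/0) = +\<infinity>\<close> becomes the explicit requirement that no \<open>\<Omega>\<close> in the series vanishes. Then
  \<open>\<mu>\<close> is not a root of unity, so \<open>\<Omega>\<close> tends to 0 and only finitely many terms are negative:
  the sum being \<open>< +\<infinity>\<close> is summability.
\<close>

definition bruno_number :: "complex \<Rightarrow> bool" where
  "bruno_number \<mu> \<longleftrightarrow> cmod \<mu> = 1 \<and>
     (\<exists>q :: nat \<Rightarrow> nat. 1 < q 0 \<and> strict_mono q \<and>
        (\<forall>k. bruno_Omega \<mu> (q (Suc k)) \<noteq> 0) \<and>
        summable (\<lambda>k. 1 / real (q k) * ln (1 / bruno_Omega \<mu> (q (Suc k)))))"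

end

theory Submission
  imports Defs
begin

text \<open>
  Linearising \<open>F|\<Gamma>\<close> formally gives a formal curve \<open>\<gamma>\<close> with \<open>F(\<gamma>(t)) = \<gamma>(\<mu>t)\<close>, tangent to an
  eigenvector of \<open>DF(0)\<close> with eigenvalue \<open>\<mu>\<^sup>d\<close>. Suppose that orbits are finite near 0. A periodic
  point has no eigenvalue off the unit circle: there would be a convergent invariant curve through
  it on which \<open>F\<close> or its inverse contracts. In particular \<open>DF(0)\<close> has unimodular eigenvalues, and
  approximating \<open>F\<close> by the maps \<open>sF\<close> with \<open>s < 1\<close> one finds a nondegenerate continuum through 0
  whose points stay in a small ball under \<open>F\<close>, hence are periodic. By an argument as in Sierpinski's
  theorem on continua they have a common period, so one eigenvalue of \<open>DF(0)\<close> is a root of unity.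
  As \<open>\<mu>\<close> is not one, it is the other eigenvalue \<open>\<beta>\<close>. Now the divisors \<open>(\<mu>\<^sup>k - \<mu>\<^sup>d)(\<mu>\<^sup>k - \<beta>)\<close> in the equation for the
  coefficients of \<open>\<gamma>\<close> are controlled by the Bruno condition, so \<open>\<gamma>\<close> converges, and its points
  \<open>\<gamma>(t)\<close> with \<open>t \<noteq> 0\<close> have infinite orbits.
\<close>

section \<open>Holomorphic functions of two variables\<close>

text \<open>The Bruno condition bounds |\<mu>^e - 1| from below and says nothing about the second
  eigenvalue \<beta>, so the factor \<mu>^k - \<beta> of the divisors is out of reach by itself.
  Finiteness of orbits is what ties \<beta> to \<mu>: if \<beta>^m = 1, then |\<mu>^k - \<beta>| is
  at least |\<mu>^(m k) - 1| / m, and one condition controls both factors. The eigenvalue that is a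
  root of unity comes from fixed points that are not isolated: where an iterate F^N is the identity
  on a nondegenerate continuum, F^N - id is not locally injective, so 1 is an eigenvalue of its
  differential. For the common period the fixed point sets of the iterates are not good enough:
  points of higher period may accumulate where a nontrivial root of unity is an eigenvalue.
  Discarding such points makes the sets relatively open. That they remain closed uses unimodularity
  once more: a determinant of modulus 1 cannot vary along a holomorphic curve of fixed points. The
  factor s < 1 serves to make 0 an attractor, so that the component of 0 has interior, on which an
  expanding inverse can be contradicted.\<close>

lemma holomorphic2_onD:
  assumes "holomorphic2_on g U" "p \<in> U"
  obtains a b where "(g has_derivative (\<lambda>(h, k). a * h + b * k)) (at p)"
  using assms unfolding holomorphic2_on_def by blast

lemma holomorphic2_on_subset: "holomorphic2_on g U \<Longrightarrow> V \<subseteq> U \<Longrightarrow> holomorphic2_on g V"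
  unfolding holomorphic2_on_def by blast

lemma holomorphic2_on_imp_continuous_on: "holomorphic2_on g U \<Longrightarrow> continuous_on U g"
  unfolding holomorphic2_on_def
  by (meson continuous_at_imp_continuous_on has_derivative_continuous)

section \<open>Partial derivatives and separate holomorphy\<close>

definition partial1 :: "(complex \<times> complex \<Rightarrow> complex) \<Rightarrow> complex \<times> complex \<Rightarrow> complex" where
  "partial1 g p = deriv (\<lambda>x. g (x, snd p)) (fst p)"

definition partial2 :: "(complex \<times> complex \<Rightarrow> complex) \<Rightarrow> complex \<times> complex \<Rightarrow> complex" where
  "partial2 g p = deriv (\<lambda>y. g (fst p, y)) (snd p)"

lemma has_derivative_imp_slices:
  assumes "(g has_derivative (\<lambda>(h, k). a * h + b * k)) (at (x, y))"
  shows "((\<lambda>x. g (x, y)) has_field_derivative a) (at x)"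
    and "((\<lambda>y. g (x, y)) has_field_derivative b) (at y)"
proof -
  have "((g \<circ> (\<lambda>x. (x, y))) has_derivative ((\<lambda>(h, k). a * h + b * k) \<circ> (\<lambda>h. (h, 0)))) (at x)"
    by (rule diff_chain_at) (use assms in \<open>auto intro!: derivative_eq_intros\<close>)
  then show "((\<lambda>x. g (x, y)) has_field_derivative a) (at x)"
    by (simp add: has_field_derivative_def o_def mult_commute_abs)
  have "((g \<circ> (\<lambda>y. (x, y))) has_derivative ((\<lambda>(h, k). a * h + b * k) \<circ> (\<lambda>h. (0, h)))) (at y)"
    by (rule diff_chain_at) (use assms in \<open>auto intro!: derivative_eq_intros\<close>)
  then show "((\<lambda>y. g (x, y)) has_field_derivative b) (at y)"
    by (simp add: has_field_derivative_def o_def mult_commute_abs)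
qed

text \<open>A differential at each point says nothing about the partial derivatives as functions.
  Continuity together with holomorphy in each variable is equivalent to it on open sets and visibly
  passes to \<open>partial1\<close> and \<open>partial2\<close>, so that these can be
  iterated.\<close>

definition separately_holomorphic :: "(complex \<times> complex \<Rightarrow> complex) \<Rightarrow> (complex \<times> complex) set \<Rightarrow> bool" where
  "separately_holomorphic g U \<longleftrightarrow> continuous_on U g \<and>
     (\<forall>(x, y)\<in>U. (\<lambda>x. g (x, y)) field_differentiable at x \<and> (\<lambda>y. g (x, y)) field_differentiable at y)"

lemma holomorphic2_on_imp_separately:
  assumes "holomorphic2_on g U" shows "separately_holomorphic g U"
  unfolding separately_holomorphic_def
proof (intro conjI ballI; clarsimp?)
  show "continuous_on U g" using assms by (rule holomorphic2_on_imp_continuous_on)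
  fix x y assume "(x, y) \<in> U"
  with assms obtain a b where "(g has_derivative (\<lambda>(h, k). a * h + b * k)) (at (x, y))"
    by (rule holomorphic2_onD)
  from has_derivative_imp_slices[OF this]
  show "(\<lambda>x. g (x, y)) field_differentiable at x \<and> (\<lambda>y. g (x, y)) field_differentiable at y"
    by (auto simp: field_differentiable_def)
qed

lemma open_contains_bidisc:
  fixes U :: "(complex \<times> complex) set"
  assumes "open U" "(a, b) \<in> U"
  obtains r where "r > 0" "cball a r \<times> cball b r \<subseteq> U"
proof -
  obtain A B where AB: "open A" "open B" "(a, b) \<in> A \<times> B" "A \<times> B \<subseteq> U"
    using assms open_prod_elim by blast
  obtain r1 r2 where "r1 > 0" "cball a r1 \<subseteq> A" "r2 > 0" "cball b r2 \<subseteq> B"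
    using AB open_contains_cball by (metis mem_Sigma_iff)
  then have "cball a (min r1 r2) \<times> cball b (min r1 r2) \<subseteq> U" "min r1 r2 > 0"
    using AB by (auto intro!: subsetD[OF AB(4)] simp: subset_iff)
  then show ?thesis using that by blast
qed

text \<open>The first-order Taylor remainder with an explicit rate in which only \<open>r\<close>
  and \<open>B\<close> enter: the estimate is uniform when f depends on a further variable. Cauchy's
  estimate on discs of radius r/2 bounds the second derivative by 8 B / r^2, rounded up to
  16.\<close>

lemma difference_quotient_bound:
  fixes f :: "complex \<Rightarrow> complex"
  assumes f: "f holomorphic_on ball y r" and B: "\<And>w. w \<in> ball y r \<Longrightarrow> norm (f w) \<le> B"
    and h: "h \<noteq> 0" "norm h \<le> r / 4"
  shows "norm ((f (y + h) - f y) / h - deriv f y) \<le> 16 * B * norm h / r\<^sup>2"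
proof -
  have r: "r > 0"
  proof -
    have "norm h > 0" using h by simp
    with h(2) show ?thesis by linarith
  qed
  have B0: "B \<ge> 0" using B[of y] r order_trans[OF norm_ge_zero] by simp
  have d2: "norm (deriv (deriv f) w) \<le> 16 * B / r\<^sup>2" if w: "w \<in> cball y (norm h)" for w
  proof -
    have sub: "cball w (r/2) \<subseteq> ball y r"
    proof
      fix t assume "t \<in> cball w (r/2)"
      moreover have "dist y t \<le> dist y w + dist w t" by (rule dist_triangle)
      ultimately show "t \<in> ball y r" using w h r by auto
    qed
    have "norm ((deriv ^^ 2) f w) \<le> fact 2 * B / (r/2)^2"
    proof (rule Cauchy_inequality)
      show "f holomorphic_on ball w (r/2)"
        using f holomorphic_on_subset sub by (meson ball_subset_cball subset_trans)
      show "continuous_on (cball w (r/2)) f"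
        using f holomorphic_on_imp_continuous_on holomorphic_on_subset sub by blast
      show "0 < r/2" using r by simp
      show "norm (f x) \<le> B" if "norm (w - x) = r/2" for x
        using B sub that by (auto simp: dist_norm)
    qed
    then show ?thesis
      using B0 r by (simp add: numeral_2_eq_2 power2_eq_square field_simps mult_left_mono)
  qed
  \<comment> \<open>Without its linear part the function has a derivative of size O(|h|) on the
    disc, and the mean value inequality gains the second factor |h|.\<close>
  define k where "k = (\<lambda>w. f w - deriv f y * w)"
  have d1: "norm (deriv f w - deriv f y) \<le> 16 * B / r\<^sup>2 * norm h" if w: "w \<in> cball y (norm h)" for w
  proof -
    have "norm (deriv f w - deriv f y) \<le> 16 * B / r\<^sup>2 * norm (w - y)"
    proof (rule field_differentiable_bound[of "cball y (norm h)" "deriv f" "deriv (deriv f)"])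
      fix t assume "t \<in> cball y (norm h)"
      then have "t \<in> ball y r" using h r by (auto simp: )
      then have "deriv f field_differentiable at t"
        using holomorphic_deriv[OF f] by (meson holomorphic_on_imp_differentiable_at open_ball)
      then show "(deriv f has_field_derivative deriv (deriv f) t) (at t within cball y (norm h))"
        using DERIV_deriv_iff_field_differentiable has_field_derivative_at_within by blast
    qed (use d2 w in auto)
    also have "\<dots> \<le> 16 * B / r\<^sup>2 * norm h"
      using w B0 by (intro mult_left_mono) (auto simp: dist_norm norm_minus_commute)
    finally show ?thesis .
  qed
  have "norm (k (y + h) - k y) \<le> 16 * B / r\<^sup>2 * norm h * norm (y + h - y)"
  proof (rule field_differentiable_bound[of "cball y (norm h)" k "\<lambda>w. deriv f w - deriv f y"])
    fix t assume "t \<in> cball y (norm h)"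
    then have "t \<in> ball y r" using h r by (auto simp: )
    then have "(f has_field_derivative deriv f t) (at t)"
      using f by (intro holomorphic_derivI[of _ "ball y r"]) auto
    then have "(k has_field_derivative deriv f t - deriv f y * 1) (at t)"
      unfolding k_def by (intro DERIV_diff DERIV_cmult DERIV_ident)
    then show "(k has_field_derivative deriv f t - deriv f y) (at t within cball y (norm h))"
      by (simp add: has_field_derivative_at_within)
  qed (use d1 in \<open>auto simp: dist_norm\<close>)
  moreover have "(f (y + h) - f y) / h - deriv f y = (k (y + h) - k y) / h"
    using h by (simp add: k_def field_simps)
  ultimately have "norm ((f (y + h) - f y) / h - deriv f y) \<le> 16 * B / r\<^sup>2 * norm h * norm h / norm h"
    by (simp only: norm_divide divide_right_mono norm_ge_zero add_diff_cancel_left')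
  then show ?thesis using h by simp
qed

text \<open>Locally \<open>partial2 g\<close> is a uniform limit of difference quotients in the
  second variable. These are continuous, and holomorphic in the first variable; both properties
  survive uniform limits.\<close>

lemma partial2_separately_holomorphic:
  assumes U: "open U" and g: "separately_holomorphic g U"
  shows "separately_holomorphic (partial2 g) U"
proof -
  have gc: "continuous_on U g"
    and g1: "\<And>x y. (x, y) \<in> U \<Longrightarrow> (\<lambda>x. g (x, y)) field_differentiable at x"
    and g2: "\<And>x y. (x, y) \<in> U \<Longrightarrow> (\<lambda>y. g (x, y)) field_differentiable at y"
    using g unfolding separately_holomorphic_def by auto
  have main: "continuous (at (a, b)) (partial2 g) \<and> (\<lambda>x. partial2 g (x, b)) field_differentiable at a \<and>
        (\<lambda>y. partial2 g (a, y)) field_differentiable at b" if ab: "(a, b) \<in> U" for a b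
  proof -
    obtain r where r: "r > 0" "cball a r \<times> cball b r \<subseteq> U"
      using open_contains_bidisc[OF U ab] .
    have "compact (g ` (cball a r \<times> cball b r))"
      by (intro compact_continuous_image compact_Times compact_cball continuous_on_subset[OF gc r(2)])
    then obtain B where B: "\<And>x y. x \<in> cball a r \<Longrightarrow> y \<in> cball b r \<Longrightarrow> norm (g (x, y)) \<le> B"
      by (metis bounded_iff compact_imp_bounded image_eqI mem_Sigma_iff)
    define s where "s = r / 2"
    \<comment> \<open>Increments of modulus at most s/4 keep the shifted point in the bidisc of
      radius r = 2 s and suit \<open>difference_quotient_bound\<close> on discs of radius s.\<close>
    define e where "e = (\<lambda>n. complex_of_real (s / (4 * real (Suc n))))"
    have e_norm: "norm (e n) = s / (4 * real (Suc n))" for n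
      using r by (simp add: e_def s_def norm_divide norm_mult del: of_nat_Suc)
    have e_ne: "e n \<noteq> 0" for n
      using r e_norm[of n] by (auto simp: s_def)
    have e_le: "norm (e n) \<le> s / 4" for n
      unfolding e_norm using r by (auto simp: s_def field_simps)
    define q where "q = (\<lambda>n p. (g (fst p, snd p + e n) - g p) / e n)"
    define W where "W = ball a s \<times> ball b s"
    have inU: "(x, y + e n) \<in> U" "(x,y) \<in> U" if "(x, y) \<in> W" for x y n
    proof -
      have "dist b (y + e n) \<le> dist b y + norm (e n)"
        using dist_triangle[of b "y + e n" y] by (simp add: dist_norm)
      then show "(x, y + e n) \<in> U" "(x,y) \<in> U"
        using e_le[of n] r that by (auto simp: W_def s_def intro!: subsetD[OF r(2)])
    qed
    have ul: "uniform_limit W q (partial2 g) sequentially"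
    proof (rule uniform_limitI)
      fix \<epsilon> :: real assume \<epsilon>: "\<epsilon> > 0"
      have "(\<lambda>n. 16 * B * (s / (4 * real (Suc n))) / s\<^sup>2) \<longlonglongrightarrow> 0"
        using tendsto_mult_right_zero[OF LIMSEQ_inverse_real_of_nat, of "16 * B * (s / 4) / s\<^sup>2"]
        by (simp add: field_simps del: of_nat_Suc)
      then have "\<forall>\<^sub>F n in sequentially. 16 * B * (s / (4 * real (Suc n))) / s\<^sup>2 < \<epsilon>"
        using \<epsilon> order_tendstoD(2) by blast
      then show "\<forall>\<^sub>F n in sequentially. \<forall>p\<in>W. dist (q n p) (partial2 g p) < \<epsilon>"
      proof (rule eventually_mono, intro ballI)
        fix n p assume n: "16 * B * (s / (4 * real (Suc n))) / s\<^sup>2 < \<epsilon>" and p: "p \<in> W"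
        obtain x y where xy: "p = (x, y)" by (cases p)
        have "norm ((g (x, y + e n) - g (x, y)) / (e n) - deriv (\<lambda>y. g (x, y)) y)
          \<le> 16 * B * norm (e n) / s\<^sup>2"
        proof (rule difference_quotient_bound)
          have sub: "ball y s \<subseteq> cball b r"
          proof
            fix w assume "w \<in> ball y s"
            then show "w \<in> cball b r"
              using p xy dist_triangle[of b w y] by (auto simp: W_def s_def)
          qed
          have xr: "x \<in> cball a r" using p xy r by (auto simp: W_def s_def)
          show "(\<lambda>y. g (x, y)) holomorphic_on ball y s"
            unfolding holomorphic_on_def
            using sub xr r(2) by (auto intro!: field_differentiable_at_within g2)
          show "norm (g (x, w)) \<le> B" if "w \<in> ball y s" for w
            using B xr sub that by blast
          show "e n \<noteq> 0" by (rule e_ne)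
          show "norm (e n) \<le> s / 4" by (rule e_le)
        qed
        also note e_norm
        finally show "dist (q n p) (partial2 g p) < \<epsilon>"
          using n by (simp add: q_def partial2_def xy dist_norm)
      qed
    qed
    have cq: "continuous_on W (q n)" for n
    proof -
      have "continuous_on W (\<lambda>p. g (fst p, snd p + e n))"
        by (rule continuous_on_compose2[OF gc]) (use inU in \<open>auto intro!: continuous_intros simp del: of_nat_Suc\<close>)
      moreover have "continuous_on W g"
        by (rule continuous_on_subset[OF gc]) (use inU in auto)
      ultimately show ?thesis unfolding q_def
        using e_ne by (auto intro!: continuous_intros)
    qed
    have "continuous_on W (partial2 g)"
      by (rule uniform_limit_theorem[OF _ ul]) (auto simp: cq)
    moreover have "open W" "(a, b) \<in> W" using r by (auto simp: W_def s_def intro!: open_Times)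
    ultimately have c: "continuous (at (a, b)) (partial2 g)"
      using continuous_on_eq_continuous_at by blast
    have ul1: "uniform_limit (cball a (s/2)) (\<lambda>n x. q n (x, b)) (\<lambda>x. partial2 g (x, b)) sequentially"
    proof -
      have "uniform_limit (cball a (s/2) \<times> {b}) q (partial2 g) sequentially"
        by (rule uniform_limit_on_subset[OF ul]) (use r in \<open>auto simp: W_def s_def\<close>)
      then show ?thesis unfolding uniform_limit_iff by fastforce
    qed
    have "(\<lambda>x. partial2 g (x, b)) holomorphic_on ball a (s/2)"
    proof (rule holomorphic_uniform_limit[OF _ ul1, THEN conjunct2])
      show "\<forall>\<^sub>F n in sequentially. continuous_on (cball a (s/2)) (\<lambda>x. q n (x, b)) \<and>
              (\<lambda>x. q n (x, b)) holomorphic_on ball a (s/2)"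
      proof (intro always_eventually allI conjI)
        fix n
        show "continuous_on (cball a (s/2)) (\<lambda>x. q n (x, b))"
          by (rule continuous_on_compose2[OF cq]) (use r in \<open>auto intro!: continuous_intros simp: W_def s_def\<close>)
        have "(\<lambda>x. q n (x, b)) field_differentiable at x" if "x \<in> ball a (s/2)" for x
        proof -
          have "(x, b) \<in> W" using that r by (auto simp: W_def s_def)
          then show ?thesis unfolding q_def fst_conv snd_conv
            by (intro field_differentiable_divide field_differentiable_diff g1 inU field_differentiable_const)
               (use e_ne in auto)
        qed
        then show "(\<lambda>x. q n (x, b)) holomorphic_on ball a (s/2)"
          by (auto simp: holomorphic_on_def field_differentiable_at_within)
      qed
    qed auto
    then have d1: "(\<lambda>x. partial2 g (x, b)) field_differentiable at a"
      by (rule holomorphic_on_imp_differentiable_at) (use r in \<open>auto simp: s_def\<close>)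
    have "(\<lambda>y. g (a, y)) holomorphic_on ball b r"
      unfolding holomorphic_on_def using r by (auto intro!: field_differentiable_at_within g2)
    then have "deriv (\<lambda>y. g (a, y)) holomorphic_on ball b r" by (rule holomorphic_deriv) auto
    then have d2: "(\<lambda>y. partial2 g (a, y)) field_differentiable at b"
      unfolding partial2_def fst_conv snd_conv
      by (rule holomorphic_on_imp_differentiable_at) (use r in \<open>auto simp: s_def\<close>)
    show ?thesis using c d1 d2 by blast
  qed
  show ?thesis unfolding separately_holomorphic_def
    using main by (auto intro!: continuous_at_imp_continuous_on)
qed

lemma separately_holomorphic_swap:
  assumes "separately_holomorphic g U"
  shows "separately_holomorphic (g \<circ> prod.swap) (prod.swap ` U)"
proof -
  have "continuous_on (prod.swap ` U) (g \<circ> prod.swap)"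
    using assms by (intro continuous_on_compose continuous_on_swap)
      (simp add: separately_holomorphic_def image_image)
  then show ?thesis
    using assms unfolding separately_holomorphic_def by auto
qed

lemma partial1_separately_holomorphic:
  assumes U: "open U" and g: "separately_holomorphic g U"
  shows "separately_holomorphic (partial1 g) U"
proof -
  have "open (prod.swap -` U)" using U by (intro open_vimage continuous_on_swap)
  also have "prod.swap -` U = prod.swap ` U" by (force simp: image_iff prod.swap_def)
  finally have "separately_holomorphic (partial2 (g \<circ> prod.swap)) (prod.swap ` U)"
    by (intro partial2_separately_holomorphic separately_holomorphic_swap g)
  from separately_holomorphic_swap[OF this] have "separately_holomorphic (partial2 (g \<circ> prod.swap) \<circ> prod.swap) U"
    by (simp add: image_image)
  moreover have "partial2 (g \<circ> prod.swap) \<circ> prod.swap = partial1 g"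
    by (auto simp: partial1_def partial2_def fun_eq_iff)
  ultimately show ?thesis by simp
qed

text \<open>Osgood's lemma. Both partial derivatives exist, and
  \<open>has_derivative_partialsI\<close> asks for continuity of one of them, here the
  second.\<close>

lemma separately_holomorphic_has_derivative:
  assumes U: "open U" and g: "separately_holomorphic g U" and p: "p \<in> U"
  shows "(g has_derivative (\<lambda>(h, k). partial1 g p * h + partial2 g p * k)) (at p)"
proof -
  obtain a b where ab: "p = (a, b)" by (cases p)
  obtain r where r: "r > 0" "cball a r \<times> cball b r \<subseteq> U"
    using open_contains_bidisc[OF U] p ab by auto
  have sub: "ball a r \<times> ball b r \<subseteq> U" using r by auto
  have g1: "\<And>x y. (x, y) \<in> U \<Longrightarrow> (\<lambda>x. g (x, y)) field_differentiable at x"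
    and g2: "\<And>x y. (x, y) \<in> U \<Longrightarrow> (\<lambda>y. g (x, y)) field_differentiable at y"
    using g unfolding separately_holomorphic_def by auto
  have c2: "continuous_on U (partial2 g)"
    using partial2_separately_holomorphic[OF U g] by (simp add: separately_holomorphic_def)
  have "((\<lambda>(x, y). g (x, y)) has_derivative (\<lambda>(h, k). partial1 g p * h + blinfun_mult_right (partial2 g (a, b)) k)) (at (a, b) within ball a r \<times> ball b r)"
  proof (rule has_derivative_partialsI[where fy = "\<lambda>x y. blinfun_mult_right (partial2 g (x, y))"])
    have "((\<lambda>x. g (x, b)) has_field_derivative partial1 g p) (at a)"
      using g1[of a b] p ab by (simp add: partial1_def DERIV_deriv_iff_field_differentiable)
    then show "((\<lambda>x. g (x, b)) has_derivative (*) (partial1 g p)) (at a within ball a r)"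
      unfolding has_field_derivative_def using has_derivative_at_withinI by blast
    fix x y assume "x \<in> ball a r" "y \<in> ball b r"
    then have "(x, y) \<in> U" using sub by auto
    from g2[OF this] have "((\<lambda>y. g (x, y)) has_field_derivative partial2 g (x, y)) (at y)"
      by (simp add: partial2_def DERIV_deriv_iff_field_differentiable)
    then show "((\<lambda>y. g (x, y)) has_derivative blinfun_apply (blinfun_mult_right (partial2 g (x, y)))) (at y within ball b r)"
      unfolding has_field_derivative_eq_has_derivative_blinfun using has_derivative_at_withinI by blast
  next
    have "continuous (at (a, b)) (\<lambda>p. partial2 g p)"
      using c2 U p ab by (simp add: continuous_on_eq_continuous_at)
    then have "continuous (at (a, b)) (\<lambda>p. blinfun_mult_right (partial2 g p))"
      using bounded_linear.continuous[OF bounded_linear_blinfun_mult_right] by blast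
    then show "continuous (at (a, b) within ball a r \<times> ball b r) (\<lambda>(x, y). blinfun_mult_right (partial2 g (x, y)))"
      by (simp add: case_prod_unfold continuous_at_imp_continuous_at_within)
  qed (use r in auto)
  moreover have "at (a, b) within ball a r \<times> ball b r = at (a, b)"
    using r by (intro at_within_open) (simp_all add: open_Times)
  ultimately show ?thesis unfolding ab by simp
qed

lemma holomorphic2_on_iff_separately:
  assumes "open U" shows "holomorphic2_on g U \<longleftrightarrow> separately_holomorphic g U"
  using holomorphic2_on_imp_separately separately_holomorphic_has_derivative[OF assms]
  unfolding holomorphic2_on_def by blast

lemma holomorphic2_has_derivative:
  assumes "open U" "holomorphic2_on g U" "p \<in> U"
  shows "(g has_derivative (\<lambda>(h, k). partial1 g p * h + partial2 g p * k)) (at p)"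
  using assms separately_holomorphic_has_derivative holomorphic2_on_iff_separately by blast

lemma holomorphic2_partial1: "open U \<Longrightarrow> holomorphic2_on g U \<Longrightarrow> holomorphic2_on (partial1 g) U"
  and holomorphic2_partial2: "open U \<Longrightarrow> holomorphic2_on g U \<Longrightarrow> holomorphic2_on (partial2 g) U"
  by (simp_all add: holomorphic2_on_iff_separately partial1_separately_holomorphic partial2_separately_holomorphic)

section \<open>Taylor series along curves\<close>

lemma holomorphic2_compose_curve:
  assumes g: "holomorphic2_on g U" and S: "open S" and u: "u holomorphic_on S" and v: "v holomorphic_on S"
    and sub: "\<And>t. t \<in> S \<Longrightarrow> (u t, v t) \<in> U"
  shows "(\<lambda>t. g (u t, v t)) holomorphic_on S"
proof -
  have "(\<lambda>t. g (u t, v t)) field_differentiable at t" if t: "t \<in> S" for t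
  proof -
    obtain a b where ab: "(g has_derivative (\<lambda>(h, k). a * h + b * k)) (at (u t, v t))"
      using holomorphic2_onD[OF g sub[OF t]] .
    have u': "(u has_derivative (*) (deriv u t)) (at t)" and v': "(v has_derivative (*) (deriv v t)) (at t)"
      using holomorphic_derivI[OF u S t] holomorphic_derivI[OF v S t] unfolding has_field_derivative_def by blast+
    have "((g \<circ> (\<lambda>t. (u t, v t))) has_derivative ((\<lambda>(h, k). a * h + b * k) \<circ> (\<lambda>h. (deriv u t * h, deriv v t * h)))) (at t)"
      by (rule diff_chain_at[OF has_derivative_Pair[OF u' v'] ab])
    then have "((\<lambda>t. g (u t, v t)) has_field_derivative (a * deriv u t + b * deriv v t)) (at t)"
      unfolding has_field_derivative_def o_def
      by (rule has_derivative_eq_rhs) (auto simp: fun_eq_iff algebra_simps)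
    then show ?thesis by (auto simp: field_differentiable_def)
  qed
  then show ?thesis
    by (simp add: holomorphic_on_def field_differentiable_at_within)
qed

lemma holomorphic2_compose_map:
  assumes g: "holomorphic2_on g V" and F: "holomorphic_map_on F U" and sub: "\<And>p. p \<in> U \<Longrightarrow> F p \<in> V"
  shows "holomorphic2_on (g \<circ> F) U"
  unfolding holomorphic2_on_def
proof
  fix p assume p: "p \<in> U"
  obtain a b where ab: "(g has_derivative (\<lambda>(h, k). a * h + b * k)) (at (F p))"
    using holomorphic2_onD[OF g sub[OF p]] .
  obtain a1 b1 where 1: "((fst \<circ> F) has_derivative (\<lambda>(h, k). a1 * h + b1 * k)) (at p)"
    using F p holomorphic2_onD unfolding holomorphic_map_on_def by blast
  obtain a2 b2 where 2: "((snd \<circ> F) has_derivative (\<lambda>(h, k). a2 * h + b2 * k)) (at p)"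
    using F p holomorphic2_onD unfolding holomorphic_map_on_def by blast
  have "(F has_derivative (\<lambda>z. (case z of (h, k) \<Rightarrow> a1 * h + b1 * k, case z of (h, k) \<Rightarrow> a2 * h + b2 * k))) (at p)"
    using has_derivative_Pair[OF 1 2] by (simp add: o_def)
  from diff_chain_at[OF this ab]
  have "((g \<circ> F) has_derivative (\<lambda>(h, k). (a * a1 + b * a2) * h + (a * b1 + b * b2) * k)) (at p)"
    by (rule has_derivative_eq_rhs) (auto simp: fun_eq_iff algebra_simps)
  then show "\<exists>a b. (g \<circ> F has_derivative (\<lambda>(h, k). a * h + b * k)) (at p)" by blast
qed

text \<open>The inner iterated derivative in \<open>taylor2\<close> is thus a slice of a function
  that is holomorphic in both variables, hence itself holomorphic in x.\<close>

lemma higher_partial2_eq: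
  "(partial2 ^^ j) g (x, y) = (deriv ^^ j) (\<lambda>y. g (x, y)) y"
proof (induction j arbitrary: y)
  case (Suc j)
  then have "(\<lambda>y. (partial2 ^^ j) g (x, y)) = (deriv ^^ j) (\<lambda>y. g (x, y))" by auto
  then show ?case by (simp add: partial2_def[of "(partial2 ^^ j) g"])
qed simp

lemma higher_partial2_holomorphic2:
  "open U \<Longrightarrow> holomorphic2_on g U \<Longrightarrow> holomorphic2_on ((partial2 ^^ j) g) U"
  by (induction j) (auto intro: holomorphic2_partial2)

lemma holomorphic_slice1:
  assumes "holomorphic2_on g U" "open S" "S \<times> {y} \<subseteq> U"
  shows "(\<lambda>x. g (x, y)) holomorphic_on S"
  by (rule holomorphic2_compose_curve[OF assms(1,2)]) (use assms(3) in \<open>auto intro!: holomorphic_intros\<close>)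

lemma holomorphic_slice2:
  assumes "holomorphic2_on g U" "open S" "{x} \<times> S \<subseteq> U"
  shows "(\<lambda>y. g (x, y)) holomorphic_on S"
  by (rule holomorphic2_compose_curve[OF assms(1,2)]) (use assms(3) in \<open>auto intro!: holomorphic_intros\<close>)

text \<open>Cauchy's estimate in y for fixed x, then in x for the coefficient obtained. The first
  bound is kept, uniformly in x, for expansions of \<open>g (x, y)\<close> in y while x moves along
  a curve.\<close>

lemma bidisc_derivative_bound:
  assumes U: "open U" and g: "holomorphic2_on g U" and R: "R > 0" "cball 0 R \<times> cball 0 R \<subseteq> U"
  obtains M where "M \<ge> 0"
    "\<And>x j. norm x \<le> R \<Longrightarrow> norm ((deriv ^^ j) (\<lambda>y. g (x, y)) 0 / fact j) \<le> M / R ^ j"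
    "\<And>i j. norm (taylor2 g $ i $ j) \<le> M / R ^ (i + j)"
proof -
  have "compact (g ` (cball 0 R \<times> cball 0 R))"
    by (intro compact_continuous_image compact_Times compact_cball
        continuous_on_subset[OF holomorphic2_on_imp_continuous_on[OF g] R(2)])
  then obtain M where M: "\<And>x y. x \<in> cball 0 R \<Longrightarrow> y \<in> cball 0 R \<Longrightarrow> norm (g (x, y)) \<le> M"
    by (metis bounded_iff compact_imp_bounded image_eqI mem_Sigma_iff)
  have M0: "M \<ge> 0" using M[of 0 0] R order_trans[OF norm_ge_zero] by simp
  have c: "norm ((deriv ^^ j) (\<lambda>y. g (x, y)) 0 / fact j) \<le> M / R ^ j" if x: "norm x \<le> R" for x j
  proof -
    have "norm ((deriv ^^ j) (\<lambda>y. g (x, y)) 0) \<le> fact j * M / R ^ j"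
    proof (rule Cauchy_inequality)
      show "(\<lambda>y. g (x, y)) holomorphic_on ball 0 R"
        by (rule holomorphic_slice2[OF g]) (use R x in auto)
      show "continuous_on (cball 0 R) (\<lambda>y. g (x, y))"
        by (rule continuous_on_compose2[OF holomorphic2_on_imp_continuous_on[OF g]])
           (use R x in \<open>auto intro!: continuous_intros\<close>)
    qed (use R x M in auto)
    then show ?thesis by (simp add: norm_divide field_simps)
  qed
  have t: "norm (taylor2 g $ i $ j) \<le> M / R ^ (i + j)" for i j
  proof -
    define k where "k = (\<lambda>x. (deriv ^^ j) (\<lambda>y. g (x, y)) 0)"
    have keq: "k = (\<lambda>x. (partial2 ^^ j) g (x, 0))" by (simp add: k_def higher_partial2_eq)
    note h2 = higher_partial2_holomorphic2[OF U g, of j]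
    have "norm ((deriv ^^ i) k 0) \<le> fact i * (fact j * (M / R ^ j)) / R ^ i"
    proof (rule Cauchy_inequality)
      show "k holomorphic_on ball 0 R" unfolding keq
        by (rule holomorphic_slice1[OF h2]) (use R in auto)
      show "continuous_on (cball 0 R) k" unfolding keq
        by (rule continuous_on_compose2[OF holomorphic2_on_imp_continuous_on[OF h2]])
           (use R in \<open>auto intro!: continuous_intros\<close>)
      fix x :: complex assume "norm (0 - x) = R"
      then show "norm (k x) \<le> fact j * (M / R ^ j)"
        using c[of x j] by (simp add: k_def norm_divide field_simps)
    qed (use R in auto)
    then show ?thesis
      by (simp add: taylor2_def k_def[symmetric] norm_divide norm_mult field_simps power_add)
  qed
  show ?thesis using that[OF M0 c t] .
qed

text \<open>Let d be the subdegree of \<open>D\<close>. Then f(t) / t^d tends to the nonzero number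
  \<open>D $ d\<close>, whereas the bound makes it tend to 0 if d \<le> n.\<close>

lemma fps_nth_eq_0_of_norm_bound:
  fixes f :: "complex \<Rightarrow> complex"
  assumes f: "f has_fps_expansion D" and b: "\<forall>\<^sub>F t in at 0. norm (f t) \<le> K * norm t ^ Suc n"
    and k: "k \<le> n"
  shows "D $ k = 0"
proof (rule ccontr)
  assume "D $ k \<noteq> 0"
  define d where "d = subdegree D"
  have d: "d \<le> n" "D $ d \<noteq> 0"
    using \<open>D $ k \<noteq> 0\<close> k subdegree_leI[of D k] unfolding d_def by auto
  define q where "q = (\<lambda>x. if x = 0 then D $ d else f x / x ^ d)"
  have "q has_fps_expansion fps_shift d D"
    unfolding q_def by (rule has_fps_expansion_shift[OF f]) (auto simp: d_def)
  then have "continuous (at 0) q" by (rule has_fps_expansion_imp_continuous)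
  then have lim: "(q \<longlongrightarrow> D $ d) (at 0)" by (simp add: isCont_def q_def)
  have "isCont (\<lambda>t::complex. K * norm t ^ Suc (n - d)) 0"
    by (intro continuous_intros)
  then have "((\<lambda>t::complex. K * norm t ^ Suc (n - d)) \<longlongrightarrow> 0) (at 0)" by (simp add: isCont_def)
  moreover have "\<forall>\<^sub>F t in at 0. norm (q t) \<le> K * norm t ^ Suc (n - d)"
    using b eventually_neq_at_within[of 0 0]
  proof eventually_elim
    case (elim t)
    have "norm t ^ Suc n = norm t ^ Suc (n - d) * norm t ^ d"
      using d by (simp flip: power_add)
    with elim show ?case
      by (simp add: q_def norm_divide norm_power field_simps del: power_Suc)
  qed
  ultimately have "(q \<longlongrightarrow> 0) (at 0)"
    by (rule Lim_null_comparison[rotated])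
  with lim have "D $ d = 0" using tendsto_unique by force
  with d show False by simp
qed

section \<open>Formal substitution as the expansion of an analytic composition\<close>

lemma fps_power_mult_nth_eq_0:
  fixes u v :: "'a::comm_ring_1 fps"
  assumes u: "u $ 0 = 0" and v: "v $ 0 = 0" and n: "n < i + j"
  shows "(u ^ i * v ^ j) $ n = 0"
proof -
  have "(u ^ i) $ l * (v ^ j) $ (n - l) = 0" if "l \<le> n" for l
    using that n startsby_zero_power_prefix[OF u, of i] startsby_zero_power_prefix[OF v, of j]
    by (cases "l < i") auto
  then show ?thesis by (simp add: fps_mult_nth)
qed

lemma sum_subst1_index:
  "(\<Sum>(i, j)\<in>{(i, j). i + j \<le> n}. f i j) = (\<Sum>j\<le>n. \<Sum>i\<le>n. if i + j \<le> n then f i j else (0::'a::comm_monoid_add))" for n :: nat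
proof -
  have "(\<Sum>(i, j)\<in>{(i, j). i + j \<le> n}. f i j) = (\<Sum>(i, j)\<in>{..n} \<times> {..n}. if i + j \<le> n then f i j else 0)"
    by (rule sum.mono_neutral_cong_left) (auto split: if_splits)
  also have "\<dots> = (\<Sum>i\<le>n. \<Sum>j\<le>n. if i + j \<le> n then f i j else 0)"
    by (simp add: sum.cartesian_product)
  also have "\<dots> = (\<Sum>j\<le>n. \<Sum>i\<le>n. if i + j \<le> n then f i j else 0)" by (rule sum.swap)
  finally show ?thesis .
qed

text \<open>Collecting terms by powers of v turns the substitution into finitely many compositions
  in one variable, which have an analytic counterpart. Any cut-off n \<ge> k is allowed because v^j
  has order at least j.\<close>

lemma subst1_nth_rows:
  assumes u: "u $ 0 = 0" and v: "v $ 0 = 0" and kn: "k \<le> n"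
  shows "subst1 f u v $ k = (\<Sum>j\<le>n. (Abs_fps (\<lambda>i. f $ i $ j) oo u) * v ^ j) $ k"
proof -
  have row: "((Abs_fps (\<lambda>i. f $ i $ j) oo u) * v ^ j) $ k = (\<Sum>i\<le>k. f $ i $ j * (u ^ i * v ^ j) $ k)" for j
  proof -
    have "((Abs_fps (\<lambda>i. f $ i $ j) oo u) * v ^ j) $ k = (\<Sum>l\<le>k. (\<Sum>i\<le>l. f $ i $ j * (u ^ i) $ l) * (v ^ j) $ (k - l))"
      by (simp add: fps_mult_nth fps_compose_nth atLeast0AtMost)
    also have "\<dots> = (\<Sum>l\<le>k. \<Sum>i\<le>k. f $ i $ j * (u ^ i) $ l * (v ^ j) $ (k - l))"
    proof (rule sum.cong[OF refl])
      fix l assume "l \<in> {..k}"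
      then have "(\<Sum>i\<le>l. f $ i $ j * (u ^ i) $ l) = (\<Sum>i\<le>k. f $ i $ j * (u ^ i) $ l)"
        by (intro sum.mono_neutral_left) (auto simp: startsby_zero_power_prefix[OF u, rule_format])
      then show "(\<Sum>i\<le>l. f $ i $ j * (u ^ i) $ l) * (v ^ j) $ (k - l) = (\<Sum>i\<le>k. f $ i $ j * (u ^ i) $ l * (v ^ j) $ (k - l))"
        by (simp add: sum_distrib_right)
    qed
    also have "\<dots> = (\<Sum>i\<le>k. f $ i $ j * (u ^ i * v ^ j) $ k)"
      by (subst sum.swap) (simp add: fps_mult_nth sum_distrib_left mult.assoc atLeast0AtMost)
    finally show ?thesis .
  qed
  have "subst1 f u v $ k = (\<Sum>j\<le>k. \<Sum>i\<le>k. f $ i $ j * (u ^ i * v ^ j) $ k)"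
    unfolding subst1_def fps_nth_Abs_fps sum_subst1_index
    by (intro sum.cong refl) (auto simp: fps_power_mult_nth_eq_0[OF u v])
  also have "\<dots> = (\<Sum>j\<le>n. \<Sum>i\<le>k. f $ i $ j * (u ^ i * v ^ j) $ k)"
    using kn by (intro sum.mono_neutral_left) (auto simp: fps_power_mult_nth_eq_0[OF u v])
  finally show ?thesis by (simp add: fps_sum_nth row)
qed

text \<open>The tail is dominated by a geometric series of ratio |y| / R \<le> 1/2; its sum is the
  factor 2.\<close>

lemma power_series_remainder_bound:
  fixes a :: "nat \<Rightarrow> complex"
  assumes a: "\<And>j. norm (a j) \<le> M / R ^ j" and R: "R > 0" and M: "M \<ge> 0" and y: "norm y \<le> R / 2"
    and s: "(\<lambda>j. a j * y ^ j) sums S"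
  shows "norm (S - (\<Sum>j\<le>n. a j * y ^ j)) \<le> 2 * M / R ^ Suc n * norm y ^ Suc n"
proof -
  have sm: "summable (\<lambda>j. a (j + Suc n) * y ^ (j + Suc n))"
    using s by (intro summable_ignore_initial_segment) (simp add: sums_iff)
  have "S = (\<Sum>j. a (j + Suc n) * y ^ (j + Suc n)) + (\<Sum>j<Suc n. a j * y ^ j)"
    using s suminf_split_initial_segment[of "\<lambda>j. a j * y ^ j" "Suc n"] by (simp add: sums_iff)
  then have eq: "S - (\<Sum>j\<le>n. a j * y ^ j) = (\<Sum>j. a (j + Suc n) * y ^ (j + Suc n))"
    by (simp add: lessThan_Suc_atMost)
  have b: "norm (a (j + Suc n) * y ^ (j + Suc n)) \<le> (M / R ^ Suc n * norm y ^ Suc n) * (1/2) ^ j" for j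
  proof -
    have "norm (a (j + Suc n) * y ^ (j + Suc n)) \<le> M / R ^ (j + Suc n) * norm y ^ (j + Suc n)"
      unfolding norm_mult norm_power by (intro mult_right_mono a) simp
    also have "\<dots> = (M / R ^ Suc n * norm y ^ Suc n) * (norm y / R) ^ j"
      by (simp add: power_add power_divide ac_simps)
    also have "\<dots> \<le> (M / R ^ Suc n * norm y ^ Suc n) * (1/2) ^ j"
      using y R M by (intro mult_left_mono power_mono) (auto simp: field_simps)
    finally show ?thesis .
  qed
  have g: "(\<lambda>j. (M / R ^ Suc n * norm y ^ Suc n) * (1/2::real) ^ j) sums ((M / R ^ Suc n * norm y ^ Suc n) * (1 / (1 - 1/2)))"
    by (intro sums_mult geometric_sums) simp
  have "norm (\<Sum>j. a (j + Suc n) * y ^ (j + Suc n)) \<le> (\<Sum>j. (M / R ^ Suc n * norm y ^ Suc n) * (1/2) ^ j)"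
    by (rule norm_suminf_le) (use g b in \<open>auto simp: sums_iff\<close>)
  also have "\<dots> = 2 * M / R ^ Suc n * norm y ^ Suc n" using g by (simp add: sums_iff)
  finally show ?thesis unfolding eq .
qed

text \<open>For a given n, expand \<open>g (u t, y)\<close> in y and cut after the n-th power. The
  part kept is a finite sum of one-variable compositions and has the formal coefficients; the
  remainder is O(t^(n+1)) because v(t) = O(t), so it does not reach coefficient n. No double series
  has to be rearranged.\<close>

lemma subst1_taylor2_expansion:
  assumes U: "open U" "0 \<in> U" and g: "holomorphic2_on g U"
    and u: "u has_fps_expansion fu" "fu $ 0 = 0" and v: "v has_fps_expansion fv" "fv $ 0 = 0"
  shows "(\<lambda>t. g (u t, v t)) has_fps_expansion subst1 (taylor2 g) fu fv"
proof -
  obtain R where R: "R > 0" "cball 0 R \<times> cball 0 R \<subseteq> U"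
    using open_contains_bidisc[OF U(1), of 0 0] U(2) by (auto simp: zero_prod_def)
  obtain M where M: "M \<ge> 0"
      "\<And>x j. norm x \<le> R \<Longrightarrow> norm ((deriv ^^ j) (\<lambda>y. g (x, y)) 0 / fact j) \<le> M / R ^ j"
    using bidisc_derivative_bound[OF U(1) g R] by metis
  define c where "c = (\<lambda>j x. (deriv ^^ j) (\<lambda>y. g (x, y)) 0 / fact j)"
  define row where "row = (\<lambda>j. Abs_fps (\<lambda>i. taylor2 g $ i $ j))"
  have c_exp: "c j has_fps_expansion row j" for j
  proof -
    have "(\<lambda>x. (partial2 ^^ j) g (x, 0)) holomorphic_on ball 0 R"
      by (rule holomorphic_slice1[OF higher_partial2_holomorphic2[OF U(1) g]]) (use R in auto)
    then have "(\<lambda>x. (deriv ^^ j) (\<lambda>y. g (x, y)) 0) has_fps_expansion fps_expansion (\<lambda>x. (deriv ^^ j) (\<lambda>y. g (x, y)) 0) 0"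
      using R(1) by (intro has_fps_expansion_fps_expansion[of "ball 0 R"]) (simp_all add: higher_partial2_eq)
    from has_fps_expansion_cmult_left[OF this, of "1 / fact j"]
    have "c j has_fps_expansion fps_const (1 / fact j) * fps_expansion (\<lambda>x. (deriv ^^ j) (\<lambda>y. g (x, y)) 0) 0"
      by (simp add: c_def)
    also have "fps_const (1 / fact j) * fps_expansion (\<lambda>x. (deriv ^^ j) (\<lambda>y. g (x, y)) 0) 0 = row j"
      by (simp add: fps_eq_iff row_def taylor2_def fps_expansion_def)
    finally show ?thesis .
  qed
  obtain Su where Su: "open Su" "0 \<in> Su" "u holomorphic_on Su"
    using has_fps_expansion_imp_holomorphic[OF u(1)] by metis
  obtain Sv where Sv: "open Sv" "0 \<in> Sv" "v holomorphic_on Sv"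
    using has_fps_expansion_imp_holomorphic[OF v(1)] by metis
  have u0: "(u \<longlongrightarrow> 0) (nhds 0)" and v0: "(v \<longlongrightarrow> 0) (nhds 0)"
    using has_fps_expansion_imp_tendsto_0[OF u(1)] has_fps_expansion_imp_tendsto_0[OF v(1)] u(2) v(2) by auto
  have evu: "\<forall>\<^sub>F t in nhds 0. norm (u t) < R / 2" and evv: "\<forall>\<^sub>F t in nhds 0. norm (v t) < R / 2"
    using R(1) order_tendstoD(2)[OF tendsto_norm_zero[OF u0], of "R/2"] order_tendstoD(2)[OF tendsto_norm_zero[OF v0], of "R/2"]
    by auto
  have "\<forall>\<^sub>F t in nhds 0. t \<in> Su \<and> t \<in> Sv \<and> norm (u t) < R / 2 \<and> norm (v t) < R / 2"
    using evu evv eventually_nhds_in_open[OF Su(1,2)] eventually_nhds_in_open[OF Sv(1,2)]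
    by (intro eventually_conj)
  then obtain S where S: "open S" "0 \<in> S"
    "\<And>t. t \<in> S \<Longrightarrow> t \<in> Su \<and> t \<in> Sv \<and> norm (u t) < R / 2 \<and> norm (v t) < R / 2"
    unfolding eventually_nhds by blast
  define f where "f = (\<lambda>t. g (u t, v t))"
  have "f holomorphic_on S" unfolding f_def
  proof (rule holomorphic2_compose_curve[OF g S(1)])
    show "u holomorphic_on S" "v holomorphic_on S"
      using Su(3) Sv(3) S(3) by (auto intro: holomorphic_on_subset)
    show "(u t, v t) \<in> U" if "t \<in> S" for t
      using S(3)[OF that] R by (intro subsetD[OF R(2)]) auto
  qed
  then have f_exp: "f has_fps_expansion fps_expansion f 0"
    using S by (intro has_fps_expansion_fps_expansion)
  have "fps_expansion f 0 $ n = subst1 (taylor2 g) fu fv $ n" for n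
  proof -
    define p where "p = (\<lambda>t. \<Sum>j\<le>n. c j (u t) * v t ^ j)"
    define P where "P = (\<Sum>j\<le>n. (row j oo fu) * fv ^ j)"
    have "(\<lambda>t. c j (u t)) has_fps_expansion (row j oo fu)" for j
      using has_fps_expansion_compose[OF c_exp u] by (simp add: o_def)
    then have "p has_fps_expansion P"
      unfolding p_def P_def
      by (intro has_fps_expansion_sum has_fps_expansion_mult has_fps_expansion_power v(1))
    then have D: "(\<lambda>t. f t - p t) has_fps_expansion fps_expansion f 0 - P"
      by (intro has_fps_expansion_diff f_exp)
    \<comment> \<open>As v vanishes at 0, the quotient v(t) / t has the limit
      \<open>fv $ 1\<close>.\<close>
    obtain B where B: "\<forall>\<^sub>F t in at 0. norm (v t) \<le> B * norm t"
    proof -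
      have "(\<lambda>x. if x = 0 then fv $ 1 else v x / x ^ 1) has_fps_expansion fps_shift 1 fv"
      proof (cases "fv = 0")
        case True
        have "\<forall>\<^sub>F t in nhds 0. v t = 0" using v(1) unfolding True by (simp add: has_fps_expansion_0_iff)
        then have "\<forall>\<^sub>F x in nhds 0. (if x = 0 then fv $ 1 else v x / x ^ 1) = 0"
          by eventually_elim (simp add: True)
        then show ?thesis unfolding True fps_shift_zero by (simp add: has_fps_expansion_0_iff)
      next
        case False
        then have "1 \<le> subdegree fv" using v(2)
          by (metis One_nat_def Suc_leI nth_subdegree_nonzero not_gr_zero)
        then show ?thesis by (intro has_fps_expansion_shift[OF v(1)]) auto
      qed
      then have "continuous (at 0) (\<lambda>x. if x = 0 then fv $ 1 else v x / x ^ 1)"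
        by (rule has_fps_expansion_imp_continuous)
      then have "((\<lambda>x. if x = 0 then fv $ 1 else v x / x ^ 1) \<longlongrightarrow> fv $ 1) (at 0)"
        by (simp add: isCont_def)
      then have "\<forall>\<^sub>F x in at 0. norm (if x = 0 then fv $ 1 else v x / x ^ 1) < norm (fv $ 1) + 1"
        using order_tendstoD(2)[OF tendsto_norm] by (metis less_add_one)
      then have "\<forall>\<^sub>F t in at 0. norm (v t) \<le> (norm (fv $ 1) + 1) * norm t"
        using eventually_neq_at_within[of 0 0]
        by eventually_elim (auto simp: norm_divide field_simps)
      then show ?thesis using that by blast
    qed
    have "\<forall>\<^sub>F t in at 0. norm (f t - p t) \<le> (2 * M / R ^ Suc n * \<bar>B\<bar> ^ Suc n) * norm t ^ Suc n"
      using B eventually_nhds_in_open[OF S(1,2), THEN eventually_nhds_conv_at[THEN iffD1, THEN conjunct1]]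
    proof eventually_elim
      case (elim t)
      have St: "norm (u t) < R / 2" "norm (v t) < R / 2" using S(3)[OF elim(2)] by auto
      have "(\<lambda>j. (deriv ^^ j) (\<lambda>y. g (u t, y)) 0 / fact j * (v t - 0) ^ j) sums g (u t, v t)"
      proof (rule holomorphic_power_series)
        show "(\<lambda>y. g (u t, y)) holomorphic_on ball 0 R"
          by (rule holomorphic_slice2[OF g]) (use R St in auto)
        show "v t \<in> ball 0 R" using St R(1) by simp
      qed
      then have "(\<lambda>j. c j (u t) * v t ^ j) sums f t" by (simp add: c_def f_def)
      then have "norm (f t - p t) \<le> 2 * M / R ^ Suc n * norm (v t) ^ Suc n"
        unfolding p_def
        by (intro power_series_remainder_bound) (use M R St in \<open>auto simp: c_def\<close>)
      also have "\<dots> \<le> 2 * M / R ^ Suc n * (\<bar>B\<bar> * norm t) ^ Suc n"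
      proof (intro mult_left_mono power_mono)
        show "norm (v t) \<le> \<bar>B\<bar> * norm t"
          using elim(1) mult_right_mono[OF abs_ge_self[of B] norm_ge_zero[of t]] by linarith
      qed (use M R in auto)
      finally show ?case by (simp only: power_mult_distrib mult.assoc)
    qed
    from fps_nth_eq_0_of_norm_bound[OF D this order_refl]
    have "fps_expansion f 0 $ n = P $ n" by simp
    also have "\<dots> = subst1 (taylor2 g) fu fv $ n"
      unfolding P_def row_def using subst1_nth_rows[OF u(2) v(2) order_refl, of "taylor2 g"] by simp
    finally show ?thesis .
  qed
  then have "fps_expansion f 0 = subst1 (taylor2 g) fu fv" by (simp add: fps_eq_iff)
  with f_exp show ?thesis by (simp add: f_def)
qed

text \<open>Formal data depend on the germ only, so any representative may be used for them.\<close>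

lemma taylor2_cong:
  assumes "\<forall>\<^sub>F p in nhds 0. g p = h p"
  shows "taylor2 g = taylor2 h"
proof -
  obtain W where W: "open W" "0 \<in> W" "\<And>p. p \<in> W \<Longrightarrow> g p = h p"
    using assms unfolding eventually_nhds by blast
  obtain r where r: "r > 0" "cball 0 r \<times> cball 0 r \<subseteq> W"
    using open_contains_bidisc[OF W(1), of 0 0] W(2) by (auto simp: zero_prod_def)
  have "\<forall>\<^sub>F x in nhds 0. (deriv ^^ j) (\<lambda>y. g (x, y)) 0 = (deriv ^^ j) (\<lambda>y. h (x, y)) 0" for j
  proof -
    have "(deriv ^^ j) (\<lambda>y. g (x, y)) 0 = (deriv ^^ j) (\<lambda>y. h (x, y)) 0" if x: "x \<in> ball 0 r" for x
    proof (rule higher_deriv_cong_ev)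
      have "\<forall>\<^sub>F y in nhds 0. y \<in> ball 0 r" using r(1) by (intro eventually_nhds_in_open) auto
      then show "\<forall>\<^sub>F y in nhds 0. g (x, y) = h (x, y)"
        by eventually_elim (use x r in \<open>auto intro!: W(3) subsetD[OF r(2)]\<close>)
    qed simp
    moreover have "\<forall>\<^sub>F x in nhds 0. x \<in> ball (0::complex) r" using r(1) by (intro eventually_nhds_in_open) auto
    ultimately show ?thesis by (auto elim: eventually_mono)
  qed
  then have "(deriv ^^ i) (\<lambda>x. (deriv ^^ j) (\<lambda>y. g (x, y)) 0) 0 = (deriv ^^ i) (\<lambda>x. (deriv ^^ j) (\<lambda>y. h (x, y)) 0) 0" for i j
    by (intro higher_deriv_cong_ev) auto
  then show ?thesis by (simp add: taylor2_def)
qed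

section \<open>Majorants for small divisors\<close>

text \<open>S stands for the indices with a small divisor: f must gain a unit whenever a sum lands
  in S, yet grow linearly. The basic function is 0 below m and 2k/m - 1 from m on; this leaves a
  unit to spare when both summands are at least m. A summand l < m contributes 0, and then a sum k +
  l \<in> S lies within m of k. Hence f is capped by 2\<kappa>/m - 2 on the window of length m
  before each \<kappa> \<in> S, which creates a unit jump at \<kappa>.\<close>

lemma davie_function:
  fixes m :: real and S :: "nat set"
  assumes m: "m > 0" and S: "\<And>k. k \<in> S \<Longrightarrow> m \<le> real k"
    and gap: "\<And>k l. k \<in> S \<Longrightarrow> l \<in> S \<Longrightarrow> k < l \<Longrightarrow> m \<le> real l - real k"
  obtains f :: "nat \<Rightarrow> real" where
    "\<And>k. 0 \<le> f k" "\<And>k. f k \<le> 2 * real k / m"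
    "\<And>k l. f k + f l + (if k + l \<in> S \<and> 0 < k \<and> 0 < l then 1 else 0) \<le> f (k + l)"
proof -
  \<comment> \<open>\<open>T k \<kappa>\<close> says that k lies in the window before \<kappa>; the
    gap condition makes \<kappa> unique.\<close>
  define T where "T = (\<lambda>k \<kappa>. \<kappa> \<in> S \<and> k < \<kappa> \<and> real \<kappa> < real k + m)"
  define f where "f = (\<lambda>k. if real k < m then 0
     else min (2 * (real k / m) - 1) (if \<exists>\<kappa>. T k \<kappa> then 2 * (real (SOME \<kappa>. T k \<kappa>) / m) - 2 else 2 * (real k / m) - 1))"
  have T_unique: "\<kappa> = \<kappa>'" if "T k \<kappa>" "T k \<kappa>'" for k \<kappa> \<kappa>'
    using gap[of \<kappa> \<kappa>'] gap[of \<kappa>' \<kappa>] that unfolding T_def by linarith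
  have f0: "f k = 0" if "real k < m" for k using that by (simp add: f_def)
  have fA: "f k \<le> 2 * (real \<kappa> / m) - 2" if "real k \<ge> m" "T k \<kappa>" for k \<kappa>
  proof -
    have "(SOME \<kappa>. T k \<kappa>) = \<kappa>" using T_unique that(2) by (metis someI)
    then show ?thesis using that by (auto simp: f_def)
  qed
  have fB: "f k \<le> 2 * (real k / m) - 1" if "real k \<ge> m" for k using that by (auto simp: f_def)
  have fC: "f k = 2 * (real k / m) - 1 \<or> (\<exists>\<kappa>. T k \<kappa> \<and> f k = 2 * (real \<kappa> / m) - 2)" if "real k \<ge> m" for k
  proof (cases "\<exists>\<kappa>. T k \<kappa>")
    case True
    then have "T k (SOME \<kappa>. T k \<kappa>)" by (rule someI_ex)
    with that True show ?thesis by (auto simp: f_def min_def)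
  next
    case False
    then have "T k = (\<lambda>_. False)" by auto
    with that show ?thesis by (simp add: f_def)
  qed
  have div: "real k / m \<ge> 1 \<longleftrightarrow> real k \<ge> m" for k using m by (simp add: field_simps)
  have f_nonneg: "0 \<le> f k" for k
  proof (cases "real k < m")
    case False
    then have k: "real k / m \<ge> 1" using div by simp
    from fC[of k] False consider "f k = 2 * (real k / m) - 1" | \<kappa> where "T k \<kappa>" "f k = 2 * (real \<kappa> / m) - 2"
      by auto
    then show ?thesis
    proof cases
      case 2
      then have "real \<kappa> / m \<ge> 1" using S div by (simp add: T_def)
      with 2 show ?thesis by simp
    qed (use k in simp)
  qed (simp add: f0)
  have f_le: "f k \<le> 2 * real k / m" for k
    using f0[of k] fB[of k] m by (cases "real k < m") auto
  have super: "f k + f l + (if k + l \<in> S \<and> 0 < k \<and> 0 < l then 1 else 0) \<le> f (k + l)"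
    if lk: "l \<le> k" for k l
  \<comment> \<open>In these cases no unit is due: it requires a positive l and a sum in S, and
    elements of S are at least m.\<close>
  proof (cases "l = 0 \<or> real (k + l) < m")
    case True
    then show ?thesis using f0[of k] f0[of l] f0[of "k + l"] m S[of "k + l"] by auto
  next
    case False
    then have l: "l > 0" and n: "real (k + l) \<ge> m" by auto
    define K L where "K = real k / m" and "L = real l / m"
    have KL: "real (k + l) / m = K + L" by (simp add: K_def L_def add_divide_distrib)
    have K1: "K \<ge> 1 \<longleftrightarrow> real k \<ge> m" and L1: "L \<ge> 1 \<longleftrightarrow> real l \<ge> m" using div by (auto simp: K_def L_def)
    have pos: "L > 0" "K > 0" using l lk m by (auto simp: K_def L_def)
    have KLge: "K + L \<ge> 1" using n unfolding div[symmetric] KL .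
    have kB: "f k \<le> 2 * K - 1" if "K \<ge> 1" using fB[of k] that K1 by (simp add: K_def)
    have lB: "f l \<le> 2 * L - 1" if "L \<ge> 1" using fB[of l] that L1 by (simp add: L_def)
    have k0: "f k = 0" if "K < 1" using f0[of k] that K1 by auto
    have l0: "f l = 0" if "L < 1" using f0[of l] that L1 by auto
    have KL': "L \<le> K" using lk m by (simp add: K_def L_def divide_right_mono)
    from fC[OF n] show ?thesis
    proof (elim disjE exE conjE)
      assume "f (k + l) = 2 * (real (k + l) / m) - 1"
      then have fn: "f (k + l) = 2 * (K + L) - 1" unfolding KL .
      show ?thesis
      proof (cases "L \<ge> 1")
        case True
        then show ?thesis using fn kB lB KL KL' by auto
      next
        case Ll: False
        show ?thesis
        proof (cases "K \<ge> 1")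
          case True
          have "f k \<le> 2 * (K + L) - 2" if "k + l \<in> S"
          proof -
            have "T k (k + l)" using that l Ll L1 by (auto simp: T_def)
            from fA[OF _ this] True K1 show ?thesis unfolding KL by simp
          qed
          then show ?thesis using kB[OF True] l0 Ll fn KL pos by auto
        next
          case False
          then show ?thesis using k0 l0 Ll fn KL KLge by auto
        qed
      qed
    next
      fix \<kappa> assume "T (k + l) \<kappa>" "f (k + l) = 2 * (real \<kappa> / m) - 2"
      define Q where "Q = real \<kappa> / m"
      have \<kappa>: "T (k + l) \<kappa>" "f (k + l) = 2 * Q - 2" by (fact, unfold Q_def, fact)
      \<comment> \<open>A point in the window of \<kappa> is closer than m to \<kappa> and so is not
        in S itself; plain superadditivity remains to be shown.\<close>
      have notS: "k + l \<notin> S" using \<kappa>(1) gap[of "k + l" \<kappa>] by (auto simp: T_def)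
      have kap: "Q \<ge> K + L" "Q \<ge> 1"
      proof -
        have "real (k + l) / m \<le> real \<kappa> / m"
          using \<kappa>(1) m by (intro divide_right_mono) (auto simp: T_def)
        then show "Q \<ge> K + L" unfolding Q_def KL .
        show "Q \<ge> 1" unfolding Q_def div using \<kappa>(1) S by (auto simp: T_def)
      qed
      have "f k + f l \<le> f (k + l)"
      proof (cases "L \<ge> 1")
        case True
        then show ?thesis using kB lB KL' kap \<kappa>(2) by auto
      next
        case Ll: False
        show ?thesis
        proof (cases "K \<ge> 1")
          case True
          show ?thesis
          proof (cases "real \<kappa> < real k + m")
            case True
            then have "T k \<kappa>" using \<kappa>(1) by (auto simp: T_def)
            from fA[OF _ this] \<open>K \<ge> 1\<close> K1 \<kappa>(2) l0 Ll show ?thesis by (simp add: Q_def[symmetric])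
          next
            case False
            then have "(real k + m) / m \<le> real \<kappa> / m" using m by (intro divide_right_mono) auto
            then have "Q \<ge> K + 1" using m by (simp add: Q_def K_def add_divide_distrib)
            then show ?thesis using kB[OF True] l0 Ll \<kappa>(2) by simp
          qed
        next
          case False
          then show ?thesis using k0 l0 Ll \<kappa>(2) kap by simp
        qed
      qed
      then show ?thesis using notS by simp
    qed
  qed
  have "f k + f l + (if k + l \<in> S \<and> 0 < k \<and> 0 < l then 1 else 0) \<le> f (k + l)" for k l
    using super[of l k] super[of k l] by (cases "l \<le> k") (auto simp: add.commute)
  with that f_nonneg f_le show ?thesis by blast
qed

text \<open>
  Rather than counting small divisors in trees, the divisors are absorbed by a superadditive
  function of linear growth (an idea of Davie).
\<close>

lemma superadditive_absorbs_divisors: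
  fixes e q w :: "nat \<Rightarrow> real"
  assumes q: "\<And>j. q j > 0" "\<And>B. \<exists>j. q j > B" and w: "\<And>j. 0 < w j" "\<And>j. w j \<le> 1"
    and sm: "summable (\<lambda>j. ln (1 / w (Suc j)) / q j)"
    and small: "\<And>j k. k0 \<le> k \<Longrightarrow> e k < w j \<Longrightarrow> q j \<le> real k"
    and gap: "\<And>j k l. k0 \<le> k \<Longrightarrow> k < l \<Longrightarrow> e k < w j \<Longrightarrow> e l < w j \<Longrightarrow> q j \<le> real l - real k"
  obtains E :: "nat \<Rightarrow> real" and C where "\<And>k. E k \<le> C * real k"
    "\<And>k l. 0 < k \<Longrightarrow> 0 < l \<Longrightarrow> E k + E l \<le> E (k + l)"
    "\<And>k l. 0 < k \<Longrightarrow> 0 < l \<Longrightarrow> k0 \<le> k + l \<Longrightarrow> E k + E l + ln (1 / e (k + l)) \<le> E (k + l)"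
    "\<And>k. k0 \<le> k \<Longrightarrow> e k > 0"
proof -
  define S where "S = (\<lambda>j. {k. k0 \<le> k \<and> e k < w j})"
  have "\<forall>j. \<exists>f :: nat \<Rightarrow> real. (\<forall>k. 0 \<le> f k) \<and> (\<forall>k. f k \<le> 2 * real k / q j) \<and>
     (\<forall>k l. f k + f l + (if k + l \<in> S j \<and> 0 < k \<and> 0 < l then 1 else 0) \<le> f (k + l))"
  proof
    fix j
    have a: "q j \<le> real k" if "k \<in> S j" for k using that small by (auto simp: S_def)
    have b: "q j \<le> real l - real k" if "k \<in> S j" "l \<in> S j" "k < l" for k l
      using that gap[of k l j] by (auto simp: S_def)
    show "\<exists>f :: nat \<Rightarrow> real. (\<forall>k. 0 \<le> f k) \<and> (\<forall>k. f k \<le> 2 * real k / q j) \<and>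
     (\<forall>k l. f k + f l + (if k + l \<in> S j \<and> 0 < k \<and> 0 < l then 1 else 0) \<le> f (k + l))"
      by (rule davie_function[OF q(1) a b]) blast+
  qed
  then obtain f :: "nat \<Rightarrow> nat \<Rightarrow> real" where f: "\<And>j k. 0 \<le> f j k" "\<And>j k. f j k \<le> 2 * real k / q j"
     "\<And>j k l. f j k + f j l + (if k + l \<in> S j \<and> 0 < k \<and> 0 < l then 1 else 0) \<le> f j (k + l)"
    by metis
  define L where "L = (\<lambda>j. ln (1 / w j))"
  have L0: "L j \<ge> 0" for j using w by (simp add: L_def)
  define X where "X = (\<Sum>j. L (Suc j) / q j)"
  have fL: "f j k * L (Suc j) \<le> 2 * real k * (L (Suc j) / q j)" "0 \<le> f j k * L (Suc j)" for j k
    using mult_right_mono[OF f(2)[of j k] L0[of "Suc j"]] f(1) L0 by (auto simp: field_simps)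
  have sm': "summable (\<lambda>j. f j k * L (Suc j))" for k
  proof (rule summable_comparison_test')
    show "summable (\<lambda>j. 2 * real k * (L (Suc j) / q j))"
      using sm by (intro summable_mult) (simp add: L_def)
    show "norm (f j k * L (Suc j)) \<le> 2 * real k * (L (Suc j) / q j)" if "j \<ge> 0" for j
      using fL by simp
  qed
  \<comment> \<open>Let j be the least index with w j \<le> e k. If j = i + 1, then k is in
    \<open>S i\<close> and ln (1 / e k) \<le> L (i + 1): hence the shifted weight. It is the shift
    between q_k and \<Omega>(q_(k+1)) in the Bruno series.\<close>
  define G where "G = (\<lambda>k. \<Sum>j. f j k * L (Suc j))"
  have G_le: "G k \<le> 2 * real k * X" for k
  proof -
    have "G k \<le> (\<Sum>j. 2 * real k * (L (Suc j) / q j))" unfolding G_def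
      using sm sm' fL by (intro suminf_le summable_mult) (auto simp: L_def)
    also have "\<dots> = 2 * real k * X" unfolding X_def
      using sm by (intro suminf_mult) (simp add: L_def)
    finally show ?thesis .
  qed
  have G_term: "G k + G l + L (Suc i) * (if k + l \<in> S i then 1 else 0) \<le> G (k + l)" if kl: "0 < k" "0 < l" for k l i
  proof -
    have s: "summable (\<lambda>j. if j = i then L (Suc i) * (if k + l \<in> S i then 1 else 0) else 0)"
      by (rule summable_finite[of "{i}"]) auto
    have "G k + G l + L (Suc i) * (if k + l \<in> S i then 1 else 0)
       = (\<Sum>j. f j k * L (Suc j) + f j l * L (Suc j) + (if j = i then L (Suc i) * (if k + l \<in> S i then 1 else 0) else 0))"
      unfolding G_def using suminf_add[OF summable_add[OF sm' sm'] s, of k l] suminf_add[OF sm' sm', of k l]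
        suminf_finite[of "{i}" "\<lambda>j. if j = i then L (Suc i) * (if k + l \<in> S i then 1 else 0) else 0"] by simp
    also have "\<dots> \<le> G (k + l)" unfolding G_def
    proof (intro suminf_le summable_add sm' s)
      fix j
      have "(f j k + f j l + (if k + l \<in> S j then 1 else 0)) * L (Suc j) \<le> f j (k + l) * L (Suc j)"
        using f(3)[of j k l] kl L0 by (intro mult_right_mono) auto
      then show "f j k * L (Suc j) + f j l * L (Suc j) + (if j = i then L (Suc i) * (if k + l \<in> S i then 1 else 0) else 0)
          \<le> f j (k + l) * L (Suc j)"
        using L0[of "Suc j"] by (auto simp: algebra_simps split: if_splits)
    qed
    finally show ?thesis .
  qed
  have ex: "\<exists>j. w j \<le> e k" if "k0 \<le> k" for k
    using q(2)[of "real k"] small[OF that] by (meson not_less)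
  \<comment> \<open>The second term gains L 0 at every addition, since (k - 1) + (l - 1) + 1 = k + l
    - 1. This pays for the divisors that are at least w 0.\<close>
  define E where "E = (\<lambda>k. G k + (real k - 1) * L 0)"
  have sup: "E k + E l + L 0 \<le> E (k + l)" if "0 < k" "0 < l" for k l
  proof -
    have "L (Suc 0) * (if k + l \<in> S 0 then 1 else 0) \<ge> 0" using L0 by simp
    then have "G k + G l \<le> G (k + l)" using G_term[OF that, of 0] by linarith
    then show ?thesis by (simp add: E_def algebra_simps)
  qed
  show ?thesis
  proof (rule that[of E "2 * X + L 0"])
    show "E k \<le> (2 * X + L 0) * real k" for k
      using G_le[of k] L0[of 0] by (simp add: E_def algebra_simps)
    show "E k + E l \<le> E (k + l)" if "0 < k" "0 < l" for k l
      using sup[OF that] L0[of 0] by linarith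
    show "e k > 0" if "k0 \<le> k" for k
      using ex[OF that] w(1) by (meson less_le_trans)
    fix k l :: nat assume kl: "0 < k" "0 < l" "k0 \<le> k + l"
    define j where "j = (LEAST j. w j \<le> e (k + l))"
    have j: "w j \<le> e (k + l)" unfolding j_def using ex[OF kl(3)] by (rule LeastI_ex)
    have le: "ln (1 / e (k + l)) \<le> L j"
      using j w(1)[of j] by (auto simp: L_def intro!: ln_mono frac_le)
    show "E k + E l + ln (1 / e (k + l)) \<le> E (k + l)"
    proof (cases j)
      case 0
      then show ?thesis using sup[OF kl(1,2)] le by simp
    next
      case (Suc i)
      then have "\<not> w i \<le> e (k + l)" unfolding j_def by (metis not_less_Least lessI)
      then have "k + l \<in> S i" using kl by (simp add: S_def)
      then have "G k + G l + L (Suc i) \<le> G (k + l)" using G_term[OF kl(1,2), of i] by simp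
      then show ?thesis using le Suc L0[of 0] by (simp add: E_def algebra_simps)
    qed
  qed
qed

text \<open>With P = a + 1 and R = k - a + 1 one has (k + 2) / (P R) = 1/P + 1/R, which splits the
  product into two sums, each bounded by telescoping. The weight 1/(n+1)^2 makes a product of power
  series cost no more than a factor 4.\<close>

lemma sum_inverse_squares_convolution:
  "(\<Sum>a = 1..<k. 1 / ((real a + 1)\<^sup>2 * (real (k - a) + 1)\<^sup>2)) \<le> 4 / (real k + 1)\<^sup>2"
proof -
  have sq: "(\<Sum>a = 1..<n. 1 / (real a + 1)\<^sup>2) \<le> 1 - 1 / real n" if "n \<ge> 1" for n
    using that
  proof (induction n rule: nat_induct_at_least)
    case (Suc n)
    have "1 / (real n + 1)\<^sup>2 \<le> 1 / (real n * (real n + 1))"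
      using Suc(1) by (intro frac_le) (auto simp: power2_eq_square)
    also have "\<dots> = 1 / real n - 1 / (real n + 1)"
      using Suc(1) by (simp add: field_simps)
    finally have "1 / (real n + 1)\<^sup>2 \<le> 1 / real n - 1 / (real n + 1)" .
    then show ?case using Suc by (simp add: algebra_simps)
  qed simp
  have sq1: "(\<Sum>a = 1..<k. 1 / (real a + 1)\<^sup>2) \<le> 1"
    using order_trans[OF sq[of k], of 1] by (cases "k \<ge> 1") auto
  have "(\<Sum>a = 1..<k. 1 / ((real a + 1)\<^sup>2 * (real (k - a) + 1)\<^sup>2)) \<le>
      (\<Sum>a = 1..<k. 2 / (real k + 2)\<^sup>2 * (1 / (real a + 1)\<^sup>2 + 1 / (real (k - a) + 1)\<^sup>2))"
  proof (rule sum_mono)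
    fix a assume "a \<in> {1..<k}"
    define P R where "P = real a + 1" and "R = real (k - a) + 1"
    define x y where "x = 1 / P" and "y = 1 / R"
    have PR: "real k + 2 = P + R" "P \<noteq> 0" "R \<noteq> 0"
      using \<open>a \<in> {1..<k}\<close> by (auto simp: P_def R_def)
    have xy: "(real k + 2) * (x * y) = x + y"
      unfolding PR(1) x_def y_def using PR(2,3) by (simp add: field_simps)
    have "(real k + 2)\<^sup>2 * (x * y)\<^sup>2 = (x + y)\<^sup>2"
      unfolding xy[symmetric] by (rule power_mult_distrib[symmetric])
    also have "\<dots> \<le> 2 * (x\<^sup>2 + y\<^sup>2)" using sum_squares_bound[of x y] by (simp add: power2_sum)
    finally have "(real k + 2)\<^sup>2 * (x * y)\<^sup>2 \<le> 2 * (x\<^sup>2 + y\<^sup>2)" .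
    moreover have "(real k + 2)\<^sup>2 > 0" by simp
    ultimately have "(x * y)\<^sup>2 \<le> 2 / (real k + 2)\<^sup>2 * (x\<^sup>2 + y\<^sup>2)"
      by (simp add: pos_le_divide_eq mult.commute)
    then show "1 / ((real a + 1)\<^sup>2 * (real (k - a) + 1)\<^sup>2) \<le> 2 / (real k + 2)\<^sup>2 * (1 / (real a + 1)\<^sup>2 + 1 / (real (k - a) + 1)\<^sup>2)"
      by (simp add: x_def y_def P_def R_def power_mult_distrib power_divide)
  qed
  also have "\<dots> = 2 / (real k + 2)\<^sup>2 * ((\<Sum>a = 1..<k. 1 / (real a + 1)\<^sup>2) + (\<Sum>a = 1..<k. 1 / (real (k - a) + 1)\<^sup>2))"
    by (simp only: sum_distrib_left[symmetric] sum.distrib)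
  also have "(\<Sum>a = 1..<k. 1 / (real (k - a) + 1)\<^sup>2) = (\<Sum>a = 1..<k. 1 / (real a + 1)\<^sup>2)"
    by (rule sum.reindex_bij_witness[of _ "\<lambda>a. k - a" "\<lambda>a. k - a"]) auto
  also have "2 / (real k + 2)\<^sup>2 * ((\<Sum>a = 1..<k. 1 / (real a + 1)\<^sup>2) + (\<Sum>a = 1..<k. 1 / (real a + 1)\<^sup>2)) \<le> 2 / (real k + 2)\<^sup>2 * (1 + 1)"
    by (intro mult_left_mono add_mono sq1) auto
  also have "\<dots> \<le> 4 / (real k + 1)\<^sup>2"
    by (simp add: frac_le power_mono)
  finally show ?thesis .
qed

text \<open>D is the room that the addition a + b = k leaves in E. It will be the logarithm of the
  reciprocal of the k-th divisor, so that exp (E k - D) becomes exp (E k) after division by that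
  divisor.\<close>

lemma fps_mult_weighted_bound:
  fixes x y :: "complex fps" and E :: "nat \<Rightarrow> real"
  assumes x0: "x $ 0 = 0" and y0: "y $ 0 = 0" and X: "X \<ge> 0" and Y: "Y \<ge> 0" and B: "B \<ge> 0"
    and x: "\<And>l. 0 < l \<Longrightarrow> l < k \<Longrightarrow> norm (x $ l) \<le> X * (B ^ l * exp (E l) / (real l + 1)\<^sup>2)"
    and y: "\<And>l. 0 < l \<Longrightarrow> l < k \<Longrightarrow> norm (y $ l) \<le> Y * (B ^ l * exp (E l) / (real l + 1)\<^sup>2)"
    and E: "\<And>a b. 0 < a \<Longrightarrow> 0 < b \<Longrightarrow> a + b = k \<Longrightarrow> E a + E b + D \<le> E k"
  shows "norm ((x * y) $ k) \<le> 4 * X * Y * (B ^ k * exp (E k - D) / (real k + 1)\<^sup>2)"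
proof -
  have "(x * y) $ k = (\<Sum>a = 1..<k. x $ a * y $ (k - a))"
    unfolding fps_mult_nth
  proof (rule sum.mono_neutral_cong_right)
    show "\<forall>i\<in>{0..k} - {1..<k}. x $ i * y $ (k - i) = 0"
    proof
      fix i assume "i \<in> {0..k} - {1..<k}"
      then have "i = 0 \<or> i = k" by auto
      then show "x $ i * y $ (k - i) = 0" using x0 y0 by auto
    qed
  qed auto
  then have "norm ((x * y) $ k) \<le> (\<Sum>a = 1..<k. norm (x $ a) * norm (y $ (k - a)))"
    by (simp add: norm_mult[symmetric] norm_sum)
  also have "\<dots> \<le> (\<Sum>a = 1..<k. X * Y * B ^ k * exp (E k - D) * (1 / ((real a + 1)\<^sup>2 * (real (k - a) + 1)\<^sup>2)))"
  proof (rule sum_mono)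
    fix a assume a: "a \<in> {1..<k}"
    have "norm (x $ a) * norm (y $ (k - a)) \<le> (X * (B ^ a * exp (E a) / (real a + 1)\<^sup>2)) * (Y * (B ^ (k - a) * exp (E (k - a)) / (real (k - a) + 1)\<^sup>2))"
      using a X Y B by (intro mult_mono x y) auto
    also have "\<dots> = X * Y * B ^ k * exp (E a + E (k - a)) * (1 / ((real a + 1)\<^sup>2 * (real (k - a) + 1)\<^sup>2))"
      using a by (simp add: exp_add power_add[symmetric] algebra_simps)
    also have "\<dots> \<le> X * Y * B ^ k * exp (E k - D) * (1 / ((real a + 1)\<^sup>2 * (real (k - a) + 1)\<^sup>2))"
      using a X Y B E[of a "k - a"] by (intro mult_right_mono mult_left_mono) auto
    finally show "norm (x $ a) * norm (y $ (k - a)) \<le> X * Y * B ^ k * exp (E k - D) * (1 / ((real a + 1)\<^sup>2 * (real (k - a) + 1)\<^sup>2))" .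
  qed
  also have "\<dots> = X * Y * B ^ k * exp (E k - D) * (\<Sum>a = 1..<k. 1 / ((real a + 1)\<^sup>2 * (real (k - a) + 1)\<^sup>2))"
    by (simp only: sum_distrib_left)
  also have "\<dots> \<le> X * Y * B ^ k * exp (E k - D) * (4 / (real k + 1)\<^sup>2)"
    using X Y B by (intro mult_left_mono sum_inverse_squares_convolution) auto
  finally show ?thesis by (simp add: algebra_simps)
qed

text \<open>The factors are split off one at a time. D is gained in the last multiplication, the
  only one evaluated at index k; at lower indices superadditivity of E is enough.\<close>

lemma fps_monomial_weighted_bound:
  fixes u v :: "complex fps" and E :: "nat \<Rightarrow> real"
  assumes u0: "u $ 0 = 0" and v0: "v $ 0 = 0" and A: "A \<ge> 0" and B: "B \<ge> 0"
    and u: "\<And>l. 0 < l \<Longrightarrow> l < k \<Longrightarrow> norm (u $ l) \<le> A * (B ^ l * exp (E l) / (real l + 1)\<^sup>2)"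
    and v: "\<And>l. 0 < l \<Longrightarrow> l < k \<Longrightarrow> norm (v $ l) \<le> A * (B ^ l * exp (E l) / (real l + 1)\<^sup>2)"
    and E: "\<And>a b. 0 < a \<Longrightarrow> 0 < b \<Longrightarrow> E a + E b \<le> E (a + b)"
    and ED: "\<And>a b. 0 < a \<Longrightarrow> 0 < b \<Longrightarrow> a + b = k \<Longrightarrow> E a + E b + D \<le> E k"
    and ij: "i + j \<ge> 2"
  shows "norm ((u ^ i * v ^ j) $ k) \<le> (4 * A) ^ (i + j) / 4 * (B ^ k * exp (E k - D) / (real k + 1)\<^sup>2)"
proof -
  have split: "\<exists>x i' j'. (x = u \<or> x = v) \<and> u ^ i * v ^ j = x * (u ^ i' * v ^ j') \<and> i' + j' = m"
    if "i + j = Suc m" for i j m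
  proof (cases i)
    case 0
    then have "u ^ i * v ^ j = v * (u ^ 0 * v ^ m)" using that by simp
    then show ?thesis by (intro exI[of _ v] exI[of _ 0] exI[of _ m]) auto
  next
    case (Suc i')
    then have "u ^ i * v ^ j = u * (u ^ i' * v ^ j)" by (simp add: mult.assoc)
    then show ?thesis using Suc that by (intro exI[of _ u] exI[of _ i'] exI[of _ j]) auto
  qed
  have zero: "(u ^ i * v ^ j) $ 0 = 0" if "i + j > 0" for i j
    using that u0 v0 by (cases i; cases j) (auto simp: fps_mult_nth)
  have low: "norm ((u ^ i * v ^ j) $ l) \<le> (4 * A) ^ (i + j) / 4 * (B ^ l * exp (E l) / (real l + 1)\<^sup>2)"
    if "i + j = Suc m" "0 < l" "l < k" for i j m l
    using that
  proof (induction m arbitrary: i j l)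
    case 0
    then have "i = 1 \<and> j = 0 \<or> i = 0 \<and> j = 1" by auto
    then show ?case using u[of l] v[of l] 0 by auto
  next
    case (Suc m)
    obtain x i' j' where x: "x = u \<or> x = v" "u ^ i * v ^ j = x * (u ^ i' * v ^ j')" "i' + j' = Suc m"
      using split[OF Suc.prems(1)] by blast
    have "norm ((x * (u ^ i' * v ^ j')) $ l) \<le> 4 * A * ((4 * A) ^ (i' + j') / 4) * (B ^ l * exp (E l - 0) / (real l + 1)\<^sup>2)"
    proof (rule fps_mult_weighted_bound)
      show "x $ 0 = 0" "(u ^ i' * v ^ j') $ 0 = 0" using x u0 v0 zero by auto
      show "norm (x $ n) \<le> A * (B ^ n * exp (E n) / (real n + 1)\<^sup>2)" if "0 < n" "n < l" for n
        using x(1) u[of n] v[of n] that Suc.prems by auto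
      show "norm ((u ^ i' * v ^ j') $ n) \<le> (4 * A) ^ (i' + j') / 4 * (B ^ n * exp (E n) / (real n + 1)\<^sup>2)" if "0 < n" "n < l" for n
        using Suc.IH[of i' j' n] x(3) that Suc.prems by auto
      show "E a + E b + 0 \<le> E l" if "0 < a" "0 < b" "a + b = l" for a b
        using E that by auto
    qed (use A B in auto)
    also have "4 * A * ((4 * A) ^ (i' + j') / 4) = (4 * A) ^ (i + j) / 4"
      using x(3) Suc.prems(1) by simp
    finally show ?case using x(2) by simp
  qed
  obtain m where m: "i + j = Suc (Suc m)" using ij by (metis add_2_eq_Suc le_Suc_ex)
  obtain x i' j' where x: "x = u \<or> x = v" "u ^ i * v ^ j = x * (u ^ i' * v ^ j')" "i' + j' = Suc m"
    using split[OF m] by blast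
  have "norm ((x * (u ^ i' * v ^ j')) $ k) \<le> 4 * A * ((4 * A) ^ (i' + j') / 4) * (B ^ k * exp (E k - D) / (real k + 1)\<^sup>2)"
  proof (rule fps_mult_weighted_bound)
    show "x $ 0 = 0" "(u ^ i' * v ^ j') $ 0 = 0" using x u0 v0 zero by auto
    show "norm (x $ n) \<le> A * (B ^ n * exp (E n) / (real n + 1)\<^sup>2)" if "0 < n" "n < k" for n
      using x(1) u[of n] v[of n] that by auto
    show "norm ((u ^ i' * v ^ j') $ n) \<le> (4 * A) ^ (i' + j') / 4 * (B ^ n * exp (E n) / (real n + 1)\<^sup>2)" if "0 < n" "n < k" for n
      using low[of i' j' m n] x(3) that by auto
  qed (use A B ED in auto)
  also have "4 * A * ((4 * A) ^ (i' + j') / 4) = (4 * A) ^ (i + j) / 4"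
    using x(3) m by simp
  finally show ?thesis using x(2) by simp
qed

lemma fps_conv_radius_pos_of_bound:
  fixes f :: "complex fps"
  assumes b: "\<And>n. norm (f $ n) \<le> A * Q ^ n" and Q: "Q > 0"
  shows "fps_conv_radius f > 0"
proof -
  have "summable (\<lambda>n. f $ n * (of_real (1 / (2 * Q))) ^ n)"
  proof (rule summable_comparison_test')
    show "summable (\<lambda>n. A * (1/2::real) ^ n)" by (intro summable_mult summable_geometric) auto
    fix n :: nat
    have "norm (f $ n * (of_real (1 / (2 * Q))) ^ n) = norm (f $ n) * (1 / (2 * Q)) ^ n"
      using Q by (simp add: norm_mult norm_power norm_divide)
    also have "\<dots> \<le> A * Q ^ n * (1 / (2 * Q)) ^ n"
      using Q by (intro mult_right_mono b) auto
    also have "\<dots> = A * (1/2) ^ n" using Q by (simp add: power_divide power_mult_distrib)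
    finally show "norm (f $ n * (of_real (1 / (2 * Q))) ^ n) \<le> A * (1/2) ^ n" .
  qed
  then have "conv_radius (fps_nth f) \<ge> ereal (norm (complex_of_real (1 / (2 * Q))))"
    by (rule conv_radius_geI)
  then show ?thesis using Q unfolding fps_conv_radius_def
    by (smt (verit) divide_pos_pos ereal_less(2) less_le_trans norm_of_real)
qed

section \<open>Convergence of linearised invariant curves\<close>

definition subst1_higher :: "complex fps fps \<Rightarrow> complex fps \<Rightarrow> complex fps \<Rightarrow> nat \<Rightarrow> complex" where
  "subst1_higher g u v k = (\<Sum>(i, j)\<in>{(i, j). 2 \<le> i + j \<and> i + j \<le> k}. g $ i $ j * (u ^ i * v ^ j) $ k)"

lemma finite_sum_le_pairs: "finite {(i, j). i + j \<le> (k::nat)}"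
  by (rule finite_subset[of _ "{..k} \<times> {..k}"]) auto

lemma subst1_nth_split:
  assumes "k \<ge> 1"
  shows "subst1 g u v $ k = g $ 1 $ 0 * u $ k + g $ 0 $ 1 * v $ k + subst1_higher g u v k"
proof -
  have "{(i, j). i + j \<le> k} = insert (0, 0) (insert (1, 0) (insert (0, 1) {(i, j). 2 \<le> i + j \<and> i + j \<le> k}))"
    using assms by (auto simp: le_Suc_eq not_less_eq_eq numeral_2_eq_2)
  moreover have "finite {(i, j). 2 \<le> i + j \<and> i + j \<le> k}"
    by (rule finite_subset[OF _ finite_sum_le_pairs[of k]]) auto
  ultimately show ?thesis
    using assms by (simp add: subst1_def subst1_higher_def)
qed

lemma fps_mult_nth_cong:
  fixes x y :: "complex fps"
  assumes "x $ 0 = 0" "y $ 0 = 0" "x' $ 0 = 0" "y' $ 0 = 0"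
    and "\<And>l. l < k \<Longrightarrow> x $ l = x' $ l" "\<And>l. l < k \<Longrightarrow> y $ l = y' $ l"
  shows "(x * y) $ k = (x' * y') $ k"
  unfolding fps_mult_nth
proof (rule sum.cong[OF refl])
  fix i assume "i \<in> {0..k}"
  then consider "i = 0" | "i = k" | "0 < i" "i < k" by fastforce
  then show "x $ i * y $ (k - i) = x' $ i * y' $ (k - i)"
    by cases (use assms in auto)
qed

lemma fps_power_nth_cong_less:
  fixes x x' :: "complex fps"
  assumes "\<And>l. l < k \<Longrightarrow> x $ l = x' $ l" "l < k"
  shows "(x ^ n) $ l = (x' ^ n) $ l"
  using assms(2)
proof (induction n arbitrary: l)
  case (Suc n)
  then show ?case using assms(1) by (simp add: fps_mult_nth)
qed simp

text \<open>In a product of at least two series without constant terms, the coefficient k involves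
  only coefficients of index below k. This makes the linearisation equation a recursion.\<close>

lemma subst1_higher_cong:
  fixes u v :: "complex fps"
  assumes z: "u $ 0 = 0" "v $ 0 = 0" "u' $ 0 = 0" "v' $ 0 = 0"
    and uv: "\<And>l. l < k \<Longrightarrow> u $ l = u' $ l" "\<And>l. l < k \<Longrightarrow> v $ l = v' $ l"
  shows "subst1_higher g u v k = subst1_higher g u' v' k"
proof -
  have mon: "(u ^ i * v ^ j) $ l = (u' ^ i * v' ^ j) $ l" if "l < k" for i j l
    unfolding fps_mult_nth
    using fps_power_nth_cong_less[of k u u'] fps_power_nth_cong_less[of k v v'] uv that by simp
  have zero: "(u ^ i * v ^ j) $ 0 = 0" "(u' ^ i * v' ^ j) $ 0 = 0" if "i + j > 0" for i j
    using that z by (cases i; cases j; auto simp: fps_mult_nth)+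
  have "(u ^ i * v ^ j) $ k = (u' ^ i * v' ^ j) $ k" if ij: "2 \<le> i + j" for i j
  proof (cases i)
    case 0
    then obtain m where m: "j = Suc m" "m > 0" using ij by (cases j) auto
    have "(v * (u ^ 0 * v ^ m)) $ k = (v' * (u' ^ 0 * v' ^ m)) $ k"
      by (rule fps_mult_nth_cong) (use z uv zero[of 0 m] mon[of _ 0 m] m in auto)
    then show ?thesis using m 0 by simp
  next
    case (Suc m)
    have "(u * (u ^ m * v ^ j)) $ k = (u' * (u' ^ m * v' ^ j)) $ k"
      by (rule fps_mult_nth_cong) (use z uv zero[of m j] mon Suc ij in auto)
    then show ?thesis using Suc by (simp add: mult.assoc)
  qed
  then show ?thesis unfolding subst1_higher_def by (intro sum.cong) auto
qed

text \<open>Order k is a linear system for the coefficients of u and v with the matrix \<alpha>^k -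
  M, where M is the linear part, and the nonlinear terms on the right; Cramer's rule solves it.
  Order 1 is the eigenvector equation.\<close>

lemma formal_linearizing_curve:
  fixes g1 g2 :: "complex fps fps" and \<alpha> p q :: complex
  defines "a \<equiv> g1 $ 1 $ 0" and "b \<equiv> g1 $ 0 $ 1" and "c \<equiv> g2 $ 1 $ 0" and "d \<equiv> g2 $ 0 $ 1"
  assumes g0: "g1 $ 0 $ 0 = 0" "g2 $ 0 $ 0 = 0"
    and det: "\<And>k. k \<ge> 2 \<Longrightarrow> (\<alpha> ^ k - a) * (\<alpha> ^ k - d) - b * c \<noteq> 0"
    and ev: "a * p + b * q = \<alpha> * p" "c * p + d * q = \<alpha> * q"
  obtains u v where "u $ 0 = 0" "v $ 0 = 0" "u $ 1 = p" "v $ 1 = q"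
    "\<And>k. subst1 g1 u v $ k = \<alpha> ^ k * u $ k" "\<And>k. subst1 g2 u v $ k = \<alpha> ^ k * v $ k"
proof -
  \<comment> \<open>Truncation below x makes \<open>\<Phi> f x\<close> depend only on the values of
    f before x, as recursion on the well-order requires.\<close>
  define U where "U = (\<lambda>(f :: nat \<Rightarrow> complex \<times> complex) x. Abs_fps (\<lambda>l. if 0 < l \<and> l < x then fst (f l) else 0))"
  define V where "V = (\<lambda>(f :: nat \<Rightarrow> complex \<times> complex) x. Abs_fps (\<lambda>l. if 0 < l \<and> l < x then snd (f l) else 0))"
  define \<Phi> where "\<Phi> = (\<lambda>f x. let R1 = subst1_higher g1 (U f x) (V f x) x; R2 = subst1_higher g2 (U f x) (V f x) x;
       D = (\<alpha> ^ x - a) * (\<alpha> ^ x - d) - b * c in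
     if x = 0 then (0, 0) else if x = 1 then (p, q)
     else (((\<alpha> ^ x - d) * R1 + b * R2) / D, (c * R1 + (\<alpha> ^ x - a) * R2) / D))"
  have "\<exists>f. \<forall>x. f x = \<Phi> f x"
  proof (rule dependent_wellorder_choice)
    fix r and f g :: "nat \<Rightarrow> complex \<times> complex" and x :: nat
    assume "\<And>y. y < x \<Longrightarrow> f y = g y"
    then have "U f x = U g x" "V f x = V g x" by (auto simp: U_def V_def fps_eq_iff)
    then show "(r = \<Phi> f x) = (r = \<Phi> g x)" by (simp add: \<Phi>_def)
  qed simp
  then obtain f where f: "\<And>x. f x = \<Phi> f x" by blast
  define u v where "u = Abs_fps (\<lambda>l. fst (f l))" and "v = Abs_fps (\<lambda>l. snd (f l))"
  have f0: "f 0 = (0, 0)" and f1: "f 1 = (p, q)" using f[of 0] f[of 1] by (auto simp: \<Phi>_def)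
  have main: "subst1 g1 u v $ k = \<alpha> ^ k * u $ k \<and> subst1 g2 u v $ k = \<alpha> ^ k * v $ k" for k
  proof -
    consider "k = 0" | "k = 1" | "k \<ge> 2" by linarith
    then show ?thesis
    proof cases
      case 1
      have "{(i, j). i + j \<le> (0::nat)} = {(0, 0)}" by auto
      then show ?thesis using 1 g0 f0 by (simp add: subst1_def u_def v_def)
    next
      case 2
      have "{(i, j). 2 \<le> i + j \<and> i + j \<le> (1::nat)} = {}" by auto
      then have "subst1_higher g u v 1 = 0" for g by (simp only: subst1_higher_def sum.empty)
      then show ?thesis using 2 f1 ev by (simp add: subst1_nth_split u_def v_def a_def b_def c_def d_def)
    next
      case 3
      define R1 R2 D where "R1 = subst1_higher g1 u v k" and "R2 = subst1_higher g2 u v k"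
        and "D = (\<alpha> ^ k - a) * (\<alpha> ^ k - d) - b * c"
      have "subst1_higher g (U f k) (V f k) k = subst1_higher g u v k" for g
        by (rule subst1_higher_cong) (auto simp: U_def V_def u_def v_def f0)
      then have fk: "f k = (((\<alpha> ^ k - d) * R1 + b * R2) / D, (c * R1 + (\<alpha> ^ k - a) * R2) / D)"
        using f[of k] 3 by (simp add: \<Phi>_def Let_def R1_def R2_def D_def)
      have D: "D \<noteq> 0" unfolding D_def using det[OF 3] .
      have uk: "D * u $ k = (\<alpha> ^ k - d) * R1 + b * R2" and vk: "D * v $ k = c * R1 + (\<alpha> ^ k - a) * R2"
        using fk D by (simp_all add: u_def v_def)
      have "D * (a * u $ k + b * v $ k + R1) = a * (D * u $ k) + b * (D * v $ k) + D * R1" by (simp add: algebra_simps)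
      also have "\<dots> = \<alpha> ^ k * (D * u $ k)" unfolding uk vk by (simp add: D_def algebra_simps)
      finally have 1: "a * u $ k + b * v $ k + R1 = \<alpha> ^ k * u $ k" using D by (simp add: ac_simps)
      have "D * (c * u $ k + d * v $ k + R2) = c * (D * u $ k) + d * (D * v $ k) + D * R2" by (simp add: algebra_simps)
      also have "\<dots> = \<alpha> ^ k * (D * v $ k)" unfolding uk vk by (simp add: D_def algebra_simps)
      finally have 2: "c * u $ k + d * v $ k + R2 = \<alpha> ^ k * v $ k" using D by (simp add: ac_simps)
      show ?thesis using 1 2 3 by (simp add: subst1_nth_split R1_def R2_def a_def b_def c_def d_def)
    qed
  qed
  show ?thesis
    by (rule that[of u v]) (use main f0 f1 in \<open>auto simp: u_def v_def\<close>)
qed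

text \<open>With y = 4A/R there are m + 1 \<le> 2^m terms y^m, and 16 A \<le> R makes 2 y \<le> 1/2,
  so the sum is geometric from m = 2 on. What matters is the factor A^2: a small A beats every
  constant in the induction that uses this.\<close>

lemma subst1_higher_weighted_bound:
  fixes u v :: "complex fps" and E :: "nat \<Rightarrow> real"
  assumes u0: "u $ 0 = 0" and v0: "v $ 0 = 0" and A: "A \<ge> 0" "16 * A \<le> R" and B: "B \<ge> 0" and R: "R > 0" and M: "M \<ge> 0"
    and g: "\<And>i j. norm (g $ i $ j) \<le> M / R ^ (i + j)"
    and u: "\<And>l. 0 < l \<Longrightarrow> l < k \<Longrightarrow> norm (u $ l) \<le> A * (B ^ l * exp (E l) / (real l + 1)\<^sup>2)"
    and v: "\<And>l. 0 < l \<Longrightarrow> l < k \<Longrightarrow> norm (v $ l) \<le> A * (B ^ l * exp (E l) / (real l + 1)\<^sup>2)"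
    and E: "\<And>a b. 0 < a \<Longrightarrow> 0 < b \<Longrightarrow> E a + E b \<le> E (a + b)"
    and ED: "\<And>a b. 0 < a \<Longrightarrow> 0 < b \<Longrightarrow> a + b = k \<Longrightarrow> E a + E b + D \<le> E k"
  shows "norm (subst1_higher g u v k) \<le> 32 * M * A\<^sup>2 / R\<^sup>2 * (B ^ k * exp (E k - D) / (real k + 1)\<^sup>2)"
proof -
  define W where "W = B ^ k * exp (E k - D) / (real k + 1)\<^sup>2"
  define y where "y = 4 * A / R"
  have W: "W \<ge> 0" using B by (simp add: W_def)
  have y: "0 \<le> y" "2 * y \<le> 1 / 2" using A R by (auto simp: y_def field_simps)
  define T where "T = {(i, j). 2 \<le> i + j \<and> i + j \<le> k}"
  have "norm (subst1_higher g u v k) \<le> (\<Sum>(i, j)\<in>T. M / 4 * W * y ^ (i + j))"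
    unfolding subst1_higher_def T_def[symmetric]
  proof (rule sum_norm_le)
    fix z assume "z \<in> T"
    moreover obtain i j where z: "z = (i, j)" by (cases z)
    ultimately have ij: "i + j \<ge> 2" by (simp add: T_def)
    have "norm (g $ i $ j * (u ^ i * v ^ j) $ k) \<le> M / R ^ (i + j) * ((4 * A) ^ (i + j) / 4 * W)"
      unfolding norm_mult W_def
      by (intro mult_mono g fps_monomial_weighted_bound u0 v0 u v E ED ij A B) (use M R in auto)
    then show "norm (case z of (i, j) \<Rightarrow> g $ i $ j * (u ^ i * v ^ j) $ k) \<le> (case z of (i, j) \<Rightarrow> M / 4 * W * y ^ (i + j))"
      by (simp add: z y_def power_divide ac_simps)
  qed
  also have "\<dots> = M / 4 * W * (\<Sum>(i, j)\<in>T. y ^ (i + j))"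
    by (simp add: sum_distrib_left split_def)
  finally have 1: "norm (subst1_higher g u v k) \<le> M / 4 * W * (\<Sum>(i, j)\<in>T. y ^ (i + j))" .
  have 2: "(\<Sum>(i, j)\<in>T. y ^ (i + j)) \<le> 32 * y\<^sup>2 / 4"
  proof -
    have "(\<Sum>(i, j)\<in>T. y ^ (i + j)) = (\<Sum>(m, i)\<in>(SIGMA m:{2..k}. {..m}). y ^ m)"
      by (rule sum.reindex_bij_witness[of _ "\<lambda>(m, i). (i, m - i)" "\<lambda>(i, j). (i + j, i)"]) (auto simp: T_def)
    also have "\<dots> = (\<Sum>m\<in>{2..k}. real (m + 1) * y ^ m)"
      by (subst sum.Sigma[symmetric]) auto
    also have "\<dots> \<le> (\<Sum>m\<in>{2..k}. 4 * y\<^sup>2 * (1/2) ^ (m - 2))"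
    proof (rule sum_mono)
      fix m assume m: "m \<in> {2..k}"
      have "m + 1 \<le> 2 ^ m"
        by (metis Suc_eq_plus1 Suc_leI less_exp)
      then have "real (m + 1) \<le> 2 ^ m"
        by (metis of_nat_le_iff of_nat_numeral of_nat_power)
      then have "real (m + 1) * y ^ m \<le> 2 ^ m * y ^ m" using y by (intro mult_right_mono) auto
      also have "\<dots> = (2 * y) ^ (2 + (m - 2))"
        using m by (simp only: power_mult_distrib[symmetric] le_add_diff_inverse atLeastAtMost_iff)
      also have "\<dots> = 4 * y\<^sup>2 * (2 * y) ^ (m - 2)"
        unfolding power_add by (simp add: power_mult_distrib)
      also have "\<dots> \<le> 4 * y\<^sup>2 * (1/2) ^ (m - 2)"
        using y by (intro mult_left_mono power_mono) auto
      finally show "real (m + 1) * y ^ m \<le> 4 * y\<^sup>2 * (1/2) ^ (m - 2)" .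
    qed
    also have "\<dots> = 4 * y\<^sup>2 * (\<Sum>m\<in>{2..k}. (1/2) ^ (m - 2))" by (simp add: sum_distrib_left)
    also have "(\<Sum>m\<in>{2..k}. (1/2::real) ^ (m - 2)) = (\<Sum>m<k-1. (1/2) ^ m)"
      by (rule sum.reindex_bij_witness[of _ "\<lambda>m. m + 2" "\<lambda>m. m - 2"]) auto
    also have "\<dots> \<le> (\<Sum>m. (1/2) ^ m)"
      by (intro sum_le_suminf summable_geometric) auto
    also have "(\<Sum>m. (1/2::real) ^ m) = 2" by (subst suminf_geometric) auto
    finally show ?thesis using y by (simp add: mult_left_mono)
  qed
  have "M / 4 * W * (\<Sum>(i, j)\<in>T. y ^ (i + j)) \<le> M / 4 * W * (32 * y\<^sup>2 / 4)"
    using M W by (intro mult_left_mono 2) auto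
  also have "\<dots> = 32 * M * A\<^sup>2 / R\<^sup>2 * W"
    using R by (simp add: y_def power_divide power_mult_distrib)
  finally show ?thesis using 1 unfolding W_def by linarith
qed

lemma det2_solution_bound:
  fixes x y :: complex
  assumes 1: "p * x - b * y = r1" and 2: "- c * x + q * y = r2"
    and N: "norm p + norm b + norm c + norm q \<le> N"
  shows "norm (p * q - b * c) * norm x \<le> N * (norm r1 + norm r2)"
    and "norm (p * q - b * c) * norm y \<le> N * (norm r1 + norm r2)"
proof -
  have n: "norm p \<le> N" "norm b \<le> N" "norm c \<le> N" "norm q \<le> N"
    using N norm_ge_zero[of p] norm_ge_zero[of b] norm_ge_zero[of c] norm_ge_zero[of q] by linarith+
  have *: "norm (s * r1 + t * r2) \<le> N * (norm r1 + norm r2)" if "norm s \<le> N" "norm t \<le> N" for s t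
    using norm_triangle_ineq[of "s * r1" "t * r2"] mult_right_mono[OF that(1) norm_ge_zero[of r1]]
      mult_right_mono[OF that(2) norm_ge_zero[of r2]]
    by (simp add: norm_mult distrib_left)
  have "(p * q - b * c) * x = q * r1 + b * r2" unfolding 1[symmetric] 2[symmetric] by (simp add: algebra_simps)
  then show "norm (p * q - b * c) * norm x \<le> N * (norm r1 + norm r2)"
    using *[OF n(4,2)] by (simp flip: norm_mult)
  have "(p * q - b * c) * y = c * r1 + p * r2" unfolding 1[symmetric] 2[symmetric] by (simp add: algebra_simps)
  then show "norm (p * q - b * c) * norm y \<le> N * (norm r1 + norm r2)"
    using *[OF n(3,1)] by (simp flip: norm_mult)
qed

text \<open>Induction with the majorant A B^k exp (E k) / (k+1)^2. Division by the k-th determinant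
  costs what E has put aside, the nonlinear terms are quadratic in A, and E k \<le> C k makes the
  majorant geometric. Indices below k0, where the determinant may vanish, are covered by a large
  B.\<close>

theorem linearizing_curve_converges:
  fixes g1 g2 :: "complex fps fps" and \<mu> :: complex and u v :: "complex fps" and E :: "nat \<Rightarrow> real"
  defines "a \<equiv> g1 $ 1 $ 0" and "b \<equiv> g1 $ 0 $ 1" and "c \<equiv> g2 $ 1 $ 0" and "d \<equiv> g2 $ 0 $ 1"
  assumes R: "R > 0" and M: "M \<ge> 0"
    and g1: "\<And>i j. norm (g1 $ i $ j) \<le> M / R ^ (i + j)"
    and g2: "\<And>i j. norm (g2 $ i $ j) \<le> M / R ^ (i + j)"
    and uv0: "u $ 0 = 0" "v $ 0 = 0" and \<mu>: "norm \<mu> \<le> 1"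
    and eq: "\<And>k. subst1 g1 u v $ k = \<mu> ^ k * u $ k" "\<And>k. subst1 g2 u v $ k = \<mu> ^ k * v $ k"
    and E: "\<And>k. E k \<le> C * real k" "\<And>k l. 0 < k \<Longrightarrow> 0 < l \<Longrightarrow> E k + E l \<le> E (k + l)"
    and det: "\<And>k. k0 \<le> k \<Longrightarrow> (\<mu> ^ k - a) * (\<mu> ^ k - d) - b * c \<noteq> 0"
    and ED: "\<And>k l. 0 < k \<Longrightarrow> 0 < l \<Longrightarrow> k0 \<le> k + l \<Longrightarrow>
       E k + E l + ln (1 / norm ((\<mu> ^ (k + l) - a) * (\<mu> ^ (k + l) - d) - b * c)) \<le> E (k + l)"
  shows "fps_conv_radius u > 0" and "fps_conv_radius v > 0"
proof -
  define N where "N = 2 + norm a + norm b + norm c + norm d"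
  have N: "N > 0" by (simp add: N_def add_nonneg_pos add_pos_nonneg)
  \<comment> \<open>The first bound is the smallness required by
    \<open>subst1_higher_weighted_bound\<close>; the second brings the constant 64 N M A^2 / R^2 of
    the induction step down to A.\<close>
  define A where "A = min (R / 16) (R\<^sup>2 / (64 * N * (M + 1)))"
  have A: "A > 0" "16 * A \<le> R" "A \<le> R\<^sup>2 / (64 * N * (M + 1))"
    using R M N by (auto simp: A_def)
  have A2: "64 * N * M * A\<^sup>2 / R\<^sup>2 \<le> A"
  proof -
    have "64 * N * M * A \<le> 64 * N * (M + 1) * A"
      using N A by (intro mult_right_mono mult_left_mono) auto
    also have "\<dots> \<le> R\<^sup>2"
      using A(3) N M pos_le_divide_eq[of "64 * N * (M + 1)" A "R\<^sup>2"] by (simp add: mult.commute)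
    finally have "64 * N * M * A * A \<le> R\<^sup>2 * A" using A by (intro mult_right_mono) auto
    then show ?thesis using R by (simp add: field_simps power2_eq_square)
  qed
  define h where "h = (\<lambda>l. exp (E l) / (real l + 1)\<^sup>2)"
  have h: "h l > 0" for l by (simp add: h_def)
  \<comment> \<open>Each summand takes care of one index l < k0, since B \<ge> 1 gives B^l \<ge> B
    for l > 0.\<close>
  define B where "B = 1 + (\<Sum>l<k0. (norm (u $ l) + norm (v $ l)) / (A * h l))"
  have B1: "B \<ge> 1" unfolding B_def using A h by (simp add: sum_nonneg less_imp_le)
  have small: "norm (u $ l) \<le> A * (B ^ l * exp (E l) / (real l + 1)\<^sup>2) \<and> norm (v $ l) \<le> A * (B ^ l * exp (E l) / (real l + 1)\<^sup>2)"
    if l: "0 < l" "l < k0" for l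
  proof -
    have "(norm (u $ l) + norm (v $ l)) / (A * h l) \<le> (\<Sum>l<k0. (norm (u $ l) + norm (v $ l)) / (A * h l))"
      by (rule member_le_sum) (use l A h in \<open>auto simp: less_imp_le\<close>)
    also have "\<dots> \<le> B" by (simp add: B_def)
    also have "\<dots> \<le> B ^ l" using B1 l by (simp add: self_le_power)
    finally have "norm (u $ l) + norm (v $ l) \<le> B ^ l * (A * h l)"
      using A h[of l] by (simp add: pos_divide_le_eq)
    also have "\<dots> = A * (B ^ l * exp (E l) / (real l + 1)\<^sup>2)" by (simp add: h_def)
    finally show ?thesis using norm_ge_zero[of "u $ l"] norm_ge_zero[of "v $ l"] by linarith
  qed
  have main: "0 < k \<longrightarrow> norm (u $ k) \<le> A * (B ^ k * exp (E k) / (real k + 1)\<^sup>2) \<and> norm (v $ k) \<le> A * (B ^ k * exp (E k) / (real k + 1)\<^sup>2)" for k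
  proof (induction k rule: less_induct)
    case (less k)
    show ?case
    proof (cases "k < k0 \<or> k = 0")
      case True
      then show ?thesis using small by blast
    next
      case False
      then have k: "k0 \<le> k" "k \<ge> 1" by auto
      define \<Delta> where "\<Delta> = (\<mu> ^ k - a) * (\<mu> ^ k - d) - b * c"
      define D where "D = ln (1 / norm \<Delta>)"
      have \<Delta>: "norm \<Delta> > 0" using det[OF k(1)] by (simp add: \<Delta>_def)
      have eD: "exp (E k - D) = exp (E k) * norm \<Delta>"
        using \<Delta> by (simp add: D_def ln_div exp_add)
      define r1 r2 where "r1 = subst1_higher g1 u v k" and "r2 = subst1_higher g2 u v k"
      have rb: "norm (subst1_higher g u v k) \<le> 32 * M * A\<^sup>2 / R\<^sup>2 * (B ^ k * exp (E k - D) / (real k + 1)\<^sup>2)"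
        if "\<And>i j. norm (g $ i $ j) \<le> M / R ^ (i + j)" for g
      proof (rule subst1_higher_weighted_bound[OF uv0 _ A(2) _ R M that])
        show "E p + E q + D \<le> E k" if "0 < p" "0 < q" "p + q = k" for p q
          using ED[OF that(1,2)] that(3) k by (simp add: D_def \<Delta>_def)
      qed (use A B1 E less.IH in auto)
      have e1: "(\<mu> ^ k - a) * u $ k - b * v $ k = r1"
        using eq(1)[of k] subst1_nth_split[OF k(2), of g1 u v] by (simp add: r1_def a_def b_def algebra_simps)
      have e2: "- c * u $ k + (\<mu> ^ k - d) * v $ k = r2"
        using eq(2)[of k] subst1_nth_split[OF k(2), of g2 u v] by (simp add: r2_def c_def d_def algebra_simps)
      have "norm (\<mu> ^ k) \<le> 1" using \<mu> by (simp add: norm_power power_le_one)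
      then have Nb: "norm (\<mu> ^ k - a) + norm b + norm c + norm (\<mu> ^ k - d) \<le> N"
        using norm_triangle_ineq4[of "\<mu> ^ k" a] norm_triangle_ineq4[of "\<mu> ^ k" d] unfolding N_def by linarith
      have "N * (norm r1 + norm r2) \<le> N * (2 * (32 * M * A\<^sup>2 / R\<^sup>2 * (B ^ k * exp (E k - D) / (real k + 1)\<^sup>2)))"
        using rb[OF g1] rb[OF g2] N by (intro mult_left_mono) (auto simp: r1_def r2_def)
      also have "\<dots> = (64 * N * M * A\<^sup>2 / R\<^sup>2) * (B ^ k * exp (E k) / (real k + 1)\<^sup>2) * norm \<Delta>"
        unfolding eD by (simp add: field_simps)
      also have "\<dots> \<le> A * (B ^ k * exp (E k) / (real k + 1)\<^sup>2) * norm \<Delta>"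
        using A2 B1 by (intro mult_right_mono) auto
      finally have fin: "N * (norm r1 + norm r2) \<le> A * (B ^ k * exp (E k) / (real k + 1)\<^sup>2) * norm \<Delta>" .
      have "norm (u $ k) * norm \<Delta> \<le> A * (B ^ k * exp (E k) / (real k + 1)\<^sup>2) * norm \<Delta>"
        "norm (v $ k) * norm \<Delta> \<le> A * (B ^ k * exp (E k) / (real k + 1)\<^sup>2) * norm \<Delta>"
        using det2_solution_bound[OF e1 e2 Nb] fin unfolding \<Delta>_def mult.commute[of "norm (_ $ k)"] by linarith+
      then show ?thesis using mult_right_le_imp_le[OF _ \<Delta>] by blast
    qed
  qed
  have fin: "A * (B ^ k * exp (E k) / (real k + 1)\<^sup>2) \<le> A * (B * exp C) ^ k" for k
  proof -
    have "exp (E k) \<le> exp C ^ k" using E(1)[of k] by (simp add: exp_of_nat_mult[symmetric] mult.commute)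
    then have "B ^ k * exp (E k) \<le> B ^ k * exp C ^ k" using B1 by (intro mult_left_mono) auto
    moreover have "B ^ k * exp (E k) / (real k + 1)\<^sup>2 \<le> B ^ k * exp (E k)"
      using B1 divide_left_mono[of 1 "(real k + 1)\<^sup>2" "B ^ k * exp (E k)"] by simp
    ultimately have "B ^ k * exp (E k) / (real k + 1)\<^sup>2 \<le> (B * exp C) ^ k"
      unfolding power_mult_distrib by linarith
    then show ?thesis using A by (intro mult_left_mono) auto
  qed
  have "norm (u $ k) \<le> A * (B * exp C) ^ k" "norm (v $ k) \<le> A * (B * exp C) ^ k" for k
    using main[of k] fin[of k] uv0 A by (cases "k = 0"; force)+
  then show "fps_conv_radius u > 0" "fps_conv_radius v > 0"
    using B1 by (auto intro!: fps_conv_radius_pos_of_bound[of _ A "B * exp C"])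
qed

section \<open>Differentials and strong stable curves\<close>

text \<open>The value at \<zeta> = 0 is the determinant of the differential, and determinants appear
  below in this form.\<close>

definition charpoly2 :: "(complex \<times> complex \<Rightarrow> complex \<times> complex) \<Rightarrow> complex \<times> complex \<Rightarrow> complex \<Rightarrow> complex" where
  "charpoly2 F p \<zeta> = (\<zeta> - partial1 (fst \<circ> F) p) * (\<zeta> - partial2 (snd \<circ> F) p)
     - partial2 (fst \<circ> F) p * partial1 (snd \<circ> F) p"

definition jacobian :: "(complex \<times> complex \<Rightarrow> complex \<times> complex) \<Rightarrow> complex \<times> complex \<Rightarrow> complex \<times> complex \<Rightarrow> complex \<times> complex" where
  "jacobian F p = (\<lambda>(h, k). (partial1 (fst \<circ> F) p * h + partial2 (fst \<circ> F) p * k,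
     partial1 (snd \<circ> F) p * h + partial2 (snd \<circ> F) p * k))"

lemma partials_eqI:
  assumes "(g has_derivative (\<lambda>(h, k). a * h + b * k)) (at p)"
  shows "partial1 g p = a" "partial2 g p = b"
  using has_derivative_imp_slices[of g a b "fst p" "snd p"] assms
  by (auto simp: partial1_def partial2_def intro!: DERIV_imp_deriv)

lemma jacobian_eqI:
  assumes "(F has_derivative (\<lambda>(h, k). (a * h + b * k, c * h + d * k))) (at p)"
  shows "partial1 (fst \<circ> F) p = a" "partial2 (fst \<circ> F) p = b" "partial1 (snd \<circ> F) p = c" "partial2 (snd \<circ> F) p = d"
proof -
  have 1: "((\<lambda>x. fst (F x)) has_derivative (\<lambda>x. fst ((\<lambda>(h, k). (a * h + b * k, c * h + d * k)) x))) (at p)"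
    and 2: "((\<lambda>x. snd (F x)) has_derivative (\<lambda>x. snd ((\<lambda>(h, k). (a * h + b * k, c * h + d * k)) x))) (at p)"
    using has_derivative_fst[OF assms] has_derivative_snd[OF assms] .
  have "((fst \<circ> F) has_derivative (\<lambda>(h, k). a * h + b * k)) (at p)"
    unfolding o_def by (rule has_derivative_eq_rhs[OF 1]) auto
  from partials_eqI[OF this] show "partial1 (fst \<circ> F) p = a" "partial2 (fst \<circ> F) p = b" .
  have "((snd \<circ> F) has_derivative (\<lambda>(h, k). c * h + d * k)) (at p)"
    unfolding o_def by (rule has_derivative_eq_rhs[OF 2]) auto
  from partials_eqI[OF this] show "partial1 (snd \<circ> F) p = c" "partial2 (snd \<circ> F) p = d" .
qed

lemma holomorphic_map_onI:
  assumes "\<And>p. p \<in> U \<Longrightarrow> \<exists>a b c d. (F has_derivative (\<lambda>(h, k). (a * h + b * k, c * h + d * k))) (at p)"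
  shows "holomorphic_map_on F U"
proof -
  have "\<exists>a b. ((fst \<circ> F) has_derivative (\<lambda>(h, k). a * h + b * k)) (at p) \<and> (\<exists>c d. ((snd \<circ> F) has_derivative (\<lambda>(h, k). c * h + d * k)) (at p))"
    if "p \<in> U" for p
  proof -
    from assms[OF that] obtain a b c d
      where *: "(F has_derivative (\<lambda>(h, k). (a * h + b * k, c * h + d * k))) (at p)" by blast
    have "((fst \<circ> F) has_derivative (\<lambda>(h, k). a * h + b * k)) (at p)"
      unfolding o_def by (rule has_derivative_eq_rhs[OF has_derivative_fst[OF *]]) auto
    moreover have "((snd \<circ> F) has_derivative (\<lambda>(h, k). c * h + d * k)) (at p)"
      unfolding o_def by (rule has_derivative_eq_rhs[OF has_derivative_snd[OF *]]) auto
    ultimately show ?thesis by blast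
  qed
  then show ?thesis unfolding holomorphic_map_on_def holomorphic2_on_def by blast
qed

lemma holomorphic_map_has_derivative:
  assumes "open U" "holomorphic_map_on F U" "p \<in> U"
  shows "(F has_derivative jacobian F p) (at p)"
proof -
  have "((fst \<circ> F) has_derivative (\<lambda>(h, k). partial1 (fst \<circ> F) p * h + partial2 (fst \<circ> F) p * k)) (at p)"
    "((snd \<circ> F) has_derivative (\<lambda>(h, k). partial1 (snd \<circ> F) p * h + partial2 (snd \<circ> F) p * k)) (at p)"
    using assms holomorphic2_has_derivative unfolding holomorphic_map_on_def by blast+
  from has_derivative_Pair[OF this] show ?thesis
    by (simp add: jacobian_def split_def)
qed

lemma holomorphic_map_on_imp_continuous_on:
  assumes "holomorphic_map_on F U" shows "continuous_on U F"
proof -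
  have "continuous_on U (fst \<circ> F)" "continuous_on U (snd \<circ> F)"
    using assms holomorphic2_on_imp_continuous_on unfolding holomorphic_map_on_def by blast+
  from continuous_on_Pair[OF this] show ?thesis by simp
qed

lemma holomorphic_map_on_subset: "holomorphic_map_on F U \<Longrightarrow> V \<subseteq> U \<Longrightarrow> holomorphic_map_on F V"
  unfolding holomorphic_map_on_def using holomorphic2_on_subset by blast

lemma holomorphic_map_on_compose:
  assumes "holomorphic_map_on G V" "holomorphic_map_on F U" "\<And>p. p \<in> U \<Longrightarrow> F p \<in> V"
  shows "holomorphic_map_on (G \<circ> F) U"
  using assms holomorphic2_compose_map[of "fst \<circ> G" V F U] holomorphic2_compose_map[of "snd \<circ> G" V F U]
  unfolding holomorphic_map_on_def by (simp add: o_assoc)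

lemma holomorphic_map_on_translate: "holomorphic_map_on (\<lambda>p. p + z) U"
proof (rule holomorphic_map_onI)
  fix p
  have "((\<lambda>p. p + z) has_derivative (\<lambda>(h, k). (1 * h + 0 * k, 0 * h + 1 * k))) (at p)"
    by (auto intro!: derivative_eq_intros simp: split_def)
  then show "\<exists>a b c d. ((\<lambda>p. p + z) has_derivative (\<lambda>(h, k). (a * h + b * k, c * h + d * k))) (at p)" by blast
qed

section \<open>Iterates and orbits on invariant curves\<close>

definition iterate_domain :: "('a \<Rightarrow> 'a) \<Rightarrow> 'a set \<Rightarrow> nat \<Rightarrow> 'a set" where
  "iterate_domain H S n = {p. \<forall>i<n. (H ^^ i) p \<in> S}"

lemma iterate_holomorphic:
  assumes "open S" "holomorphic_map_on H S"
  shows "open (iterate_domain H S n) \<and> holomorphic_map_on (H ^^ n) (iterate_domain H S n)"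
proof (induction n)
  case 0
  have "holomorphic_map_on (\<lambda>p. p + 0) UNIV" by (rule holomorphic_map_on_translate)
  then show ?case by (simp add: iterate_domain_def id_def)
next
  case (Suc n)
  have eq: "iterate_domain H S (Suc n) = iterate_domain H S n \<inter> (H ^^ n) -` S"
    by (auto simp: iterate_domain_def less_Suc_eq)
  have "continuous_on (iterate_domain H S n) (H ^^ n)"
    using Suc holomorphic_map_on_imp_continuous_on by blast
  then have "open (iterate_domain H S (Suc n))"
    unfolding eq using Suc assms(1) continuous_open_preimage by blast
  moreover have "holomorphic_map_on (H \<circ> (H ^^ n)) (iterate_domain H S (Suc n))"
    by (rule holomorphic_map_on_compose[OF assms(2)])
       (use Suc holomorphic_map_on_subset in \<open>auto simp: eq\<close>)
  ultimately show ?case by (simp add: comp_def)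
qed

text \<open>The parameters \<mu>^j t are distinct and stay in a compact disc. If the orbit on the
  curve were finite, each coordinate would repeat a value at parameters with a limit point, hence be
  constant and so 0. Contractions and irrational rotations are covered alike.\<close>

lemma infinite_orbit_on_curve:
  fixes H :: "complex \<times> complex \<Rightarrow> complex \<times> complex"
  assumes S: "open S" and H: "holomorphic_map_on H S" and z: "z \<in> iterate_domain H S n" and n: "n \<ge> 1"
    and u: "u has_fps_expansion fu" "fu $ 0 = 0" and v: "v has_fps_expansion fv" "fv $ 0 = 0"
    and nz: "fu \<noteq> 0 \<or> fv \<noteq> 0"
    and lin: "\<forall>\<^sub>F t in nhds 0. (H ^^ n) (z + (u t, v t)) = z + (u (\<mu> * t), v (\<mu> * t))"
    and \<mu>: "\<mu> \<noteq> 0" "norm \<mu> \<le> 1" "\<And>k. k \<ge> 1 \<Longrightarrow> \<mu> ^ k \<noteq> 1"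
  shows "\<exists>q. infinite (forward_orbit H S q)"
proof -
  define N where "N = iterate_domain H S n"
  have N: "open N" "z \<in> N" using iterate_holomorphic[OF S H, of n] z by (auto simp: N_def)
  have lim: "((\<lambda>t. z + (u t, v t)) \<longlongrightarrow> z + (0, 0)) (nhds 0)"
    using has_fps_expansion_imp_tendsto_0[OF u(1)] has_fps_expansion_imp_tendsto_0[OF v(1)] u(2) v(2)
    by (intro tendsto_intros) auto
  then have "\<forall>\<^sub>F t in nhds 0. z + (u t, v t) \<in> N"
    using N by (intro topological_tendstoD[OF lim]) (auto simp flip: zero_prod_def)
  moreover obtain Su where Su: "open Su" "0 \<in> Su" "u holomorphic_on Su"
    using has_fps_expansion_imp_holomorphic[OF u(1)] by metis
  moreover obtain Sv where Sv: "open Sv" "0 \<in> Sv" "v holomorphic_on Sv"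
    using has_fps_expansion_imp_holomorphic[OF v(1)] by metis
  ultimately have "\<forall>\<^sub>F t in nhds 0. t \<in> Su \<and> t \<in> Sv \<and> z + (u t, v t) \<in> N \<and>
      (H ^^ n) (z + (u t, v t)) = z + (u (\<mu> * t), v (\<mu> * t))"
    using lin eventually_nhds_in_open[OF Su(1,2)] eventually_nhds_in_open[OF Sv(1,2)]
    by (intro eventually_conj)
  then obtain e where e: "e > 0" "\<And>t. t \<in> ball 0 e \<Longrightarrow> t \<in> Su \<and> t \<in> Sv \<and> z + (u t, v t) \<in> N \<and>
      (H ^^ n) (z + (u t, v t)) = z + (u (\<mu> * t), v (\<mu> * t))"
    unfolding eventually_nhds_metric by (auto simp: dist_commute)
  define t where "t = complex_of_real (e / 2)"
  have t: "norm t < e" "t \<noteq> 0" using e(1) by (auto simp: t_def)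
  define s where "s = (\<lambda>j. \<mu> ^ j * t)"
  have s: "norm (s j) \<le> norm t" "s j \<in> ball 0 e" for j
  proof -
    show *: "norm (s j) \<le> norm t"
      using \<mu>(2) by (simp add: s_def norm_mult norm_power mult_left_le_one_le power_le_one)
    then show "s j \<in> ball 0 e" using t by simp
  qed
  have inj_s: "inj s"
  proof (rule injI)
    have "\<mu> ^ i \<noteq> \<mu> ^ j" if "i < j" for i j
    proof
      assume "\<mu> ^ i = \<mu> ^ j"
      also have "\<mu> ^ j = \<mu> ^ i * \<mu> ^ (j - i)" using that by (simp flip: power_add)
      finally have "\<mu> ^ (j - i) = 1" using \<mu>(1) by simp
      then show False using \<mu>(3)[of "j - i"] that by simp
    qed
    then show "i = j" if "s i = s j" for i j
      using that t by (auto simp: s_def) (metis nat_neq_iff)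
  qed
  define q where "q = z + (u t, v t)"
  have it: "(H ^^ (n * j)) q = z + (u (s j), v (s j))" for j
  proof (induction j)
    case (Suc j)
    have "n * Suc j = n + n * j" by simp
    then have "(H ^^ (n * Suc j)) q = (H ^^ n) ((H ^^ (n * j)) q)" by (simp only: funpow_add o_apply)
    also have "\<dots> = z + (u (\<mu> * s j), v (\<mu> * s j))" unfolding Suc using e(2) s by blast
    finally show ?case by (simp add: s_def mult.assoc)
  qed (simp add: q_def s_def)
  \<comment> \<open>Division with remainder by n: at multiples of n the orbit is on the curve inside
    N, from where the next n - 1 iterates are in S.\<close>
  have stay: "(H ^^ k) q \<in> S" for k
  proof -
    have "k = k mod n + n * (k div n)" by simp
    then have "(H ^^ k) q = (H ^^ (k mod n)) ((H ^^ (n * (k div n))) q)"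
      by (metis funpow_add o_apply)
    moreover have "(H ^^ (n * (k div n))) q \<in> N" unfolding it using e(2) s by blast
    ultimately show ?thesis using n by (simp add: N_def iterate_domain_def)
  qed
  have sub: "range (\<lambda>j. z + (u (s j), v (s j))) \<subseteq> forward_orbit H S q"
    unfolding forward_orbit_def using it stay by (auto simp flip: it)
  have const: "f = 0" if w: "w has_fps_expansion f" "f $ 0 = 0" and hol: "w holomorphic_on ball 0 e" and fin: "finite (range (\<lambda>j. w (s j)))" for w f
  proof -
    obtain c where c: "infinite {j. w (s j) = w (s c)}"
    proof -
      have "\<exists>a\<in>UNIV. \<not> finite {b\<in>UNIV. w (s b) = w (s a)}"
        by (rule pigeonhole_infinite[OF infinite_UNIV_nat fin])
      then show ?thesis using that by auto
    qed
    define X where "X = s ` {j. w (s j) = w (s c)}"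
    have "infinite X" unfolding X_def using c inj_s by (meson finite_imageD inj_on_subset subset_UNIV)
    moreover have "X \<subseteq> cball 0 (norm t)" using s by (auto simp: X_def)
    ultimately obtain \<xi> where \<xi>: "\<xi> \<in> cball 0 (norm t)" "\<xi> islimpt X"
      using compact_cball compact_eq_Bolzano_Weierstrass by metis
    have "w x - w (s c) = 0" if "x \<in> ball 0 e" for x
    proof (rule analytic_continuation[of "\<lambda>x. w x - w (s c)" "ball 0 e" X \<xi>])
      show "(\<lambda>x. w x - w (s c)) holomorphic_on ball 0 e" using hol by (intro holomorphic_intros)
      show "X \<subseteq> ball 0 e" using s by (auto simp: X_def)
    qed (use \<xi> t that in \<open>auto simp: X_def\<close>)
    moreover have "w 0 = 0" using has_fps_expansion_imp_0_eq_fps_nth_0[OF w(1)] w(2) by simp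
    ultimately have w0: "w x = 0" if "x \<in> ball 0 e" for x
      using that e(1) by (metis centre_in_ball right_minus_eq)
    have "\<forall>\<^sub>F x in nhds 0. w x = 0"
      by (rule eventually_mono[OF eventually_nhds_in_open[of "ball 0 e" 0]]) (use e(1) w0 in auto)
    then have "w has_fps_expansion 0" by (simp add: has_fps_expansion_0_iff)
    with w(1) show ?thesis by (rule fps_expansion_unique_complex)
  qed
  have "infinite (range (\<lambda>j. z + (u (s j), v (s j))))"
  proof
    assume fin: "finite (range (\<lambda>j. z + (u (s j), v (s j))))"
    have "u holomorphic_on ball 0 e" "v holomorphic_on ball 0 e"
      using Su(3) Sv(3) e(2) by (auto intro: holomorphic_on_subset)
    moreover have "finite (range (\<lambda>j. u (s j)))" "finite (range (\<lambda>j. v (s j)))"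
      using finite_imageI[OF fin, of "\<lambda>p. fst (p - z)"] finite_imageI[OF fin, of "\<lambda>p. snd (p - z)"]
      by (simp_all add: image_image)
    ultimately show False using const[OF u] const[OF v] nz by blast
  qed
  then show ?thesis using sub finite_subset by blast
qed

lemma curve_functional_equation:
  fixes G :: "complex \<times> complex \<Rightarrow> complex \<times> complex"
  assumes U: "open U" "0 \<in> U" and G: "holomorphic_map_on G U"
    and u: "fps_conv_radius fu > 0" "fu $ 0 = 0" and v: "fps_conv_radius fv > 0" "fv $ 0 = 0"
    and eq: "\<And>k. subst1 (taylor2 (fst \<circ> G)) fu fv $ k = \<mu> ^ k * fu $ k"
      "\<And>k. subst1 (taylor2 (snd \<circ> G)) fu fv $ k = \<mu> ^ k * fv $ k"
  shows "\<forall>\<^sub>F t in nhds 0. G (eval_fps fu t, eval_fps fv t) = (eval_fps fu (\<mu> * t), eval_fps fv (\<mu> * t))"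
proof -
  have lin: "(\<lambda>t. eval_fps f (\<mu> * t)) has_fps_expansion Abs_fps (\<lambda>n. \<mu> ^ n * f $ n)" if "fps_conv_radius f > 0" for f
  proof -
    have "(eval_fps f \<circ> (\<lambda>t. \<mu> * t)) has_fps_expansion (f oo (fps_const \<mu> * fps_X))"
      by (intro has_fps_expansion_compose eval_fps_has_fps_expansion that fps_expansion_intros) simp
    then show ?thesis by (simp add: o_def fps_compose_linear)
  qed
  have ev: "\<forall>\<^sub>F t in nhds 0. f t = g t" if "f has_fps_expansion F" "g has_fps_expansion F" for f g :: "complex \<Rightarrow> complex" and F
    using that unfolding has_fps_expansion_def by (auto elim: eventually_elim2)
  have 1: "(\<lambda>t. (fst \<circ> G) (eval_fps fu t, eval_fps fv t)) has_fps_expansion Abs_fps (\<lambda>n. \<mu> ^ n * fu $ n)"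
  proof -
    have "subst1 (taylor2 (fst \<circ> G)) fu fv = Abs_fps (\<lambda>n. \<mu> ^ n * fu $ n)" using eq by (simp add: fps_eq_iff)
    then show ?thesis
      using subst1_taylor2_expansion[OF U, of "fst \<circ> G" "eval_fps fu" fu "eval_fps fv" fv] G u v
      by (simp add: holomorphic_map_on_def eval_fps_has_fps_expansion)
  qed
  have 2: "(\<lambda>t. (snd \<circ> G) (eval_fps fu t, eval_fps fv t)) has_fps_expansion Abs_fps (\<lambda>n. \<mu> ^ n * fv $ n)"
  proof -
    have "subst1 (taylor2 (snd \<circ> G)) fu fv = Abs_fps (\<lambda>n. \<mu> ^ n * fv $ n)" using eq by (simp add: fps_eq_iff)
    then show ?thesis
      using subst1_taylor2_expansion[OF U, of "snd \<circ> G" "eval_fps fu" fu "eval_fps fv" fv] G u v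
      by (simp add: holomorphic_map_on_def eval_fps_has_fps_expansion)
  qed
  show ?thesis
    using ev[OF 1 lin[OF u(1)]] ev[OF 2 lin[OF v(1)]]
    by eventually_elim (simp add: prod_eq_iff)
qed

lemma taylor2_linear_coeffs:
  "taylor2 g $ 0 $ 0 = g 0" "taylor2 g $ 1 $ 0 = partial1 g 0" "taylor2 g $ 0 $ 1 = partial2 g 0"
  by (simp_all add: taylor2_def partial1_def partial2_def zero_prod_def)

text \<open>The candidates are the columns of the adjugate of \<zeta> - M; if both vanish, M is
  \<zeta> times the identity.\<close>

lemma det2_zero_imp_kernel:
  fixes a b c d :: complex
  assumes "(\<zeta> - a) * (\<zeta> - d) - b * c = 0"
  obtains p q where "(p, q) \<noteq> (0, 0)" "a * p + b * q = \<zeta> * p" "c * p + d * q = \<zeta> * q"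
proof (cases "b = 0 \<and> \<zeta> = a")
  case False
  show ?thesis
  proof (rule that[of b "\<zeta> - a"])
    show "c * b + d * (\<zeta> - a) = \<zeta> * (\<zeta> - a)" using assms by (simp add: algebra_simps)
  qed (use False in \<open>auto simp: algebra_simps\<close>)
next
  case True
  show ?thesis
  proof (cases "c = 0 \<and> d = \<zeta>")
    case True
    then show ?thesis using \<open>b = 0 \<and> \<zeta> = a\<close> that[of 0 1] by simp
  next
    case False
    then show ?thesis using True that[of "\<zeta> - d" c] by (auto simp: algebra_simps)
  qed
qed

text \<open>The roots are ordered by modulus so that \<alpha> can be the eigenvalue of
  \<open>strong_stable_curve\<close>.\<close>

lemma charpoly2_factor:
  obtains \<alpha> \<beta> where "\<And>\<zeta>. charpoly2 F p \<zeta> = (\<zeta> - \<alpha>) * (\<zeta> - \<beta>)" "norm \<alpha> \<le> norm \<beta>"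
proof -
  define a b c d where "a = partial1 (fst \<circ> F) p" and "b = partial2 (fst \<circ> F) p"
    and "c = partial1 (snd \<circ> F) p" and "d = partial2 (snd \<circ> F) p"
  define s where "s = csqrt ((a - d)\<^sup>2 + 4 * b * c)"
  have s: "s * s = (a - d)\<^sup>2 + 4 * b * c" unfolding s_def power2_eq_square[symmetric] by (rule power2_csqrt)
  have f: "charpoly2 F p \<zeta> = (\<zeta> - (a + d + s) / 2) * (\<zeta> - (a + d - s) / 2)" for \<zeta>
  proof -
    have "4 * ((\<zeta> - (a + d + s) / 2) * (\<zeta> - (a + d - s) / 2)) = (2 * \<zeta> - (a + d)) ^ 2 - s * s"
      by (simp add: field_simps power2_eq_square)
    also have "\<dots> = 4 * ((\<zeta> - a) * (\<zeta> - d) - b * c)"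
      unfolding s by (simp add: algebra_simps power2_eq_square)
    finally have "charpoly2 F p \<zeta> * 4 = ((\<zeta> - (a + d + s) / 2) * (\<zeta> - (a + d - s) / 2)) * 4"
      unfolding charpoly2_def a_def[symmetric] b_def[symmetric] c_def[symmetric] d_def[symmetric]
      by (simp only: mult.commute)
    then show ?thesis by (simp only: mult_cancel_right) simp
  qed
  show ?thesis
  proof (cases "norm ((a + d + s) / 2) \<le> norm ((a + d - s) / 2)")
    case True
    then show ?thesis using that f by blast
  next
    case False
    then show ?thesis using that[of "(a + d - s) / 2" "(a + d + s) / 2"] f by (simp add: mult.commute)
  qed
qed

lemma taylor2_map_bounds:
  fixes G :: "complex \<times> complex \<Rightarrow> complex \<times> complex"
  assumes U: "open U" "0 \<in> U" and G: "holomorphic_map_on G U"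
  obtains R M where "R > 0" "M \<ge> 0" "\<And>i j. norm (taylor2 (fst \<circ> G) $ i $ j) \<le> M / R ^ (i + j)"
    "\<And>i j. norm (taylor2 (snd \<circ> G) $ i $ j) \<le> M / R ^ (i + j)"
proof -
  obtain R where R: "R > 0" "cball 0 R \<times> cball 0 R \<subseteq> U"
    using open_contains_bidisc[OF U(1), of 0 0] U(2) by (auto simp: zero_prod_def)
  obtain M1 where M1: "M1 \<ge> 0" "\<And>i j. norm (taylor2 (fst \<circ> G) $ i $ j) \<le> M1 / R ^ (i + j)"
    using bidisc_derivative_bound[OF U(1) _ R, of "fst \<circ> G"] G unfolding holomorphic_map_on_def by metis
  obtain M2 where M2: "M2 \<ge> 0" "\<And>i j. norm (taylor2 (snd \<circ> G) $ i $ j) \<le> M2 / R ^ (i + j)"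
    using bidisc_derivative_bound[OF U(1) _ R, of "snd \<circ> G"] G unfolding holomorphic_map_on_def by metis
  have M: "norm (taylor2 (fst \<circ> G) $ i $ j) \<le> (M1 + M2) / R ^ (i + j)" "norm (taylor2 (snd \<circ> G) $ i $ j) \<le> (M1 + M2) / R ^ (i + j)" for i j
  proof -
    have "M1 / R ^ (i + j) \<le> (M1 + M2) / R ^ (i + j)" "M2 / R ^ (i + j) \<le> (M1 + M2) / R ^ (i + j)"
      using R M1(1) M2(1) by (intro divide_right_mono; simp)+
    then show "norm (taylor2 (fst \<circ> G) $ i $ j) \<le> (M1 + M2) / R ^ (i + j)" "norm (taylor2 (snd \<circ> G) $ i $ j) \<le> (M1 + M2) / R ^ (i + j)"
      using M1(2)[of i j] M2(2)[of i j] by linarith+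
  qed
  show ?thesis using that[OF R(1) _ M] M1(1) M2(1) by auto
qed

text \<open>No small divisors occur: for k \<ge> 2 one has |\<alpha>^k| \<le> |\<alpha>|^2 <
  |\<alpha>| \<le> |\<beta>|. Choosing the eigenvalue of smaller modulus excludes the resonances
  \<alpha>^k = \<beta>.\<close>

lemma strong_stable_curve:
  fixes G :: "complex \<times> complex \<Rightarrow> complex \<times> complex"
  assumes U: "open U" "0 \<in> U" and G: "holomorphic_map_on G U" and G0: "G 0 = 0"
    and chi: "\<And>\<zeta>. charpoly2 G 0 \<zeta> = (\<zeta> - \<alpha>) * (\<zeta> - \<beta>)" and \<alpha>: "0 < norm \<alpha>" "norm \<alpha> < 1" "norm \<alpha> \<le> norm \<beta>"
  obtains fu fv where "fps_conv_radius fu > 0" "fu $ 0 = 0" "fps_conv_radius fv > 0" "fv $ 0 = 0"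
    "fu \<noteq> 0 \<or> fv \<noteq> 0"
    "\<forall>\<^sub>F t in nhds 0. G (eval_fps fu t, eval_fps fv t) = (eval_fps fu (\<alpha> * t), eval_fps fv (\<alpha> * t))"
proof -
  define g1 g2 where "g1 = taylor2 (fst \<circ> G)" and "g2 = taylor2 (snd \<circ> G)"
  have det: "(\<zeta> - g1 $ 1 $ 0) * (\<zeta> - g2 $ 0 $ 1) - g1 $ 0 $ 1 * g2 $ 1 $ 0 = (\<zeta> - \<alpha>) * (\<zeta> - \<beta>)" for \<zeta>
    using chi[of \<zeta>] by (simp add: charpoly2_def g1_def g2_def taylor2_linear_coeffs del: One_nat_def)
  define \<delta> where "\<delta> = norm \<alpha> - norm \<alpha> ^ 2"
  have \<delta>: "\<delta> > 0" using mult_strict_left_mono[OF \<alpha>(2,1)] by (simp add: \<delta>_def power2_eq_square)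
  have low: "norm ((\<alpha> ^ k - \<alpha>) * (\<alpha> ^ k - \<beta>)) \<ge> \<delta>\<^sup>2" if k: "k \<ge> 2" for k
  proof -
    have "norm \<alpha> ^ k \<le> norm \<alpha> ^ 2" using k \<alpha> by (intro power_decreasing) auto
    then have "norm (\<alpha> ^ k - \<alpha>) \<ge> \<delta>" "norm (\<alpha> ^ k - \<beta>) \<ge> \<delta>"
      using norm_triangle_ineq3[of "\<alpha> ^ k" \<alpha>] norm_triangle_ineq3[of "\<alpha> ^ k" \<beta>] \<alpha>(3)
      by (auto simp: norm_power \<delta>_def)
    then show ?thesis unfolding norm_mult power2_eq_square using \<delta> by (intro mult_mono) auto
  qed
  have ne: "(\<alpha> ^ k - g1 $ 1 $ 0) * (\<alpha> ^ k - g2 $ 0 $ 1) - g1 $ 0 $ 1 * g2 $ 1 $ 0 \<noteq> 0" if "k \<ge> 2" for k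
    using low[OF that] \<delta> unfolding det by (metis norm_zero not_le zero_less_power)
  obtain p q where pq: "(p, q) \<noteq> (0, 0)" "g1 $ 1 $ 0 * p + g1 $ 0 $ 1 * q = \<alpha> * p" "g2 $ 1 $ 0 * p + g2 $ 0 $ 1 * q = \<alpha> * q"
    using det2_zero_imp_kernel[of \<alpha> "g1 $ 1 $ 0" "g2 $ 0 $ 1" "g1 $ 0 $ 1" "g2 $ 1 $ 0"] det[of \<alpha>] by auto
  have g0: "g1 $ 0 $ 0 = 0" "g2 $ 0 $ 0 = 0" using G0 by (simp_all add: g1_def g2_def taylor2_linear_coeffs)
  obtain fu fv where f: "fu $ 0 = 0" "fv $ 0 = 0" "fu $ 1 = p" "fv $ 1 = q"
    "\<And>k. subst1 g1 fu fv $ k = \<alpha> ^ k * fu $ k" "\<And>k. subst1 g2 fu fv $ k = \<alpha> ^ k * fv $ k"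
    using formal_linearizing_curve[OF g0 ne pq(2,3)] by blast
  obtain R M where R: "R > 0" and M0: "M \<ge> 0"
    and M': "\<And>i j. norm (taylor2 (fst \<circ> G) $ i $ j) \<le> M / R ^ (i + j)"
      "\<And>i j. norm (taylor2 (snd \<circ> G) $ i $ j) \<le> M / R ^ (i + j)"
    by (rule taylor2_map_bounds[OF U G]) (rule that)
  note M = M'[folded g1_def g2_def]
  define L where "L = max 0 (ln (1 / \<delta>\<^sup>2))"
  \<comment> \<open>All determinants are at least \<delta>^2 in modulus, so a fixed gain L at every
    addition is enough.\<close>
  define E where "E = (\<lambda>k. (real k - 1) * L)"
  have L0: "L \<ge> 0" by (simp add: L_def)
  have E1: "E k \<le> L * real k" for k using L0 by (simp add: E_def algebra_simps)
  have E2: "E k + E l \<le> E (k + l)" for k l using L0 by (simp add: E_def algebra_simps)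
  have E3: "E k + E l + ln (1 / norm ((\<alpha> ^ (k + l) - g1 $ 1 $ 0) * (\<alpha> ^ (k + l) - g2 $ 0 $ 1) - g1 $ 0 $ 1 * g2 $ 1 $ 0)) \<le> E (k + l)"
    if kl: "2 \<le> k + l" for k l
  proof -
    have "1 / norm ((\<alpha> ^ (k + l) - \<alpha>) * (\<alpha> ^ (k + l) - \<beta>)) \<le> 1 / \<delta>\<^sup>2"
      using low[OF kl] \<delta> by (intro divide_left_mono) (auto intro!: mult_pos_pos zero_less_power)
    moreover have "norm ((\<alpha> ^ (k + l) - \<alpha>) * (\<alpha> ^ (k + l) - \<beta>)) > 0"
      using low[OF kl] \<delta> by (meson less_le_trans zero_less_power)
    ultimately have "ln (1 / norm ((\<alpha> ^ (k + l) - \<alpha>) * (\<alpha> ^ (k + l) - \<beta>))) \<le> L"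
      unfolding L_def by (intro max.coboundedI2 ln_mono) auto
    then show ?thesis unfolding det by (simp add: E_def algebra_simps)
  qed
  have conv: "fps_conv_radius fu > 0" "fps_conv_radius fv > 0"
    using linearizing_curve_converges[OF R M0 M f(1,2) _ f(5,6) E1 E2 ne E3] \<alpha>(2) by auto
  have nz: "fu \<noteq> 0 \<or> fv \<noteq> 0" using pq(1) f(3,4) by auto
  show ?thesis
    by (rule that[OF conv(1) f(1) conv(2) f(2) nz curve_functional_equation[OF U G conv(1) f(1) conv(2) f(2) f(5,6)[unfolded g1_def g2_def]]])
qed

theorem infinite_orbit_near_contracting_periodic_point:
  assumes S: "open S" and H: "holomorphic_map_on H S" and z: "z \<in> iterate_domain H S n" "(H ^^ n) z = z" and n: "n \<ge> 1"
    and chi: "\<And>\<zeta>. charpoly2 (H ^^ n) z \<zeta> = (\<zeta> - \<alpha>) * (\<zeta> - \<beta>)" and \<alpha>: "0 < norm \<alpha>" "norm \<alpha> < 1" "norm \<alpha> \<le> norm \<beta>"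
  shows "\<exists>q. infinite (forward_orbit H S q)"
proof -
  define D where "D = iterate_domain H S n"
  have D: "open D" "holomorphic_map_on (H ^^ n) D" "z \<in> D"
    using iterate_holomorphic[OF S H] z by (auto simp: D_def)
  define U where "U = (\<lambda>p. p + z) -` D"
  define G where "G = (\<lambda>p. p + (- z)) \<circ> ((H ^^ n) \<circ> (\<lambda>p. p + z))"
  have U: "open U" "0 \<in> U" unfolding U_def using D by (auto intro!: open_vimage continuous_intros)
  have G: "holomorphic_map_on G U" unfolding G_def
    by (intro holomorphic_map_on_compose[of _ UNIV] holomorphic_map_on_compose[of _ D] holomorphic_map_on_translate D)
       (auto simp: U_def)
  have G0: "G 0 = 0" using z by (simp add: G_def)
  have "((H ^^ n) has_derivative jacobian (H ^^ n) z) (at (0 + z))"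
    using holomorphic_map_has_derivative[OF D] by simp
  then have "(G has_derivative jacobian (H ^^ n) z) (at 0)"
    unfolding G_def o_def
    by (auto intro!: derivative_eq_intros has_derivative_compose[of "\<lambda>p. p + z" "\<lambda>p. p", where g = "H ^^ n"])
  then have "charpoly2 G 0 \<zeta> = charpoly2 (H ^^ n) z \<zeta>" for \<zeta>
    unfolding jacobian_def charpoly2_def by (simp add: jacobian_eqI[of G])
  then have chi0: "charpoly2 G 0 \<zeta> = (\<zeta> - \<alpha>) * (\<zeta> - \<beta>)" for \<zeta> using chi by simp
  obtain fu fv where f: "fps_conv_radius fu > 0" "fu $ 0 = 0" "fps_conv_radius fv > 0" "fv $ 0 = 0"
    "fu \<noteq> 0 \<or> fv \<noteq> 0"
    "\<forall>\<^sub>F t in nhds 0. G (eval_fps fu t, eval_fps fv t) = (eval_fps fu (\<alpha> * t), eval_fps fv (\<alpha> * t))"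
    by (rule strong_stable_curve[OF U G G0 chi0 \<alpha>])
  have "\<forall>\<^sub>F t in nhds 0. (H ^^ n) (z + (eval_fps fu t, eval_fps fv t)) = z + (eval_fps fu (\<alpha> * t), eval_fps fv (\<alpha> * t))"
    using f(6) by eventually_elim (simp add: G_def algebra_simps)
  moreover have "\<alpha> ^ k \<noteq> 1" if "k \<ge> 1" for k
  proof -
    have "norm (\<alpha> ^ k) < 1" using \<alpha> that by (simp add: norm_power power_less_one_iff)
    then show ?thesis by auto
  qed
  ultimately show ?thesis
    using infinite_orbit_on_curve[OF S H z(1) n _ f(2) _ f(4,5), of "eval_fps fu" "eval_fps fv" \<alpha>] \<alpha> f(1,3)
    by (auto simp: eval_fps_has_fps_expansion)
qed

section \<open>Curves whose multiplier is a Bruno number\<close>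

text \<open>At order k the coefficient of \<psi> is multiplied by \<mu> - \<mu>^k, because
  \<open>(h ^ k) $ k\<close> is \<mu>^k. Formally it only matters that this is nonzero for k \<ge>
  2.\<close>

lemma formal_schroeder:
  fixes h :: "complex fps"
  assumes h0: "h $ 0 = 0" and nr: "\<And>k. k \<ge> 2 \<Longrightarrow> (h $ 1) ^ k \<noteq> h $ 1"
  obtains \<psi> where "\<psi> $ 0 = 0" "\<psi> $ 1 = 1" "\<psi> oo h = fps_const (h $ 1) * \<psi>"
proof -
  define \<mu> where "\<mu> = h $ 1"
  define \<Phi> where "\<Phi> = (\<lambda>(f :: nat \<Rightarrow> complex) k. if k = 0 then 0 else if k = 1 then 1
      else (\<Sum>i<k. f i * (h ^ i) $ k) / (\<mu> - \<mu> ^ k))"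
  have "\<exists>f. \<forall>x. f x = \<Phi> f x"
    by (rule dependent_wellorder_choice) (auto simp: \<Phi>_def)
  then obtain f where f: "\<And>k. f k = \<Phi> f k" by blast
  have f0: "f 0 = 0" and f1: "f 1 = 1" by (subst f, simp add: \<Phi>_def)+
  have "(\<Sum>i\<le>k. f i * (h ^ i) $ k) = \<mu> * f k" for k
  proof -
    consider "k = 0" | "k = 1" | "k \<ge> 2" by linarith
    then show ?thesis
    proof cases
      case 1
      then show ?thesis using f0 by simp
    next
      case 2
      then show ?thesis using f0 f1 by (simp add: \<mu>_def)
    next
      case 3
      have "\<mu> - \<mu> ^ k \<noteq> 0" using nr[OF 3] by (auto simp: \<mu>_def)
      then have "(\<Sum>i<k. f i * (h ^ i) $ k) = f k * (\<mu> - \<mu> ^ k)"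
        using f[of k] 3 by (simp add: \<Phi>_def)
      then show ?thesis
        by (simp add: lessThan_Suc_atMost[symmetric] startsby_zero_power_nth_same[OF h0] \<mu>_def[symmetric] algebra_simps del: One_nat_def)
    qed
  qed
  then have "Abs_fps f oo h = fps_const \<mu> * Abs_fps f"
    by (simp add: fps_eq_iff fps_compose_nth atLeast0AtMost)
  then show ?thesis
    using that[of "Abs_fps f"] f0 f1 by (simp add: \<mu>_def)
qed

lemma subst1_compose:
  assumes u: "u $ 0 = 0" and v: "v $ 0 = 0" and s: "s $ 0 = 0"
  shows "subst1 g (u oo s) (v oo s) = subst1 g u v oo s"
proof (rule fps_ext)
  fix n
  have "subst1 g (u oo s) (v oo s) $ n = (\<Sum>z\<in>{(i, j). i + j \<le> n}. \<Sum>l\<le>n. case z of (i, j) \<Rightarrow> g $ i $ j * (u ^ i * v ^ j) $ l * (s ^ l) $ n)"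
    unfolding subst1_def fps_nth_Abs_fps fps_compose_power[OF s] fps_compose_mult_distrib[OF s, symmetric]
    by (intro sum.cong refl) (auto simp: fps_compose_nth sum_distrib_left atLeast0AtMost mult.assoc)
  also have "\<dots> = (\<Sum>l\<le>n. \<Sum>z\<in>{(i, j). i + j \<le> n}. case z of (i, j) \<Rightarrow> g $ i $ j * (u ^ i * v ^ j) $ l * (s ^ l) $ n)"
    by (rule sum.swap)
  also have "\<dots> = (\<Sum>l\<le>n. \<Sum>z\<in>{(i, j). i + j \<le> l}. case z of (i, j) \<Rightarrow> g $ i $ j * (u ^ i * v ^ j) $ l * (s ^ l) $ n)"
  proof (rule sum.cong[OF refl])
    fix l assume l: "l \<in> {..n}"
    show "(\<Sum>z\<in>{(i, j). i + j \<le> n}. case z of (i, j) \<Rightarrow> g $ i $ j * (u ^ i * v ^ j) $ l * (s ^ l) $ n)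
      = (\<Sum>z\<in>{(i, j). i + j \<le> l}. case z of (i, j) \<Rightarrow> g $ i $ j * (u ^ i * v ^ j) $ l * (s ^ l) $ n)"
    proof (rule sum.mono_neutral_right[OF finite_sum_le_pairs])
      have "i + j \<le> l" if "(u ^ i * v ^ j) $ l \<noteq> 0" for i j
        using that fps_power_mult_nth_eq_0[OF u v, of l i j] by (meson not_less)
      then show "\<forall>z\<in>{(i, j). i + j \<le> n} - {(i, j). i + j \<le> l}.
          (case z of (i, j) \<Rightarrow> g $ i $ j * (u ^ i * v ^ j) $ l * (s ^ l) $ n) = 0"
        by fastforce
    qed (use l in auto)
  qed
  also have "\<dots> = (subst1 g u v oo s) $ n"
    by (simp add: fps_compose_nth subst1_def sum_distrib_right split_def atLeast0AtMost)
  finally show "subst1 g (u oo s) (v oo s) $ n = (subst1 g u v oo s) $ n" .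
qed

text \<open>Reparametrise by the compositional inverse \<sigma> of the Schroeder series: then h oo
  \<sigma> = \<sigma> oo m, where m is multiplication by the multiplier. The new pair need not have
  Puiseux form any more.\<close>

lemma linearized_formal_curve:
  fixes u v h :: "complex fps"
  assumes uv0: "u $ 0 = 0" "v $ 0 = 0" and nz: "u \<noteq> 0 \<or> v \<noteq> 0"
    and h: "h $ 0 = 0" "h $ 1 \<noteq> 0" "\<And>k. k \<ge> 2 \<Longrightarrow> (h $ 1) ^ k \<noteq> h $ 1"
    and eq: "subst1 g1 u v = u oo h" "subst1 g2 u v = v oo h"
  obtains fu fv where "fu $ 0 = 0" "fv $ 0 = 0" "fu \<noteq> 0 \<or> fv \<noteq> 0"
    "\<And>k. subst1 g1 fu fv $ k = (h $ 1) ^ k * fu $ k" "\<And>k. subst1 g2 fu fv $ k = (h $ 1) ^ k * fv $ k"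
proof -
  define m where "m = fps_const (h $ 1) * fps_X"
  obtain \<psi> where \<psi>: "\<psi> $ 0 = 0" "\<psi> $ 1 = 1" "\<psi> oo h = fps_const (h $ 1) * \<psi>"
    using formal_schroeder[OF h(1,3)] by blast
  define \<sigma> where "\<sigma> = fps_inv \<psi>"
  have \<sigma>0: "\<sigma> $ 0 = 0" by (simp add: \<sigma>_def fps_inv_def)
  have \<sigma>\<psi>: "\<sigma> oo \<psi> = fps_X" and \<psi>\<sigma>: "\<psi> oo \<sigma> = fps_X"
    using fps_inv[of \<psi>] fps_inv_right[of \<psi>] \<psi> by (auto simp: \<sigma>_def)
  have m0: "m $ 0 = 0" by (simp add: m_def)
  have "\<psi> oo (h oo \<sigma>) = (\<psi> oo h) oo \<sigma>" by (rule fps_compose_assoc) (use \<sigma>0 h in auto)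
  also have "\<dots> = m" unfolding \<psi>(3) m_def
    by (simp add: fps_compose_mult_distrib[OF \<sigma>0] \<psi>\<sigma>)
  finally have "\<sigma> oo (\<psi> oo (h oo \<sigma>)) = \<sigma> oo m" by simp
  moreover have "\<sigma> oo (\<psi> oo (h oo \<sigma>)) = (\<sigma> oo \<psi>) oo (h oo \<sigma>)"
    by (rule fps_compose_assoc) (use \<sigma>0 h \<psi> in auto)
  ultimately have h\<sigma>: "h oo \<sigma> = \<sigma> oo m" using h(1) by (simp add: \<sigma>\<psi>)
  have step: "(f oo h) oo \<sigma> = (f oo \<sigma>) oo m" for f :: "complex fps"
    using fps_compose_assoc[of \<sigma> h f] fps_compose_assoc[of m \<sigma> f] \<sigma>0 h(1) m0 h\<sigma> by simp
  have cancel: "f = 0" if "f oo \<sigma> = 0" for f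
  proof -
    have "f = (f oo (\<sigma> oo \<psi>))" by (simp add: \<sigma>\<psi>)
    also have "\<dots> = (f oo \<sigma>) oo \<psi>" by (rule fps_compose_assoc) (use \<sigma>0 \<psi> in auto)
    finally show ?thesis using that by simp
  qed
  show ?thesis
  proof (rule that[of "u oo \<sigma>" "v oo \<sigma>"])
    show "u oo \<sigma> \<noteq> 0 \<or> v oo \<sigma> \<noteq> 0" using cancel nz by blast
    show "subst1 g1 (u oo \<sigma>) (v oo \<sigma>) $ k = (h $ 1) ^ k * (u oo \<sigma>) $ k" for k
      unfolding subst1_compose[OF uv0 \<sigma>0] eq step by (simp add: m_def fps_compose_linear)
    show "subst1 g2 (u oo \<sigma>) (v oo \<sigma>) $ k = (h $ 1) ^ k * (v oo \<sigma>) $ k" for k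
      unfolding subst1_compose[OF uv0 \<sigma>0] eq step by (simp add: m_def fps_compose_linear)
  qed (use uv0 in auto)
qed

lemma det2_annihilates_kernel:
  fixes a b c d :: complex
  assumes 1: "a * p + b * q = \<zeta> * p" and 2: "c * p + d * q = \<zeta> * q"
  shows "((\<zeta> - a) * (\<zeta> - d) - b * c) * p = 0" "((\<zeta> - a) * (\<zeta> - d) - b * c) * q = 0"
proof -
  have 3: "(\<zeta> - a) * p = b * q" "(\<zeta> - d) * q = c * p" using 1 2 by (simp_all add: algebra_simps)
  have "((\<zeta> - a) * (\<zeta> - d) - b * c) * p = (\<zeta> - d) * ((\<zeta> - a) * p) - b * (c * p)" by (simp add: algebra_simps)
  also have "\<dots> = 0" unfolding 3(1) 3(2)[symmetric] by (simp add: algebra_simps)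
  finally show "((\<zeta> - a) * (\<zeta> - d) - b * c) * p = 0" .
  have "((\<zeta> - a) * (\<zeta> - d) - b * c) * q = (\<zeta> - a) * ((\<zeta> - d) * q) - c * (b * q)" by (simp add: algebra_simps)
  also have "\<dots> = 0" unfolding 3(2) 3(1)[symmetric] by (simp add: algebra_simps)
  finally show "((\<zeta> - a) * (\<zeta> - d) - b * c) * q = 0" .
qed

text \<open>At the lowest order d of the pair the nonlinear terms vanish, so the leading
  coefficients form an eigenvector for \<mu>^d. For a singular curve d may exceed 1, which is why a
  power of \<mu> appears.\<close>

lemma linearized_curve_tangent_eigenvalue:
  fixes fu fv :: "complex fps"
  assumes f: "fu $ 0 = 0" "fv $ 0 = 0" "fu \<noteq> 0 \<or> fv \<noteq> 0"
    and eq: "\<And>k. subst1 g1 fu fv $ k = \<mu> ^ k * fu $ k" "\<And>k. subst1 g2 fu fv $ k = \<mu> ^ k * fv $ k"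
  obtains d where "d \<ge> 1" "(\<mu> ^ d - g1 $ 1 $ 0) * (\<mu> ^ d - g2 $ 0 $ 1) - g1 $ 0 $ 1 * g2 $ 1 $ 0 = 0"
proof -
  define P where "P = (\<lambda>k. fu $ k \<noteq> 0 \<or> fv $ k \<noteq> 0)"
  have "\<exists>k. P k" using f(3) by (auto simp: P_def fps_eq_iff)
  define d where "d = (LEAST k. P k)"
  have d: "P d" unfolding d_def using \<open>\<exists>k. P k\<close> by (rule LeastI_ex)
  have less: "fu $ l = 0" "fv $ l = 0" if "l < d" for l
    using not_less_Least[of l P] that by (auto simp: d_def P_def)
  have d1: "d \<ge> 1" using d f by (cases d) (auto simp: P_def)
  have "subst1_higher g fu fv d = 0" for g
  proof -
    have "subst1_higher g fu fv d = subst1_higher g 0 0 d"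
      by (rule subst1_higher_cong) (use f less in auto)
    also have "\<dots> = 0" unfolding subst1_higher_def
      by (rule sum.neutral) (auto simp: power_0_left)
    finally show ?thesis .
  qed
  then have e: "g1 $ 1 $ 0 * fu $ d + g1 $ 0 $ 1 * fv $ d = \<mu> ^ d * fu $ d" "g2 $ 1 $ 0 * fu $ d + g2 $ 0 $ 1 * fv $ d = \<mu> ^ d * fv $ d"
    using eq[of d] by (simp_all add: subst1_nth_split[OF d1] del: One_nat_def)
  define \<Delta> where "\<Delta> = (\<mu> ^ d - g1 $ 1 $ 0) * (\<mu> ^ d - g2 $ 0 $ 1) - g1 $ 0 $ 1 * g2 $ 1 $ 0"
  have "\<Delta> * fu $ d = 0" "\<Delta> * fv $ d = 0"
    unfolding \<Delta>_def using det2_annihilates_kernel[OF e] by blast+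
  then have "\<Delta> = 0" using d by (auto simp: P_def)
  then show ?thesis using that d1 by (simp add: \<Delta>_def)
qed

text \<open>As |\<mu>| = 1, the number |\<mu>^(e+1) - \<mu>| equals |\<mu>^e - 1|; the shift of the
  exponent turns k \<le> q j into e < q j. The series of 1/q_j is extracted as well, because it pays
  for constant factors in the divisors.\<close>

lemma bruno_number_divisor_data:
  assumes "bruno_number \<mu>"
  obtains q :: "nat \<Rightarrow> nat" and \<Omega> where "strict_mono q" "1 < q 0" "norm \<mu> = 1"
    "\<And>j. 0 < \<Omega> j" "\<And>j. \<Omega> j \<le> 2"
    "\<And>j e. 1 \<le> e \<Longrightarrow> e < q j \<Longrightarrow> \<Omega> j \<le> norm (\<mu> ^ e - 1)"
    "summable (\<lambda>j. 1 / real (q j) * ln (1 / \<Omega> (Suc j)))" "summable (\<lambda>j. 1 / real (q j))"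
    "\<And>e. e \<ge> 1 \<Longrightarrow> \<mu> ^ e \<noteq> 1"
proof -
  obtain q :: "nat \<Rightarrow> nat" where n1: "norm \<mu> = 1" and q: "1 < q 0" "strict_mono q"
    "\<And>k. bruno_Omega \<mu> (q (Suc k)) \<noteq> 0"
    "summable (\<lambda>k. 1 / real (q k) * ln (1 / bruno_Omega \<mu> (q (Suc k))))"
    using assms unfolding bruno_number_def by blast
  define \<Omega> where "\<Omega> = (\<lambda>j. bruno_Omega \<mu> (q j))"
  have q2: "q j \<ge> 2" for j using q(1) strict_mono_mono[OF q(2), THEN monoD, of 0 j] by simp
  have qj: "q j \<ge> j" for j using strict_mono_imp_increasing[OF q(2)] .
  have le: "\<Omega> j \<le> norm (\<mu> ^ k - \<mu>)" if "2 \<le> k" "k \<le> q j" for j k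
    unfolding \<Omega>_def bruno_Omega_def using that by (intro Min_le) auto
  have ne: "(\<lambda>k. cmod (\<mu> ^ k - \<mu>)) ` {2..q j} \<noteq> {}" for j using q2[of j] by auto
  have \<Omega>0: "\<Omega> j \<ge> 0" for j
    unfolding \<Omega>_def bruno_Omega_def using ne[of j] by (intro Min.boundedI) auto
  have \<Omega>S: "\<Omega> (Suc j) \<le> \<Omega> j" for j
    unfolding \<Omega>_def bruno_Omega_def using ne[of j] strict_monoD[OF q(2), of j "Suc j"]
    by (intro Min_antimono image_mono) auto
  \<comment> \<open>The definition excludes zeros at \<open>q (Suc k)\<close> only; monotonicity
    supplies the index 0.\<close>
  have pos: "\<Omega> j > 0" for j
    using \<Omega>0[of "Suc j"] q(3)[of j] \<Omega>S[of j] unfolding \<Omega>_def[symmetric] by (smt (verit) \<Omega>_def)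
  have le': "\<Omega> j \<le> norm (\<mu> ^ e - 1)" if "1 \<le> e" "e < q j" for j e
  proof -
    have "\<mu> ^ Suc e - \<mu> = \<mu> * (\<mu> ^ e - 1)" by (simp add: algebra_simps)
    then have "norm (\<mu> ^ Suc e - \<mu>) = norm (\<mu> ^ e - 1)" using n1 by (simp add: norm_mult)
    with le[of "Suc e" j] that show ?thesis by simp
  qed
  have two: "\<Omega> j \<le> 2" for j
  proof -
    have "\<Omega> j \<le> norm (\<mu> ^ 1 - 1)" using le'[of 1 j] q2[of j] by simp
    also have "\<dots> \<le> norm \<mu> + norm (1::complex)" using norm_triangle_ineq4[of \<mu> 1] by simp
    finally show ?thesis using n1 by simp
  qed
  have nr: "\<mu> ^ e \<noteq> 1" if "e \<ge> 1" for e
    using le'[of e "Suc e"] qj[of "Suc e"] pos[of "Suc e"] that by auto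
  \<comment> \<open>Compactness of the circle gives a power of \<mu> this close to 1. From index e0
    on, ln (1/\<Omega>) \<ge> 1, and the Bruno series dominates the series of 1/q_j.\<close>
  obtain e0 where e0: "e0 \<ge> 1" "norm (\<mu> ^ e0 - 1) < exp (- 1)"
  proof -
    have "\<exists>l\<in>sphere 0 1. \<exists>r. strict_mono r \<and> ((\<lambda>n. \<mu> ^ n) \<circ> r) \<longlonglongrightarrow> l"
      using compact_sphere[of "0::complex" 1] n1 unfolding compact_def by (auto simp: norm_power)
    then obtain l r where r: "strict_mono r" "(\<lambda>n. \<mu> ^ r n) \<longlonglongrightarrow> l" by (auto simp: o_def)
    then have "Cauchy (\<lambda>n. \<mu> ^ r n)" by (intro LIMSEQ_imp_Cauchy)
    then obtain N where N: "\<And>m n. m \<ge> N \<Longrightarrow> n \<ge> N \<Longrightarrow> norm (\<mu> ^ r m - \<mu> ^ r n) < exp (- 1)"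
      unfolding Cauchy_def dist_norm by (metis exp_gt_zero)
    define e where "e = r (Suc N) - r N"
    have e: "e \<ge> 1" "r (Suc N) = r N + e" using strict_monoD[OF r(1), of N "Suc N"] by (auto simp: e_def)
    have "norm (\<mu> ^ r (Suc N) - \<mu> ^ r N) = norm (\<mu> ^ r N * (\<mu> ^ e - 1))"
      unfolding e(2) by (simp add: power_add algebra_simps)
    also have "\<dots> = norm (\<mu> ^ e - 1)" using n1 by (simp add: norm_mult norm_power)
    finally show ?thesis using that e(1) N[of "Suc N" N] by simp
  qed
  have s1: "summable (\<lambda>j. 1 / real (q j))"
  proof (rule summable_comparison_test'[OF q(4), of e0])
    fix j assume j: "j \<ge> e0"
    have "\<Omega> (Suc j) \<le> norm (\<mu> ^ e0 - 1)" using le'[of e0 "Suc j"] e0 qj[of "Suc j"] j by simp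
    then have "\<Omega> (Suc j) \<le> exp (- 1)" using e0 by linarith
    then have "exp 1 \<le> 1 / \<Omega> (Suc j)" using pos[of "Suc j"]
      by (simp add: exp_minus field_simps)
    then have "1 \<le> ln (1 / \<Omega> (Suc j))" using pos[of "Suc j"] by (subst ln_ge_iff) auto
    then have "1 / real (q j) * 1 \<le> 1 / real (q j) * ln (1 / \<Omega> (Suc j))"
      by (intro mult_left_mono) auto
    then show "norm (1 / real (q j)) \<le> 1 / real (q j) * ln (1 / bruno_Omega \<mu> (q (Suc j)))"
      by (simp add: \<Omega>_def)
  qed
  show ?thesis
    by (rule that[OF q(2,1) n1 pos two le' _ s1 nr]) (use q(4) in \<open>auto simp: \<Omega>_def\<close>)
qed

text \<open>If e k is small, then so is |\<mu>^l - 1| for some l \<le> m k, hence k \<ge> q_j / m.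
  If e k and e l are both small, the triangle inequality makes |\<mu>^(l-k) - 1| small, hence l - k
  \<ge> q_j. This sparsity is what \<open>superadditive_absorbs_divisors\<close> asks for.\<close>

lemma bruno_divisors_absorbed:
  assumes b: "bruno_number \<mu>" and e0: "\<And>k. e k = norm (\<mu> ^ k - \<alpha>)" and m: "m \<ge> 1"
    and near: "\<And>k. k0 \<le> k \<Longrightarrow> \<exists>l. 1 \<le> l \<and> l \<le> m * k \<and> norm (\<mu> ^ l - 1) \<le> real m * e k"
  obtains E :: "nat \<Rightarrow> real" and C where "\<And>k. E k \<le> C * real k"
    "\<And>k l. 0 < k \<Longrightarrow> 0 < l \<Longrightarrow> E k + E l \<le> E (k + l)"
    "\<And>k l. 0 < k \<Longrightarrow> 0 < l \<Longrightarrow> k0 \<le> k + l \<Longrightarrow> E k + E l + ln (1 / e (k + l)) \<le> E (k + l)"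
    "\<And>k. k0 \<le> k \<Longrightarrow> e k > 0"
proof -
  obtain q :: "nat \<Rightarrow> nat" and \<Omega> where q: "strict_mono q" "1 < q 0" and n1: "norm \<mu> = 1"
    and \<Omega>: "\<And>j. 0 < \<Omega> j" "\<And>j. \<Omega> j \<le> 2"
    and low: "\<And>j e. 1 \<le> e \<Longrightarrow> e < q j \<Longrightarrow> \<Omega> j \<le> norm (\<mu> ^ e - 1)"
    and sm: "summable (\<lambda>j. 1 / real (q j) * ln (1 / \<Omega> (Suc j)))" "summable (\<lambda>j. 1 / real (q j))"
    by (rule bruno_number_divisor_data[OF b]) (rule that)
  have q2: "q j \<ge> 2" for j using q(2) strict_mono_mono[OF q(1), THEN monoD, of 0 j] by simp
  have qj: "q j \<ge> j" for j using strict_mono_imp_increasing[OF q(1)] .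
  \<comment> \<open>The factor m comes from \<open>near\<close>, the factor 2 from the sum of two
    divisors in \<open>gap\<close>; as \<Omega> is at most 2, it also gives w \<le> 1.\<close>
  define w where "w = (\<lambda>j. \<Omega> j / (2 * real m))"
  define Q where "Q = (\<lambda>j. real (q j) / real m)"
  have Qpos: "Q j > 0" for j using q2[of j] m by (simp add: Q_def)
  have Qunb: "\<exists>j. Q j > B" for B
  proof -
    obtain j :: nat where "real j > B * real m" using reals_Archimedean2 by blast
    also have "real j \<le> real (q j)" using qj by simp
    finally have "Q j > B" using m by (simp add: Q_def pos_less_divide_eq)
    then show ?thesis by blast
  qed
  have wpos: "0 < w j" for j using \<Omega> m by (simp add: w_def)
  have wle: "w j \<le> 1" for j
  proof -
    have "\<Omega> j \<le> 2 * real m" using \<Omega>(2)[of j] m by simp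
    then show ?thesis using m by (simp add: w_def)
  qed
  have ws: "2 * real m * w j = \<Omega> j" for j using m by (simp add: w_def)
  \<comment> \<open>The constant 2 m in w contributes ln (2 m) times the series of 1/q_j.\<close>
  have sumw: "summable (\<lambda>j. ln (1 / w (Suc j)) / Q j)"
  proof -
    have "summable (\<lambda>j. real m * (1 / real (q j) * ln (1 / \<Omega> (Suc j)) + ln (2 * real m) * (1 / real (q j))))"
      by (intro summable_mult summable_add sm)
    moreover have "real m * (1 / real (q j) * ln (1 / \<Omega> (Suc j)) + ln (2 * real m) * (1 / real (q j))) = ln (1 / w (Suc j)) / Q j" for j
    proof -
      have "1 / w (Suc j) = 1 / \<Omega> (Suc j) * (2 * real m)" by (simp add: w_def)
      then have "ln (1 / w (Suc j)) = ln (1 / \<Omega> (Suc j)) + ln (2 * real m)"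
        using \<Omega>(1)[of "Suc j"] m by (simp only:) (rule ln_mult_pos; simp)
      then show ?thesis using m q2[of j] by (simp add: Q_def field_simps)
    qed
    ultimately show ?thesis by (simp only:)
  qed
  have small: "Q j \<le> real k" if "k0 \<le> k" "e k < w j" for j k
  proof -
    from near[OF that(1)] obtain l where l: "1 \<le> l" "l \<le> m * k" "norm (\<mu> ^ l - 1) \<le> real m * e k" by blast
    have "real m * e k < real m * w j" using that(2) m by simp
    also have "\<dots> \<le> \<Omega> j" using ws[of j] \<Omega>(1)[of j] by linarith
    finally have "norm (\<mu> ^ l - 1) < \<Omega> j" using l(3) by linarith
    then have "q j \<le> l" using low[of l j] l(1) by linarith
    then have "real (q j) \<le> real m * real k" using l(2) by (metis of_nat_le_iff of_nat_mult order_trans)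
    then show ?thesis using m by (simp add: Q_def pos_divide_le_eq mult.commute)
  qed
  have gap: "Q j \<le> real l - real k" if "k0 \<le> k" "k < l" "e k < w j" "e l < w j" for j k l
  proof -
    define i where "i = l - k"
    have i: "i \<ge> 1" "l = k + i" using that(2) by (auto simp: i_def)
    have "norm (\<mu> ^ i - 1) = norm (\<mu> ^ k * (\<mu> ^ i - 1))" using n1 by (simp add: norm_mult norm_power)
    also have "\<mu> ^ k * (\<mu> ^ i - 1) = (\<mu> ^ l - \<alpha>) - (\<mu> ^ k - \<alpha>)" by (simp add: i(2) power_add algebra_simps)
    also have "norm \<dots> \<le> e l + e k" unfolding e0 by (rule norm_triangle_ineq4)
    also have "\<dots> < 2 * w j" using that by linarith
    also have "\<dots> \<le> 2 * real m * w j" using m wpos[of j] by simp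
    finally have "norm (\<mu> ^ i - 1) < \<Omega> j" unfolding ws .
    then have "q j \<le> i" using low[of i j] i(1) by linarith
    then have "real (q j) \<le> real l - real k" by (simp add: i(2))
    moreover have "Q j \<le> real (q j)" using m divide_left_mono[of 1 "real m" "real (q j)"] by (simp add: Q_def)
    ultimately show ?thesis by linarith
  qed
  show ?thesis
    by (rule superadditive_absorbs_divisors[where e = e and ?k0.0 = k0, OF Qpos Qunb wpos wle sumw small gap];
        (assumption | rule that; assumption))
qed

text \<open>The two factors of the determinant are absorbed separately, and the sum of
  \<open>Ea\<close> and \<open>Eb\<close> serves for the product. The comparison with |\<mu>^l - 1|
  takes l = k - d for the first factor and l = m k for the second, where \<beta>^m = 1 enters. The
  threshold \<open>Suc d\<close> avoids the zero of \<mu>^k - \<mu>^d at k = d.\<close>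

theorem infinite_orbit_on_bruno_curve:
  fixes H :: "complex \<times> complex \<Rightarrow> complex \<times> complex"
  assumes S: "open S" "0 \<in> S" and H: "holomorphic_map_on H S"
    and b: "bruno_number \<mu>" and f: "fu $ 0 = 0" "fv $ 0 = 0" "fu \<noteq> 0 \<or> fv \<noteq> 0"
    and eq: "\<And>k. subst1 (taylor2 (fst \<circ> H)) fu fv $ k = \<mu> ^ k * fu $ k"
      "\<And>k. subst1 (taylor2 (snd \<circ> H)) fu fv $ k = \<mu> ^ k * fv $ k"
    and chi: "\<And>\<zeta>. charpoly2 H 0 \<zeta> = (\<zeta> - \<mu> ^ d) * (\<zeta> - \<beta>)" and \<beta>: "m \<ge> 1" "\<beta> ^ m = 1"
  shows "\<exists>q. infinite (forward_orbit H S q)"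
proof -
  define g1 g2 where "g1 = taylor2 (fst \<circ> H)" and "g2 = taylor2 (snd \<circ> H)"
  have det: "(\<zeta> - g1 $ 1 $ 0) * (\<zeta> - g2 $ 0 $ 1) - g1 $ 0 $ 1 * g2 $ 1 $ 0 = (\<zeta> - \<mu> ^ d) * (\<zeta> - \<beta>)" for \<zeta>
    using chi[of \<zeta>] by (simp add: charpoly2_def g1_def g2_def taylor2_linear_coeffs del: One_nat_def)
  obtain R M where R: "R > 0" and M0: "M \<ge> 0"
    and M': "\<And>i j. norm (taylor2 (fst \<circ> H) $ i $ j) \<le> M / R ^ (i + j)"
      "\<And>i j. norm (taylor2 (snd \<circ> H) $ i $ j) \<le> M / R ^ (i + j)"
    by (rule taylor2_map_bounds[OF S H]) (rule that)
  note M = M'[folded g1_def g2_def]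
  have "norm \<mu> = 1 \<and> (\<forall>e\<ge>1. \<mu> ^ e \<noteq> 1)"
    by (rule bruno_number_divisor_data[OF b]) blast
  then have n1: "norm \<mu> = 1" and nr: "\<And>e. e \<ge> 1 \<Longrightarrow> \<mu> ^ e \<noteq> 1" by auto
  have \<beta>1: "norm \<beta> = 1"
  proof -
    have "norm \<beta> ^ m = 1" using \<beta> by (simp flip: norm_power)
    then show ?thesis using \<beta>(1) by (metis norm_ge_zero power_eq_1_iff not_one_le_zero abs_of_nonneg real_norm_def)
  qed
  define ea eb where "ea = (\<lambda>k. norm (\<mu> ^ k - \<mu> ^ d))" and "eb = (\<lambda>k. norm (\<mu> ^ k - \<beta>))"
  have ea: "ea k = norm (\<mu> ^ k - \<mu> ^ d)" and eb: "eb k = norm (\<mu> ^ k - \<beta>)" for k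
    by (simp_all add: ea_def eb_def)
  have neara: "\<exists>l. 1 \<le> l \<and> l \<le> 1 * k \<and> norm (\<mu> ^ l - 1) \<le> real 1 * ea k" if "Suc d \<le> k" for k
  proof -
    have "\<mu> ^ k - \<mu> ^ d = \<mu> ^ d * (\<mu> ^ (k - d) - 1)" using that by (simp add: algebra_simps flip: power_add)
    then have "ea k = norm (\<mu> ^ (k - d) - 1)" using n1 by (simp add: ea_def norm_mult norm_power)
    then show ?thesis using that by (intro exI[of _ "k - d"]) auto
  qed
  have nearb: "\<exists>l. 1 \<le> l \<and> l \<le> m * k \<and> norm (\<mu> ^ l - 1) \<le> real m * eb k" if "Suc d \<le> k" for k
  proof -
    have "norm ((\<mu> ^ k) ^ m - \<beta> ^ m) \<le> real m * eb k" unfolding eb_def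
      by (rule norm_power_diff) (use n1 \<beta>1 in \<open>auto simp: norm_power\<close>)
    then show ?thesis using that \<beta> by (intro exI[of _ "m * k"]) (simp add: power_mult mult.commute)
  qed
  obtain Ea Ca where Ea: "\<And>k. Ea k \<le> Ca * real k" "\<And>k l. 0 < k \<Longrightarrow> 0 < l \<Longrightarrow> Ea k + Ea l \<le> Ea (k + l)"
    "\<And>k l. 0 < k \<Longrightarrow> 0 < l \<Longrightarrow> Suc d \<le> k + l \<Longrightarrow> Ea k + Ea l + ln (1 / ea (k + l)) \<le> Ea (k + l)"
    "\<And>k. Suc d \<le> k \<Longrightarrow> ea k > 0"
    by (rule bruno_divisors_absorbed[where ?k0.0 = "Suc d", OF b ea order_refl neara]; (assumption | rule that; assumption))
  obtain Eb Cb where Eb: "\<And>k. Eb k \<le> Cb * real k" "\<And>k l. 0 < k \<Longrightarrow> 0 < l \<Longrightarrow> Eb k + Eb l \<le> Eb (k + l)"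
    "\<And>k l. 0 < k \<Longrightarrow> 0 < l \<Longrightarrow> Suc d \<le> k + l \<Longrightarrow> Eb k + Eb l + ln (1 / eb (k + l)) \<le> Eb (k + l)"
    "\<And>k. Suc d \<le> k \<Longrightarrow> eb k > 0"
    by (rule bruno_divisors_absorbed[where ?k0.0 = "Suc d", OF b eb \<beta>(1) nearb]; (assumption | rule that; assumption))
  define E where "E = (\<lambda>k. Ea k + Eb k)"
  have E1: "E k \<le> (Ca + Cb) * real k" for k using Ea(1)[of k] Eb(1)[of k] by (simp add: E_def algebra_simps)
  have E2: "E k + E l \<le> E (k + l)" if "0 < k" "0 < l" for k l using Ea(2)[OF that] Eb(2)[OF that] by (simp add: E_def)
  have nd: "norm ((\<mu> ^ k - g1 $ 1 $ 0) * (\<mu> ^ k - g2 $ 0 $ 1) - g1 $ 0 $ 1 * g2 $ 1 $ 0) = ea k * eb k" for k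
    unfolding det by (simp add: ea_def eb_def norm_mult)
  have ne: "(\<mu> ^ k - g1 $ 1 $ 0) * (\<mu> ^ k - g2 $ 0 $ 1) - g1 $ 0 $ 1 * g2 $ 1 $ 0 \<noteq> 0" if "Suc d \<le> k" for k
    using nd[of k] Ea(4)[OF that] Eb(4)[OF that] by (metis mult_eq_0_iff norm_zero order_less_irrefl)
  have E3: "E k + E l + ln (1 / norm ((\<mu> ^ (k + l) - g1 $ 1 $ 0) * (\<mu> ^ (k + l) - g2 $ 0 $ 1) - g1 $ 0 $ 1 * g2 $ 1 $ 0)) \<le> E (k + l)"
    if kl: "0 < k" "0 < l" "Suc d \<le> k + l" for k l
  proof -
    have "ln (1 / (ea (k + l) * eb (k + l))) = ln (1 / ea (k + l)) + ln (1 / eb (k + l))"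
      using Ea(4)[OF kl(3)] Eb(4)[OF kl(3)] by (simp add: ln_div ln_mult_pos)
    then show ?thesis unfolding nd using Ea(3)[OF kl] Eb(3)[OF kl] by (simp add: E_def)
  qed
  have conv: "fps_conv_radius fu > 0" "fps_conv_radius fv > 0"
    using linearizing_curve_converges[OF R M0 M f(1,2) _ eq[folded g1_def g2_def] E1 E2 ne E3] n1 by auto
  have "\<forall>\<^sub>F t in nhds 0. H (eval_fps fu t, eval_fps fv t) = (eval_fps fu (\<mu> * t), eval_fps fv (\<mu> * t))"
    by (rule curve_functional_equation[OF S H conv(1) f(1) conv(2) f(2) eq])
  then have lin: "\<forall>\<^sub>F t in nhds 0. (H ^^ 1) (0 + (eval_fps fu t, eval_fps fv t)) = 0 + (eval_fps fu (\<mu> * t), eval_fps fv (\<mu> * t))"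
    by simp
  have dom: "0 \<in> iterate_domain H S 1" using S by (simp add: iterate_domain_def)
  have "\<mu> \<noteq> 0" using n1 by auto
  then show ?thesis
    using infinite_orbit_on_curve[OF S(1) H dom order_refl eval_fps_has_fps_expansion[OF conv(1)] f(1)
       eval_fps_has_fps_expansion[OF conv(2)] f(2,3) lin _ _ nr] n1 by auto
qed

section \<open>Continua of points that stay in a ball\<close>

text \<open>Boundary bumping. A component that misses the frontier lies in U; by Sura-Bura it has a
  neighbourhood inside U that is clopen in K \<inter> closure U, and this is then clopen in K,
  against connectedness.\<close>

lemma component_meets_frontier:
  fixes K :: "'a::euclidean_space set"
  assumes K: "compact K" "connected K" and U: "open U" and q: "q \<in> K \<inter> U" and ns: "\<not> K \<subseteq> U"
  shows "connected_component_set (K \<inter> closure U) q \<inter> frontier U \<noteq> {}"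
proof
  assume e: "connected_component_set (K \<inter> closure U) q \<inter> frontier U = {}"
  define S where "S = K \<inter> closure U"
  define D where "D = connected_component_set S q"
  have S: "compact S" unfolding S_def using K by (intro compact_Int_closed) auto
  have qS: "q \<in> S" using q closure_subset by (auto simp: S_def)
  then have D: "D \<in> components S" by (auto simp: components_def D_def)
  have "D \<subseteq> closure U" unfolding D_def S_def using connected_component_subset by blast
  then have DU: "D \<subseteq> U" using e U unfolding D_def S_def by (auto simp: frontier_def interior_open)
  obtain T where T: "openin (top_of_set S) T" "compact T" "D \<subseteq> T" "T \<subseteq> U"
    using Sura_Bura_clopen_subset[OF _ D _ U DU] S compact_components[OF S D] closed_imp_locally_compact compact_imp_closed
    by metis
  obtain A where A: "open A" "T = S \<inter> A" using T(1) by (auto simp: openin_open)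
  have "T = K \<inter> (A \<inter> U)" using A(2) T(4) closure_subset by (auto simp: S_def)
  then have "openin (top_of_set K) T" using A(1) U by (auto simp: openin_open)
  moreover have "closedin (top_of_set K) T"
    using T(2) A(2) by (intro closed_subset compact_imp_closed) (auto simp: S_def)
  ultimately have "T = {} \<or> T = K" using K(2) connected_clopen by blast
  moreover have "q \<in> T" using T(3) qS by (auto simp: D_def)
  ultimately show False using T(4) ns by auto
qed

text \<open>
  A variant of Sierpinski's theorem that a continuum is not a countable disjoint union of at
  least two nonempty closed sets.
\<close>

lemma continuum_subset_of_increasing_union:
  fixes K :: "'a::euclidean_space set" and V :: "nat \<Rightarrow> 'a set"
  assumes K: "compact K" "connected K" "K \<noteq> {}" "K \<subseteq> (\<Union>n. V n)" and cl: "\<And>n. closed (V n)"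
    and mono: "\<And>n m. n \<le> m \<Longrightarrow> V n \<subseteq> V m"
    and op: "\<And>n m. n \<le> m \<Longrightarrow> openin (top_of_set (V m)) (V n)"
  shows "\<exists>n. K \<subseteq> V n"
proof (rule ccontr)
  assume no: "\<nexists>n. K \<subseteq> V n"
  define bad where "bad = (\<lambda>L. compact L \<and> connected L \<and> L \<noteq> {} \<and> L \<subseteq> K \<and> (\<forall>n. \<not> L \<subseteq> V n))"
  \<comment> \<open>To avoid V n, follow the component of a point q outside V n up to the frontier
    of an open set U2 that is separated from V n.\<close>
  have step: "\<exists>L'. bad L' \<and> L' \<subseteq> L \<and> L' \<inter> V n = {}" if L: "bad L" for L n
  proof (cases "L \<inter> V n = {}")
    case False
    obtain q where q: "q \<in> L" "q \<notin> V n" using L by (auto simp: bad_def)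
    have "q \<in> K" using q(1) L by (auto simp: bad_def)
    then obtain m0 where "q \<in> V m0" using K(4) by blast
    then obtain m where m: "q \<in> V m" "n \<le> m" using mono[of m0 "max m0 n"] by (meson max.cobounded1 max.cobounded2 subsetD)
    obtain A where A: "open A" "V n = V m \<inter> A" using op[OF m(2)] by (auto simp: openin_open)
    have "closed (V m - A)" using cl A(1) by (intro closed_Diff)
    moreover have "V n \<inter> (V m - A) = {}" using A by auto
    ultimately obtain U1 U2 where U: "open U1" "open U2" "V n \<subseteq> U1" "V m - A \<subseteq> U2" "U1 \<inter> U2 = {}"
      using separation_normal[OF cl[of n]] by metis
    have clU: "closure U2 \<inter> U1 = {}" using U open_Int_closure_eq_empty[of U1 U2] by auto
    define D where "D = connected_component_set (L \<inter> closure U2) q"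
    have qU: "q \<in> L \<inter> U2" using q m A U(4) by auto
    have "\<not> L \<subseteq> U2" using False U by auto
    then have "D \<inter> frontier U2 \<noteq> {}" unfolding D_def
      using component_meets_frontier[OF _ _ U(2) qU] L by (auto simp: bad_def)
    then obtain r where r: "r \<in> D" "r \<in> frontier U2" by auto
    have Dsub: "D \<subseteq> L \<inter> closure U2" unfolding D_def by (rule connected_component_subset)
    have qD: "q \<in> D" unfolding D_def using qU closure_subset by auto
    \<comment> \<open>V m consists of V n and V m - A, which lie in the disjoint open sets U1 and
      U2. A frontier point of U2 is in neither of these.\<close>
    have "r \<notin> V m"
    proof
      assume "r \<in> V m"
      moreover have "r \<notin> U2" using r(2) U(2) by (auto simp: frontier_def interior_open)
      ultimately have "r \<in> V n" using A U(4) by auto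
      then show False using U(3) clU r Dsub by auto
    qed
    \<comment> \<open>Otherwise D \<inter> V m would be clopen in the connected set D, although it
      contains q and not r.\<close>
    have "\<not> D \<subseteq> V l" for l
    proof
      assume "D \<subseteq> V l"
      then have Dl: "D \<subseteq> V (max l m)" using mono[of l "max l m"] by auto
      have "openin (top_of_set (V (max l m))) (V m)" by (rule op) simp
      then obtain B where B: "open B" "V m = V (max l m) \<inter> B" by (auto simp: openin_open)
      have "D \<inter> V m = D \<inter> B" using B(2) Dl by auto
      then have "openin (top_of_set D) (D \<inter> V m)" using B(1) by (metis openin_open_Int)
      moreover have "closedin (top_of_set D) (D \<inter> V m)" using cl by (simp add: closedin_closed_Int)
      moreover have "connected D" by (simp add: D_def)
      ultimately have "D \<inter> V m = {} \<or> D \<inter> V m = D" by (meson connected_clopen)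
      then show False using qD m(1) r(1) \<open>r \<notin> V m\<close> by auto
    qed
    moreover have "compact D"
    proof (rule compact_components)
      show "compact (L \<inter> closure U2)" using L by (intro compact_Int_closed) (auto simp: bad_def)
      show "D \<in> components (L \<inter> closure U2)"
        using qU closure_subset by (auto simp: components_def D_def)
    qed
    moreover have "connected D" by (simp add: D_def)
    moreover have "D \<noteq> {}" using qD by blast
    ultimately have "bad D" using Dsub L unfolding bad_def by blast
    moreover have "D \<inter> V n = {}" using Dsub U(3) clU by auto
    ultimately show ?thesis using Dsub by auto
  qed (use that in blast)
  have "bad K" using K no by (auto simp: bad_def)
  \<comment> \<open>Avoiding V 0, V 1, ... in turn gives nested compact sets, whose common point
    belongs to no V n.\<close>
  have "\<exists>f. \<forall>n. (bad (f n) \<and> (n > 0 \<longrightarrow> f n \<inter> V (n - 1) = {})) \<and> f (Suc n) \<subseteq> f n"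
  proof (rule dependent_nat_choice)
    show "\<exists>x. bad x \<and> (0 < (0::nat) \<longrightarrow> x \<inter> V (0 - 1) = {})" using \<open>bad K\<close> by auto
    show "\<exists>y. (bad y \<and> (0 < Suc n \<longrightarrow> y \<inter> V (Suc n - 1) = {})) \<and> y \<subseteq> x"
      if "bad x \<and> (0 < n \<longrightarrow> x \<inter> V (n - 1) = {})" for x n
      using step[of x n] that by auto
  qed
  then obtain f where f: "\<And>n. bad (f n)" "\<And>n. f (Suc n) \<inter> V n = {}" "\<And>n. f (Suc n) \<subseteq> f n"
    by (metis diff_Suc_1 zero_less_Suc)
  have "(\<Inter>n. f n) \<noteq> {}"
  proof (rule compact_nest)
    show "f n \<subseteq> f m" if "m \<le> n" for m n
      by (rule lift_Suc_antimono_le[of f]) (use f(3) that in auto)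
  qed (use f(1) in \<open>auto simp: bad_def\<close>)
  then obtain x where x: "\<And>n. x \<in> f n" by auto
  then have "x \<in> K" using f(1)[of 0] by (auto simp: bad_def)
  then obtain n where "x \<in> V n" using K(4) by auto
  then show False using f(2)[of n] x[of "Suc n"] by auto
qed

section \<open>Points whose forward orbit stays in a ball\<close>

definition staying_set :: "('a \<Rightarrow> 'a) \<Rightarrow> 'a set \<Rightarrow> 'a set" where
  "staying_set F B = {p. \<forall>n. (F ^^ n) p \<in> B}"

lemma staying_set_subset: "staying_set F B \<subseteq> B"
  by (auto simp: staying_set_def dest: spec[of _ 0])

lemma staying_set_image: "F ` staying_set F B \<subseteq> staying_set F B"
proof
  fix q assume "q \<in> F ` staying_set F B"
  then obtain p where p: "q = F p" "\<And>n. (F ^^ n) p \<in> B" by (auto simp: staying_set_def)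
  have "(F ^^ n) q \<in> B" for n
    using p(2)[of "Suc n"] by (simp only: p(1) funpow_Suc_right o_apply)
  then show "q \<in> staying_set F B" by (simp add: staying_set_def)
qed

lemma staying_setI: "p \<in> B \<Longrightarrow> F p \<in> staying_set F B \<Longrightarrow> p \<in> staying_set F B"
  unfolding staying_set_def
proof clarsimp
  fix n assume "p \<in> B" "\<forall>n. (F ^^ n) (F p) \<in> B"
  then show "(F ^^ n) p \<in> B" by (cases n) (auto simp only: funpow_Suc_right o_apply funpow_0)
qed

text \<open>F is continuous on B only. So closedness of the set of points that stay for n steps is
  proved together with continuity of the next iterate on it.\<close>

lemma closed_staying_set:
  fixes F :: "'a::t2_space \<Rightarrow> 'a"
  assumes c: "continuous_on B F" and B: "closed B"
  shows "closed (staying_set F B)"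
proof -
  define En where "En = (\<lambda>n. {p. \<forall>i\<le>n. (F ^^ i) p \<in> B})"
  have "closed (En n) \<and> continuous_on (En n) (F ^^ Suc n)" for n
  proof (induction n)
    case 0
    then show ?case using c B by (simp add: En_def)
  next
    case (Suc n)
    have eq: "En (Suc n) = En n \<inter> (F ^^ Suc n) -` B" by (auto simp: En_def le_Suc_eq)
    have cl: "closed (En (Suc n))" unfolding eq
      using Suc B by (intro continuous_closed_preimage) auto
    have "continuous_on (En (Suc n)) (F \<circ> (F ^^ Suc n))"
      by (rule continuous_on_compose) (use Suc c in \<open>auto simp: eq intro: continuous_on_subset\<close>)
    then show ?case using cl by simp
  qed
  moreover have "staying_set F B = (\<Inter>n. En n)" by (auto simp: staying_set_def En_def)
  ultimately show ?thesis by auto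
qed

lemma jacobian_scale: "jacobian F x (t * p, t * q) = (t * fst (jacobian F x (p, q)), t * snd (jacobian F x (p, q)))"
  by (simp add: jacobian_def algebra_simps)

text \<open>
  Cauchy's estimates bound the differentials at 0 of all iterates of \<open>g\<close>.
\<close>

lemma automorphism_no_expanding_eigenvalue:
  fixes g :: "complex \<times> complex \<Rightarrow> complex \<times> complex"
  assumes \<Omega>: "open \<Omega>" "0 \<in> \<Omega>" "bounded \<Omega>" and g: "holomorphic_map_on g \<Omega>" "g ` \<Omega> \<subseteq> \<Omega>" and g0: "g 0 = 0"
    and ev: "jacobian g 0 (p, q) = (\<zeta> * p, \<zeta> * q)" "(p, q) \<noteq> (0, 0)"
  shows "norm \<zeta> \<le> 1"
proof (rule ccontr)
  assume z: "\<not> norm \<zeta> \<le> 1"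
  obtain r where r: "r > 0" "ball 0 r \<subseteq> \<Omega>" using \<Omega> open_contains_ball by blast
  obtain B where B: "\<And>x. x \<in> \<Omega> \<Longrightarrow> norm x \<le> B" using \<Omega>(3) bounded_iff by blast
  \<comment> \<open>Small enough for the disc of radius s in the direction (p, q) to lie in the ball
    of radius r.\<close>
  define s where "s = r / (norm (p, q) + 1) / 2"
  have s: "s > 0" using r by (simp add: s_def add_nonneg_pos)
  have inv: "(g ^^ n) x \<in> \<Omega>" if "x \<in> \<Omega>" for n x
    using that g(2) by (induction n) auto
  have hol: "holomorphic_map_on (g ^^ n) \<Omega>" for n
    by (rule holomorphic_map_on_subset[OF iterate_holomorphic[OF \<Omega>(1) g(1), THEN conjunct2]])
       (use inv in \<open>auto simp: iterate_domain_def\<close>)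
  have in\<Omega>: "(t * p, t * q) \<in> \<Omega>" if "norm t \<le> s" for t
  proof -
    have "norm (t * p, t * q) = norm t * norm (p, q)"
      by (simp add: norm_Pair norm_mult power_mult_distrib flip: distrib_left) (simp add: real_sqrt_mult)
    also have "\<dots> \<le> s * norm (p, q)" using that by (intro mult_right_mono) auto
    also have "\<dots> < s * (norm (p, q) + 1) * 2"
    proof -
      have "0 \<le> s * norm (p, q)" using s by simp
      then have "s * norm (p, q) < 2 * s + 2 * (s * norm (p, q))" using s by linarith
      then show ?thesis by (simp add: algebra_simps)
    qed
    also have "\<dots> = r"
    proof -
      define N where "N = norm (p, q) + 1"
      have "N > 0" by (simp add: N_def add_nonneg_pos)
      then show ?thesis unfolding s_def N_def[symmetric] by simp
    qed
    finally show ?thesis using r by auto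
  qed
  have lin: "jacobian g 0 (t * p, t * q) = (\<zeta> * (t * p), \<zeta> * (t * q))" for t
    unfolding jacobian_scale ev(1) by (simp add: mult.left_commute)
  have pow: "((jacobian g 0) ^^ n) (t * p, t * q) = (\<zeta> ^ n * t * p, \<zeta> ^ n * t * q)" for n t
  proof (induction n)
    case (Suc n)
    then show ?case using lin[of "\<zeta> ^ n * t"] by (simp add: mult.assoc)
  qed simp
  have der: "((g ^^ n) has_derivative (jacobian g 0) ^^ n) (at 0)" for n
  proof (induction n)
    case (Suc n)
    have "(g ^^ n) 0 = 0" using g0 by (induction n) auto
    then have "(g has_derivative jacobian g 0) (at ((g ^^ n) 0))"
      using holomorphic_map_has_derivative[OF \<Omega>(1) g(1) \<Omega>(2)] by simp
    from diff_chain_at[OF Suc this] show ?case by (simp add: o_def)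
  qed (simp add: id_def)
  have line: "((\<lambda>t. (t * p, t * q)) has_derivative (\<lambda>t. (t * p, t * q))) (at 0)"
    by (intro derivative_eq_intros refl) auto
  have bound: "norm \<zeta> ^ n * norm p \<le> B / s \<and> norm \<zeta> ^ n * norm q \<le> B / s" for n
  proof -
    have D: "((\<lambda>t. (g ^^ n) (t * p, t * q)) has_derivative (\<lambda>t. (\<zeta> ^ n * t * p, \<zeta> ^ n * t * q))) (at 0)"
    proof -
      have "((g ^^ n) has_derivative (jacobian g 0) ^^ n) (at (0 * p, 0 * q))"
        using der[of n] by (simp add: zero_prod_def)
      from diff_chain_at[OF line this] show ?thesis unfolding o_def pow .
    qed
    have C: "norm c \<le> B / s" if d: "((\<lambda>t. h ((g ^^ n) (t * p, t * q))) has_field_derivative c) (at 0)"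
       and h: "holomorphic2_on (\<lambda>x. h ((g ^^ n) x)) \<Omega>" and hn: "\<And>x. norm (h x) \<le> norm x" for h c
    proof -
      have hol': "(\<lambda>t. h ((g ^^ n) (t * p, t * q))) holomorphic_on A" if "open A" "\<And>t. t \<in> A \<Longrightarrow> (t * p, t * q) \<in> \<Omega>" for A
        by (rule holomorphic2_compose_curve[OF h that(1) _ _ that(2)]) (auto intro!: holomorphic_intros)
      have op: "open {t. (t * p, t * q) \<in> \<Omega>}"
      proof -
        have "open ((\<lambda>t. (t * p, t * q)) -` \<Omega>)" by (intro open_vimage \<Omega>(1) continuous_intros)
        then show ?thesis by (simp add: vimage_def)
      qed
      have "norm ((deriv ^^ 1) (\<lambda>t. h ((g ^^ n) (t * p, t * q))) 0) \<le> fact 1 * B / s ^ 1"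
      proof (rule Cauchy_inequality)
        show "(\<lambda>t. h ((g ^^ n) (t * p, t * q))) holomorphic_on ball 0 s"
          by (rule hol') (use in\<Omega> in auto)
        show "continuous_on (cball 0 s) (\<lambda>t. h ((g ^^ n) (t * p, t * q)))"
          by (rule holomorphic_on_imp_continuous_on[OF holomorphic_on_subset[OF hol'[OF op]]]) (use in\<Omega> in auto)
        show "norm (h ((g ^^ n) (x * p, x * q))) \<le> B" if "norm (0 - x) = s" for x
          using order_trans[OF hn B[OF inv[OF in\<Omega>]]] that by simp
      qed (use s in auto)
      then show ?thesis using d by (simp add: DERIV_imp_deriv)
    qed
    have "norm (\<zeta> ^ n * p) \<le> B / s"
    proof (rule C[of fst])
      have "((\<lambda>t. fst ((g ^^ n) (t * p, t * q))) has_derivative (\<lambda>t. fst (\<zeta> ^ n * t * p, \<zeta> ^ n * t * q))) (at 0)"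
        by (rule has_derivative_fst[OF D])
      then show "((\<lambda>t. fst ((g ^^ n) (t * p, t * q))) has_field_derivative \<zeta> ^ n * p) (at 0)"
        unfolding has_field_derivative_def by (rule has_derivative_eq_rhs) (auto simp: fun_eq_iff)
      show "holomorphic2_on (\<lambda>x. fst ((g ^^ n) x)) \<Omega>" using hol[of n] by (simp add: holomorphic_map_on_def o_def)
      show "norm (fst x) \<le> norm x" for x :: "complex \<times> complex" by (cases x) (simp add: norm_fst_le)
    qed
    moreover have "norm (\<zeta> ^ n * q) \<le> B / s"
    proof (rule C[of snd])
      have "((\<lambda>t. snd ((g ^^ n) (t * p, t * q))) has_derivative (\<lambda>t. snd (\<zeta> ^ n * t * p, \<zeta> ^ n * t * q))) (at 0)"
        by (rule has_derivative_snd[OF D])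
      then show "((\<lambda>t. snd ((g ^^ n) (t * p, t * q))) has_field_derivative \<zeta> ^ n * q) (at 0)"
        unfolding has_field_derivative_def by (rule has_derivative_eq_rhs) (auto simp: fun_eq_iff)
      show "holomorphic2_on (\<lambda>x. snd ((g ^^ n) x)) \<Omega>" using hol[of n] by (simp add: holomorphic_map_on_def o_def)
      show "norm (snd x) \<le> norm x" for x :: "complex \<times> complex" by (cases x) (simp add: norm_snd_le)
    qed
    ultimately show ?thesis by (simp add: norm_mult norm_power)
  qed
  have unb: "x = 0" if "\<And>n. norm \<zeta> ^ n * norm x \<le> B / s" for x :: complex
  proof (rule ccontr)
    assume "x \<noteq> 0"
    obtain n where "B / s / norm x < norm \<zeta> ^ n" using z real_arch_pow[of "norm \<zeta>" "B / s / norm x"] by auto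
    moreover have "norm x > 0" using \<open>x \<noteq> 0\<close> by simp
    ultimately have "B / s < norm \<zeta> ^ n * norm x" by (simp only: pos_divide_less_eq)
    then show False using that[of n] by linarith
  qed
  show False using unb[of p] unb[of q] bound ev(2) by auto
qed

text \<open>
  If the component lies in the open ball, \<open>G\<close> restricts to an automorphism of a component of its
  interior, although the inverse \<open>g\<close> has an expanding eigenvalue at 0. The set \<open>W\<close> puts 0
  into the interior.
\<close>

lemma component_of_staying_set_meets_sphere:
  fixes G :: "complex \<times> complex \<Rightarrow> complex \<times> complex"
  assumes D: "cball 0 r \<subseteq> D" and G: "homeomorphism D D' G g" "open D" "open D'" and r: "r > 0"
    and g: "holomorphic_map_on g D'" and G0: "G 0 = 0"
    and W: "open W" "0 \<in> W" "W \<subseteq> cball 0 r" "G ` W \<subseteq> W"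
    and ev: "jacobian g 0 (p, q) = (\<zeta> * p, \<zeta> * q)" "(p, q) \<noteq> (0, 0)" "norm \<zeta> > 1"
  shows "connected_component_set (staying_set G (cball 0 r)) 0 \<inter> sphere 0 r \<noteq> {}"
proof
  define E where "E = staying_set G (cball 0 r)"
  define K where "K = connected_component_set E 0"
  assume "connected_component_set (staying_set G (cball 0 r)) 0 \<inter> sphere 0 r = {}"
  then have Ks: "K \<inter> sphere 0 r = {}" by (simp add: K_def E_def)
  have Gc: "continuous_on D G" and gc: "continuous_on D' g" and gG: "\<And>x. x \<in> D \<Longrightarrow> g (G x) = x"
    and GD: "G ` D = D'"
    using G(1) by (auto simp: homeomorphism_def)
  have Gcb: "continuous_on (cball 0 r) G" using Gc D continuous_on_subset by blast
  have E: "closed E" "E \<subseteq> cball 0 r"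
    unfolding E_def by (rule closed_staying_set[OF Gcb closed_cball], rule staying_set_subset)
  have KE: "K \<subseteq> E" unfolding K_def by (rule connected_component_subset)
  have "closed K" unfolding K_def by (rule closed_connected_component[OF E(1)])
  then have Kc: "compact K" using bounded_subset[OF bounded_cball order_trans[OF KE E(2)]] by (simp add: compact_eq_bounded_closed)
  have Kconn: "connected K" by (simp add: K_def)
  have Kball: "K \<subseteq> ball 0 r" using Ks KE E(2) by (force simp: less_le)
  have WE: "W \<subseteq> E"
  proof
    fix x assume x: "x \<in> W"
    have "(G ^^ n) x \<in> W" for n using x W(4) by (induction n) auto
    then show "x \<in> E" using W(3) unfolding E_def staying_set_def by blast
  qed
  have K0: "0 \<in> K" using WE W(2) by (auto simp: K_def)
  have Kmax: "S \<subseteq> K" if "connected S" "S \<subseteq> E" "S \<inter> K \<noteq> {}" for S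
  proof -
    have "connected (S \<union> K)" using that Kconn by (intro connected_Un) auto
    then have "S \<union> K \<subseteq> K" unfolding K_def
      using K0 KE that(2) by (intro connected_component_maximal) (auto simp: K_def)
    then show ?thesis by simp
  qed
  have int0: "0 \<in> interior K"
  proof -
    obtain e where e: "e > 0" "ball 0 e \<subseteq> W" using W open_contains_ball by blast
    have "0 \<in> ball 0 e \<inter> K" using e(1) K0 by simp
    then have "ball 0 e \<subseteq> K" using e(2) WE by (intro Kmax connected_ball) blast+
    then show ?thesis using e(1) interior_maximal[OF _ open_ball] by (metis centre_in_ball subsetD)
  qed
  have GK: "G ` K \<subseteq> K"
  proof (rule Kmax)
    show "connected (G ` K)"
      by (rule connected_continuous_image[OF continuous_on_subset[OF Gcb] Kconn]) (use KE E in auto)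
    show "G ` K \<subseteq> E"
      by (rule order_trans[OF image_mono[OF KE]]) (simp only: E_def staying_set_image)
    have "0 \<in> G ` K \<inter> K" using imageI[OF K0, of G] K0 by (simp only: G0 Int_iff)
    then show "G ` K \<inter> K \<noteq> {}" by (intro notI) (simp only: empty_iff)
  qed
  \<comment> \<open>K lies in the open ball, so points near x are in the ball and are sent into K by
    G. Hence they stay forever and belong to the component K.\<close>
  have int_pre: "x \<in> interior K" if x: "x \<in> K" "G x \<in> interior K" for x
  proof -
    have "open (ball 0 r \<inter> G -` interior K)"
      by (rule continuous_open_preimage[OF continuous_on_subset[OF Gcb]]) auto
    moreover have "x \<in> ball 0 r \<inter> G -` interior K" using x Kball by blast
    ultimately obtain e where e: "e > 0" "ball x e \<subseteq> ball 0 r \<inter> G -` interior K"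
      using open_contains_ball by blast
    have "ball x e \<subseteq> E"
    proof
      fix y assume "y \<in> ball x e"
      then have y: "y \<in> ball 0 r" "G y \<in> interior K" using e(2) by blast+
      then have "y \<in> cball 0 r" "G y \<in> E" using interior_subset[of K] KE ball_subset_cball by blast+
      then show "y \<in> E" unfolding E_def by (rule staying_setI)
    qed
    moreover have "x \<in> ball x e \<inter> K" using e(1) x(1) by simp
    ultimately have "ball x e \<subseteq> K" by (intro Kmax connected_ball) blast+
    then show ?thesis using e(1) interior_maximal[OF _ open_ball] by (metis centre_in_ball subsetD)
  qed
  define \<Omega> where "\<Omega> = connected_component_set (interior K) 0"
  have \<Omega>: "open \<Omega>" "connected \<Omega>" "0 \<in> \<Omega>" "\<Omega> \<subseteq> interior K"
    using int0 by (auto simp: \<Omega>_def open_connected_component connected_component_subset[THEN subsetD])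
  have \<Omega>max: "S \<subseteq> \<Omega>" if "connected S" "S \<subseteq> interior K" "S \<inter> \<Omega> \<noteq> {}" for S
  proof -
    have "connected (S \<union> \<Omega>)" using that \<Omega> by (intro connected_Un) auto
    then have "S \<union> \<Omega> \<subseteq> \<Omega>" unfolding \<Omega>_def
      using int0 that(2) \<Omega>(4) by (intro connected_component_maximal) (auto simp: \<Omega>_def)
    then show ?thesis by simp
  qed
  have \<Omega>D: "\<Omega> \<subseteq> D" using \<Omega>(4) interior_subset[of K] KE E(2) D by blast
  have op: "open (G ` \<Omega>)"
    using homeomorphism_imp_open_map[OF G(1), of \<Omega>] \<Omega>(1) \<Omega>D G(2,3)
    by (metis open_openin_trans openin_open_trans open_subset)
  have G\<Omega>: "G ` \<Omega> \<subseteq> \<Omega>"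
  proof (rule \<Omega>max)
    show "connected (G ` \<Omega>)" using \<Omega>(2) \<Omega>D Gc by (meson connected_continuous_image continuous_on_subset)
    show "G ` \<Omega> \<subseteq> interior K"
      by (rule interior_maximal[OF _ op]) (use \<Omega>(4) interior_subset[of K] GK in blast)
    have "0 \<in> G ` \<Omega> \<inter> \<Omega>" using imageI[OF \<Omega>(3), of G] \<Omega>(3) by (simp only: G0 Int_iff)
    then show "G ` \<Omega> \<inter> \<Omega> \<noteq> {}" by (intro notI) (simp only: empty_iff)
  qed
  \<comment> \<open>A point of the closure of \<Omega> that G sends into \<Omega> is interior to K
    by \<open>int_pre\<close>, hence already in \<Omega>. So within \<Omega> the image of \<Omega>
    agrees with the compact image of its closure; being clopen in \<Omega>, it is all of
    \<Omega>.\<close>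
  have "closedin (top_of_set \<Omega>) (G ` \<Omega>)"
  proof -
    have clK: "closure \<Omega> \<subseteq> K" using \<Omega>(4) interior_subset[of K] \<open>closed K\<close> by (meson closure_minimal subset_trans)
    have "compact (closure \<Omega>)" using clK Kc by (metis closed_closure compact_Int_closed inf.absorb_iff2)
    then have "compact (G ` closure \<Omega>)"
      by (rule compact_continuous_image[rotated]) (use clK KE E(2) Gcb continuous_on_subset in blast)
    then have "closed (G ` closure \<Omega>)" by (rule compact_imp_closed)
    moreover have "G ` \<Omega> = \<Omega> \<inter> G ` closure \<Omega>"
    proof
      show "G ` \<Omega> \<subseteq> \<Omega> \<inter> G ` closure \<Omega>" using G\<Omega> closure_subset by blast
      show "\<Omega> \<inter> G ` closure \<Omega> \<subseteq> G ` \<Omega>"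
      proof
        fix y assume "y \<in> \<Omega> \<inter> G ` closure \<Omega>"
        then obtain x where x: "x \<in> closure \<Omega>" "y = G x" "y \<in> \<Omega>" by auto
        have "x \<in> interior K" using int_pre[of x] x clK \<Omega>(4) by auto
        then obtain e where e: "e > 0" "ball x e \<subseteq> interior K" using open_contains_ball open_interior by blast
        have "ball x e \<inter> \<Omega> \<noteq> {}"
        proof -
          obtain y where "y \<in> \<Omega>" "dist y x < e" using x(1) e(1) unfolding closure_approachable by blast
          then have "y \<in> ball x e \<inter> \<Omega>" by (simp add: dist_commute)
          then show ?thesis by blast
        qed
        then have "ball x e \<subseteq> \<Omega>" using e(2) by (intro \<Omega>max connected_ball) blast+
        moreover have "x \<in> ball x e" using e(1) by simp
        ultimately show "y \<in> G ` \<Omega>" unfolding x(2) by blast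
      qed
    qed
    ultimately show ?thesis by (metis closedin_closed_Int)
  qed
  moreover have "openin (top_of_set \<Omega>) (G ` \<Omega>)" using op G\<Omega> by (rule open_subset[rotated])
  moreover have "G ` \<Omega> \<noteq> {}" using \<Omega>(3) by auto
  ultimately have eq: "G ` \<Omega> = \<Omega>" using \<Omega>(2) connected_clopen by blast
  have "norm \<zeta> \<le> 1"
  proof (rule automorphism_no_expanding_eigenvalue[OF \<Omega>(1,3) _ _ _ _ ev(1,2)])
    show "bounded \<Omega>" using \<Omega>(4) interior_subset[of K] Kc by (meson bounded_subset compact_imp_bounded)
    show "holomorphic_map_on g \<Omega>"
      by (rule holomorphic_map_on_subset[OF g]) (use eq \<Omega>D GD in blast)
    show "g ` \<Omega> \<subseteq> \<Omega>"
    proof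
      fix x assume "x \<in> g ` \<Omega>"
      then obtain y where "y \<in> \<Omega>" "x = g (G y)" using eq by (metis imageE)
      moreover from this have "y \<in> D" using \<Omega>D by blast
      ultimately show "x \<in> \<Omega>" using gG[of y] by simp
    qed
    have "0 \<in> D" using r by (intro subsetD[OF D]) simp
    then show "g 0 = 0" using gG[of 0] G0 by simp
  qed
  with ev(3) show False by simp
qed

text \<open>
  The linear form \<open>l2\<close> of the proof is a left eigenvector for \<open>\<beta>\<close>; with \<open>l1\<close> as a second coordinate the
  differential is triangular, and \<open>W\<close> is a bidisc that is long in one direction.
\<close>

lemma attracting_neighbourhood:
  fixes G :: "complex \<times> complex \<Rightarrow> complex \<times> complex"
  assumes G0: "G 0 = 0" and der: "(G has_derivative (\<lambda>(h, k). (a * h + b * k, c * h + d * k))) (at 0)"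
    and ev: "\<And>\<zeta>. (\<zeta> - a) * (\<zeta> - d) - b * c = (\<zeta> - \<alpha>) * (\<zeta> - \<beta>)" "norm \<alpha> < 1" "norm \<beta> < 1" and r: "r > 0"
  obtains W where "open W" "0 \<in> W" "W \<subseteq> cball 0 r" "G ` W \<subseteq> W"
proof -
  \<comment> \<open>The trace will identify the other diagonal entry of the triangular form as
    \<alpha>.\<close>
  have tr: "a + d = \<alpha> + \<beta>"
    using ev(1)[of 0] ev(1)[of 1] by (simp add: algebra_simps)
  obtain p q where pq: "(p, q) \<noteq> (0, 0)" "a * p + c * q = \<beta> * p" "b * p + d * q = \<beta> * q"
    using det2_zero_imp_kernel[of \<beta> a d c b] ev(1)[of \<beta>] by (auto simp: mult.commute)
  define N where "N = cnj p * p + cnj q * q"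
  have Nr: "N = of_real ((norm p)\<^sup>2 + (norm q)\<^sup>2)" by (simp add: N_def mult.commute[of "cnj _"] flip: complex_norm_square)
  have N: "N \<noteq> 0" using pq(1) unfolding Nr of_real_eq_0_iff by (auto simp: sum_power2_eq_zero_iff)
  \<comment> \<open>With conjugate coefficients in l1, the pair (l1, l2) has determinant -N with N =
    |p|^2 + |q|^2, so it is a coordinate system.\<close>
  define l1 l2 where "l1 = (\<lambda>(x, y). cnj p * y - cnj q * x)" and "l2 = (\<lambda>(x, y). p * x + q * y)"
  define \<kappa> where "\<kappa> = ((cnj p * c - cnj q * a) * cnj p + (cnj p * d - cnj q * b) * cnj q) / N"
  have \<kappa>N: "N * \<kappa> = (cnj p * c - cnj q * a) * cnj p + (cnj p * d - cnj q * b) * cnj q"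
    using N by (simp add: \<kappa>_def)
  define L where "L = (\<lambda>(h, k). (a * h + b * k, c * h + d * k))"
  have x: "N * fst v = cnj p * l2 v - q * l1 v" and y: "N * snd v = cnj q * l2 v + p * l1 v" for v
    by (cases v; simp add: N_def l1_def l2_def algebra_simps)+
  have l2L: "l2 (L v) = \<beta> * l2 v" for v
  proof -
    have "l2 (L v) = (a * p + c * q) * fst v + (b * p + d * q) * snd v"
      by (cases v) (simp add: l2_def L_def algebra_simps)
    also have "\<dots> = \<beta> * l2 v" unfolding pq by (cases v) (simp add: l2_def algebra_simps)
    finally show ?thesis .
  qed
  have l1L: "l1 (L v) = \<alpha> * l1 v + \<kappa> * l2 v" for v
  proof -
    have "N * l1 (L v) = (cnj p * c - cnj q * a) * (N * fst v) + (cnj p * d - cnj q * b) * (N * snd v)"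
      by (cases v) (simp add: l1_def L_def algebra_simps)
    also have "\<dots> = l1 v * (cnj q * q * a - cnj p * (c * q) - cnj q * (b * p) + cnj p * p * d) + N * \<kappa> * l2 v"
      unfolding x y \<kappa>N by (simp add: algebra_simps)
    also have "c * q = (\<beta> - a) * p" using pq(2) by (simp add: algebra_simps)
    also have "b * p = (\<beta> - d) * q" using pq(3) by (simp add: algebra_simps)
    also have "l1 v * (cnj q * q * a - cnj p * ((\<beta> - a) * p) - cnj q * ((\<beta> - d) * q) + cnj p * p * d) + N * \<kappa> * l2 v
      = N * ((a + d - \<beta>) * l1 v + \<kappa> * l2 v)" by (simp add: N_def algebra_simps)
    finally show ?thesis using N tr by simp
  qed
  have blin: "bounded_linear l1" "bounded_linear l2"
    unfolding l1_def l2_def split_def by (intro bounded_linear_intros)+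
  obtain K where K: "K > 0" "\<And>v. norm (l1 v) \<le> norm v * K" "\<And>v. norm (l2 v) \<le> norm v * K"
  proof -
    obtain K1 K2 where "K1 > 0" "\<And>v. norm (l1 v) \<le> norm v * K1" "K2 > 0" "\<And>v. norm (l2 v) \<le> norm v * K2"
      using bounded_linear.pos_bounded[OF blin(1)] bounded_linear.pos_bounded[OF blin(2)] by blast
    then have "norm (l1 v) \<le> norm v * max K1 K2" "norm (l2 v) \<le> norm v * max K1 K2" for v
      by (meson max.cobounded1 max.cobounded2 mult_left_mono norm_ge_zero order_trans)+
    then show ?thesis using that[of "max K1 K2"] \<open>K1 > 0\<close> by auto
  qed
  define J where "J = 2 * (norm p + norm q) / norm N + 1"
  have J: "J > 0" by (simp add: J_def add_nonneg_pos)
  have vJ: "norm v \<le> J * (norm (l1 v) + norm (l2 v))" for v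
  proof -
    define m where "m = norm (l1 v) + norm (l2 v)"
    have m: "m \<ge> 0" "norm (l1 v) \<le> m" "norm (l2 v) \<le> m" by (auto simp: m_def)
    have A: "norm N * norm (fst v) \<le> (norm p + norm q) * m"
      unfolding norm_mult[symmetric] x distrib_right
      using m by (intro order_trans[OF norm_triangle_ineq4] add_mono) (auto simp: norm_mult mult_left_mono)
    have B: "norm N * norm (snd v) \<le> (norm p + norm q) * m"
      unfolding norm_mult[symmetric] y distrib_right
      using m by (subst add.commute[of "norm p * m"], intro order_trans[OF norm_triangle_ineq] add_mono) (auto simp: norm_mult mult_left_mono)
    have "norm v \<le> norm (fst v) + norm (snd v)" by (cases v) (simp add: norm_Pair_le)
    also have "\<dots> \<le> 2 * ((norm p + norm q) * m / norm N)"
      using A B N by (simp add: field_simps)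
    also have "\<dots> \<le> J * m" using m(1) by (simp add: J_def algebra_simps)
    finally show ?thesis by (simp add: m_def)
  qed
  \<comment> \<open>W will be given by |l1| < s and |l2| < t s. In the first coordinate the
    off-diagonal term, by the choice of t, and the remainder add at most e s each, and |\<alpha>| +
    2 e < 1.\<close>
  define e where "e = (1 - norm \<alpha>) / 4"
  define t where "t = min 1 (e / (norm \<kappa> + 1))"
  have e: "e > 0" "e \<le> (1 - norm \<alpha>) / 4" using ev(2) by (simp_all add: e_def)
  have t: "t > 0" "t \<le> 1" "norm \<kappa> * t \<le> e"
  proof -
    show "t > 0" "t \<le> 1" using e by (auto simp: t_def add_nonneg_pos)
    have "t \<le> e / (norm \<kappa> + 1)" by (simp add: t_def)
    then have "t * (norm \<kappa> + 1) \<le> e" by (simp add: pos_le_divide_eq add_nonneg_pos)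
    then show "norm \<kappa> * t \<le> e" using \<open>t > 0\<close> by (simp add: algebra_simps)
  qed
  \<comment> \<open>On W one has |v| \<le> 2 J s, so the remainder changes l1 and l2 by at most
    \<eta> (2 J K) s. The minimum serves the two coordinates at once.\<close>
  define \<eta> where "\<eta> = min e (t * (1 - norm \<beta>) / 2) / (2 * J * K)"
  have \<eta>: "\<eta> > 0" using e t ev J K by (simp add: \<eta>_def)
  have \<eta>': "\<eta> * (2 * J * K) \<le> e" "\<eta> * (2 * J * K) \<le> t * (1 - norm \<beta>) / 2"
    using J K by (simp_all add: \<eta>_def)
  have "\<exists>\<delta>>0. \<forall>v. norm (v - 0) < \<delta> \<longrightarrow> norm (G v - G 0 - L (v - 0)) \<le> \<eta> * norm (v - 0)"
    using der \<eta> unfolding has_derivative_at_alt L_def by blast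
  then obtain \<delta> where \<delta>: "\<delta> > 0" "\<And>v. norm v < \<delta> \<Longrightarrow> norm (G v - L v) \<le> \<eta> * norm v"
    using G0 by auto
  define s where "s = min \<delta> r / (4 * J)"
  have s: "s > 0" using \<delta> r J by (simp add: s_def)
  define W where "W = {v. norm (l1 v) < s \<and> norm (l2 v) < t * s}"
  have Wn: "norm v < \<delta> \<and> norm v \<le> r \<and> norm v \<le> 2 * J * s" if "v \<in> W" for v
  proof -
    have "t * s \<le> s" using t s by simp
    then have "norm (l1 v) + norm (l2 v) \<le> 2 * s" using that unfolding W_def mem_Collect_eq by linarith
    then have "J * (norm (l1 v) + norm (l2 v)) \<le> J * (2 * s)" using J by (intro mult_left_mono) auto
    then have *: "norm v \<le> 2 * J * s" using vJ[of v] by linarith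
    also have "2 * J * s = min \<delta> r / 2" using J by (simp add: s_def)
    finally show ?thesis using * \<delta>(1) r by (auto simp: min_def split: if_splits)
  qed
  have GW: "G v \<in> W" if v: "v \<in> W" for v
  proof -
    define h where "h = G v - L v"
    have hn: "norm h \<le> \<eta> * (2 * J * s)"
      using \<delta>(2)[of v] Wn[OF v] mult_left_mono[of "norm v" "2 * J * s" \<eta>] \<eta> unfolding h_def by linarith
    then have hK: "norm h * K \<le> \<eta> * (2 * J * K) * s"
      using mult_right_mono[OF hn, of K] K by (simp add: algebra_simps)
    have Gv: "G v = L v + h" by (simp add: h_def)
    have v1: "norm (l1 v) < s" and v2: "norm (l2 v) < t * s" using v by (auto simp: W_def)
    have es: "norm \<kappa> * (t * s) \<le> e * s" using mult_right_mono[OF t(3), of s] s by (simp add: mult.assoc)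
    have "l1 (G v) = \<alpha> * l1 v + \<kappa> * l2 v + l1 h"
      unfolding Gv bounded_linear.linear[OF blin(1), THEN linear_add] l1L by simp
    then have "norm (l1 (G v)) \<le> norm \<alpha> * norm (l1 v) + norm \<kappa> * norm (l2 v) + norm (l1 h)"
      using norm_triangle_ineq[of "\<alpha> * l1 v + \<kappa> * l2 v" "l1 h"] norm_triangle_ineq[of "\<alpha> * l1 v" "\<kappa> * l2 v"]
      by (simp add: norm_mult)
    also have "norm \<alpha> * norm (l1 v) \<le> norm \<alpha> * s" using v1 by (intro mult_left_mono) auto
    also have "norm \<kappa> * norm (l2 v) \<le> e * s" using v2 es mult_left_mono[of "norm (l2 v)" "t * s" "norm \<kappa>"] by simp
    also have "norm (l1 h) \<le> e * s"
      using K(2)[of h] hK mult_right_mono[OF \<eta>'(1), of s] s by linarith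
    finally have "norm (l1 (G v)) \<le> (norm \<alpha> + 2 * e) * s" by (simp add: algebra_simps)
    also have "\<dots> < 1 * s" using e ev(2) s by (intro mult_strict_right_mono) auto
    finally have 1: "norm (l1 (G v)) < s" by simp
    have "l2 (G v) = \<beta> * l2 v + l2 h"
      unfolding Gv bounded_linear.linear[OF blin(2), THEN linear_add] l2L by simp
    then have "norm (l2 (G v)) \<le> norm \<beta> * norm (l2 v) + norm (l2 h)"
      using norm_triangle_ineq[of "\<beta> * l2 v" "l2 h"] by (simp add: norm_mult)
    also have "norm \<beta> * norm (l2 v) \<le> norm \<beta> * (t * s)" using v2 by (intro mult_left_mono) auto
    also have "norm (l2 h) \<le> t * (1 - norm \<beta>) / 2 * s"
      using K(3)[of h] hK mult_right_mono[OF \<eta>'(2), of s] s by linarith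
    finally have "norm (l2 (G v)) \<le> t * s * ((1 + norm \<beta>) / 2)" by (simp add: field_simps)
    also have "\<dots> < t * s * 1" using ev(3) t s by (intro mult_strict_left_mono) auto
    finally show ?thesis using 1 by (simp add: W_def)
  qed
  have oW: "open W"
  proof -
    have "open {v. norm (l1 v) < s}" "open {v. norm (l2 v) < t * s}"
      by (intro open_Collect_less continuous_intros bounded_linear.continuous_on[OF blin(1)] bounded_linear.continuous_on[OF blin(2)])+
    then show ?thesis unfolding W_def by (simp add: Collect_conj_eq open_Int)
  qed
  have zW: "0 \<in> W" using s t by (simp add: W_def l1_def l2_def zero_prod_def)
  show ?thesis
  proof (rule that[OF oW zW])
    show "W \<subseteq> cball 0 r"
    proof
      fix v assume "v \<in> W"
      from Wn[OF this] show "v \<in> cball 0 r" by (simp only: mem_cball_0)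
    qed
    show "G ` W \<subseteq> W" using GW by (rule image_subsetI)
  qed
qed

lemma holomorphic_map_on_scale: "holomorphic_map_on (\<lambda>p. c *\<^sub>R p) U"
proof (rule holomorphic_map_onI)
  fix p
  have "((\<lambda>p. c *\<^sub>R p) has_derivative (\<lambda>(h, k). (of_real c * h + 0 * k, 0 * h + of_real c * k))) (at p)"
    by (rule has_derivative_eq_rhs[OF bounded_linear_imp_has_derivative[OF bounded_linear_scaleR_right]])
       (auto simp: fun_eq_iff scaleR_conv_of_real)
  then show "\<exists>a' b c' d. ((\<lambda>p. c *\<^sub>R p) has_derivative (\<lambda>(h, k). (a' * h + b * k, c' * h + d * k))) (at p)" by blast
qed

lemma inverse_jacobian:
  assumes F: "biholomorphism F U V" and p: "p \<in> U"
  shows "jacobian (inv_into U F) (F p) (jacobian F p v) = v"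
proof -
  have U: "open U" "open V" and bij: "bij_betw F U V" and hF: "holomorphic_map_on F U" and hi: "holomorphic_map_on (inv_into U F) V"
    using F by (auto simp: biholomorphism_def)
  have Fp: "F p \<in> V" using bij p by (auto simp: bij_betw_def)
  have "((inv_into U F \<circ> F) has_derivative (jacobian (inv_into U F) (F p) \<circ> jacobian F p)) (at p)"
    by (rule diff_chain_at[OF holomorphic_map_has_derivative[OF U(1) hF p] holomorphic_map_has_derivative[OF U(2) hi Fp]])
  moreover have "((inv_into U F \<circ> F) has_derivative (\<lambda>v. v)) (at p)"
  proof (rule has_derivative_transform_within_open[OF has_derivative_ident U(1) p])
    show "x = (inv_into U F \<circ> F) x" if "x \<in> U" for x
      using bij that by (auto simp: bij_betw_def)
  qed
  ultimately have "jacobian (inv_into U F) (F p) \<circ> jacobian F p = (\<lambda>v. v)" by (rule has_derivative_unique)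
  then show ?thesis by (metis o_apply)
qed

text \<open>Scaling by s moves both eigenvalues into the open unit disc, so 0 has an attracting
  neighbourhood, while the inverse of the scaled map has the eigenvalue 1/(s \<alpha>) of modulus
  greater than 1.\<close>

lemma scaled_component_meets_sphere:
  assumes F: "local_diffeo F U V" and r: "r > 0" "cball 0 r \<subseteq> U"
    and chi: "\<And>\<zeta>. charpoly2 F 0 \<zeta> = (\<zeta> - \<alpha>) * (\<zeta> - \<beta>)" and ab: "norm \<alpha> = 1" "norm \<beta> = 1"
    and s: "0 < s" "s < 1"
  shows "connected_component_set (staying_set (\<lambda>p. s *\<^sub>R F p) (cball 0 r)) 0 \<inter> sphere 0 r \<noteq> {}"
proof -
  have bih: "biholomorphism F U V" and z: "0 \<in> U" "0 \<in> V" "F 0 = 0" using F by (auto simp: local_diffeo_def)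
  have U: "open U" "open V" and bij: "bij_betw F U V" and hF: "holomorphic_map_on F U" and hi: "holomorphic_map_on (inv_into U F) V"
    using bih by (auto simp: biholomorphism_def)
  have inj: "inj_on F U" "F ` U = V" using bij by (auto simp: bij_betw_def)
  define G where "G = (\<lambda>p. s *\<^sub>R F p)"
  define V' where "V' = (\<lambda>p. s *\<^sub>R p) ` V"
  define g where "g = inv_into U F \<circ> (\<lambda>y. (1 / s) *\<^sub>R y)"
  have V'_iff: "(1 / s) *\<^sub>R y \<in> V" if "y \<in> V'" for y using that s by (auto simp: V'_def)
  have hg: "holomorphic_map_on g V'" unfolding g_def
    by (rule holomorphic_map_on_compose[OF hi holomorphic_map_on_scale V'_iff])
  have G: "homeomorphism U V' G g"
  proof (rule homeomorphismI)
    show "continuous_on U G" unfolding G_def using holomorphic_map_on_imp_continuous_on[OF hF] by (intro continuous_intros)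
    show "continuous_on V' g" by (rule holomorphic_map_on_imp_continuous_on[OF hg])
    show "G ` U \<subseteq> V'" using inj(2) by (auto simp: G_def V'_def)
    show "g ` V' \<subseteq> U" using V'_iff inj(2) by (auto simp: g_def inv_into_into)
    show "g (G x) = x" if "x \<in> U" for x using that s inj(1) by (simp add: g_def G_def)
    show "G (g y) = y" if "y \<in> V'" for y using V'_iff[OF that] s inj(2) by (simp add: g_def G_def f_inv_into_f)
  qed
  have oV': "open V'" unfolding V'_def using U(2) s by (intro open_scaling) auto
  have G0: "G 0 = 0" using z by (simp add: G_def)
  obtain p q where pq: "(p, q) \<noteq> (0, 0)" "partial1 (fst \<circ> F) 0 * p + partial2 (fst \<circ> F) 0 * q = \<alpha> * p"
      "partial1 (snd \<circ> F) 0 * p + partial2 (snd \<circ> F) 0 * q = \<alpha> * q"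
    using det2_zero_imp_kernel[of \<alpha> "partial1 (fst \<circ> F) 0" "partial2 (snd \<circ> F) 0" "partial2 (fst \<circ> F) 0" "partial1 (snd \<circ> F) 0"]
      chi[of \<alpha>] by (auto simp: charpoly2_def)
  then have jF: "jacobian F 0 (p, q) = (\<alpha> * p, \<alpha> * q)" by (simp add: jacobian_def)
  have \<alpha>0: "\<alpha> \<noteq> 0" using ab by auto
  have "(\<alpha> * fst (jacobian (inv_into U F) 0 (p, q)), \<alpha> * snd (jacobian (inv_into U F) 0 (p, q))) = (p, q)"
    using inverse_jacobian[OF bih z(1), of "(p, q)"] unfolding jF z(3) jacobian_scale .
  then have jI: "jacobian (inv_into U F) 0 (p, q) = (p / \<alpha>, q / \<alpha>)"
    using \<alpha>0 by (auto simp: prod_eq_iff field_simps)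
  define \<zeta> where "\<zeta> = of_real (1 / s) / \<alpha>"
  have z': "0 \<in> V'" using z(2) by (force simp: V'_def)
  have "(g has_derivative (jacobian (inv_into U F) 0 \<circ> (\<lambda>y. (1 / s) *\<^sub>R y))) (at 0)"
    unfolding g_def
    by (rule diff_chain_at[OF bounded_linear_imp_has_derivative[OF bounded_linear_scaleR_right]])
       (use holomorphic_map_has_derivative[OF U(2) hi z(2)] in simp)
  then have "jacobian g 0 = jacobian (inv_into U F) 0 \<circ> (\<lambda>y. (1 / s) *\<^sub>R y)"
    by (rule has_derivative_unique[OF holomorphic_map_has_derivative[OF oV' hg z']])
  then have jg: "jacobian g 0 (p, q) = (\<zeta> * p, \<zeta> * q)"
    using jI jacobian_scale[of "inv_into U F" 0 "of_real (1 / s)" p q]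
    by (simp add: scaleR_conv_of_real \<zeta>_def)
  have \<zeta>: "norm \<zeta> > 1" using ab s by (simp add: \<zeta>_def norm_divide norm_mult)
  define S where "S = complex_of_real s"
  have S: "S \<noteq> 0" using s by (simp add: S_def)
  have dG: "(G has_derivative (\<lambda>(h, k). ((S * partial1 (fst \<circ> F) 0) * h + (S * partial2 (fst \<circ> F) 0) * k,
       (S * partial1 (snd \<circ> F) 0) * h + (S * partial2 (snd \<circ> F) 0) * k))) (at 0)"
      unfolding G_def
      by (rule has_derivative_eq_rhs[OF has_derivative_scaleR_right[OF holomorphic_map_has_derivative[OF U(1) hF z(1)]]])
         (auto simp: fun_eq_iff jacobian_def scaleR_conv_of_real S_def algebra_simps)
  have cG: "(\<zeta> - S * partial1 (fst \<circ> F) 0) * (\<zeta> - S * partial2 (snd \<circ> F) 0) - S * partial2 (fst \<circ> F) 0 * (S * partial1 (snd \<circ> F) 0)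
       = (\<zeta> - S * \<alpha>) * (\<zeta> - S * \<beta>)" for \<zeta>
    proof -
      have eq: "\<zeta> = S * (\<zeta> / S)" using S by simp
      have "(S * (\<zeta> / S) - S * partial1 (fst \<circ> F) 0) * (S * (\<zeta> / S) - S * partial2 (snd \<circ> F) 0) - S * partial2 (fst \<circ> F) 0 * (S * partial1 (snd \<circ> F) 0)
         = S * S * charpoly2 F 0 (\<zeta> / S)" unfolding charpoly2_def by (simp only: algebra_simps)
      also have "\<dots> = (S * (\<zeta> / S) - S * \<alpha>) * (S * (\<zeta> / S) - S * \<beta>)" unfolding chi by (simp only: algebra_simps)
      finally show ?thesis unfolding eq[symmetric] .
    qed
  have nS: "norm (S * \<alpha>) < 1" "norm (S * \<beta>) < 1" using s ab by (auto simp: S_def norm_mult)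
  obtain W where W: "open W" "0 \<in> W" "W \<subseteq> cball 0 r" "G ` W \<subseteq> W"
    by (rule attracting_neighbourhood[OF G0 dG cG nS r(1)]) (rule that)
  show ?thesis
    using component_of_staying_set_meets_sphere[OF r(2) G U(1) oV' r(1) hg G0 W jg pq(1) \<zeta>] unfolding G_def .
qed

text \<open>Let s tend to 1. If the component avoided the sphere, Sura-Bura would give an open set
  \<open>O1\<close> around it, inside the ball, whose frontier contains no staying point. The
  components for s < 1 reach the sphere and thus cross this frontier, and a limit of crossing points
  is a staying point of F.\<close>

theorem component_of_staying_set_meets_sphere_unimodular:
  assumes F: "local_diffeo F U V" and r: "r > 0" "cball 0 r \<subseteq> U"
    and chi: "\<And>\<zeta>. charpoly2 F 0 \<zeta> = (\<zeta> - \<alpha>) * (\<zeta> - \<beta>)" and ab: "norm \<alpha> = 1" "norm \<beta> = 1"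
  shows "connected_component_set (staying_set F (cball 0 r)) 0 \<inter> sphere 0 r \<noteq> {}"
proof
  define E where "E = staying_set F (cball 0 r)"
  define C where "C = connected_component_set E 0"
  assume "connected_component_set (staying_set F (cball 0 r)) 0 \<inter> sphere 0 r = {}"
  then have Cs: "C \<inter> sphere 0 r = {}" by (simp add: C_def E_def)
  have z: "F 0 = 0" and hF: "holomorphic_map_on F U" using F by (auto simp: local_diffeo_def biholomorphism_def)
  have Fc: "continuous_on (cball 0 r) F"
    using holomorphic_map_on_imp_continuous_on[OF hF] r(2) continuous_on_subset by blast
  have E: "closed E" "E \<subseteq> cball 0 r"
    unfolding E_def by (rule closed_staying_set[OF Fc closed_cball], rule staying_set_subset)
  have Ec: "compact E" using bounded_subset[OF bounded_cball E(2)] E(1) by (simp add: compact_eq_bounded_closed)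
  have "(F ^^ n) 0 = 0" for n using z by (induction n) auto
  then have E0: "0 \<in> E" using r(1) by (simp add: E_def staying_set_def)
  then have C: "C \<in> components E" by (auto simp: components_def C_def)
  have CE: "C \<subseteq> E" unfolding C_def by (rule connected_component_subset)
  have Cball: "C \<subseteq> ball 0 r"
  proof
    fix x assume "x \<in> C"
    then have "x \<in> cball 0 r" "x \<notin> sphere 0 r" using CE E(2) Cs by blast+
    then show "x \<in> ball 0 r" by simp
  qed
  obtain K where K: "openin (top_of_set E) K" "compact K" "C \<subseteq> K" "K \<subseteq> ball 0 r"
    using Sura_Bura_clopen_subset[OF closed_imp_locally_compact[OF E(1)] C compact_components[OF Ec C] open_ball Cball] by blast
  obtain A where A: "open A" "K = E \<inter> A" using K(1) by (auto simp: openin_open)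
  have "closed (E - A)" using E(1) A(1) by (intro closed_Diff)
  then have "closed ((E - A) \<union> - ball 0 r)" by (intro closed_Un) auto
  moreover have "K \<inter> ((E - A) \<union> - ball 0 r) = {}" using A(2) K(4) by blast
  ultimately obtain O1 O2 where O: "open O1" "open O2" "K \<subseteq> O1" "(E - A) \<union> - ball 0 r \<subseteq> O2" "O1 \<inter> O2 = {}"
    using separation_normal[OF compact_imp_closed[OF K(2)]] by metis
  have cl: "closure O1 \<inter> O2 = {}" using O by (metis inf_commute open_Int_closure_eq_empty)
  have fr: "frontier O1 \<inter> E = {}"
  proof -
    have "frontier O1 \<inter> O1 = {}" using O(1) by (auto simp: frontier_def interior_open)
    moreover have "frontier O1 \<inter> O2 = {}" using cl by (auto simp: frontier_def)
    ultimately show ?thesis using O(3,4) A(2) by blast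
  qed
  have O1b: "O1 \<subseteq> ball 0 r" using O(4,5) by blast
  have frc: "compact (frontier O1)"
    using bounded_subset[OF bounded_ball O1b] compact_frontier_bounded by blast
  define s where "s = (\<lambda>n. 1 - 1 / real (n + 2))"
  have s: "0 < s n" "s n < 1" for n by (auto simp: s_def field_simps)
  have slim: "s \<longlonglongrightarrow> 1" unfolding s_def by real_asymp
  have "\<exists>p. p \<in> frontier O1 \<and> p \<in> staying_set (\<lambda>p. s n *\<^sub>R F p) (cball 0 r)" for n
  proof -
    define Kn where "Kn = connected_component_set (staying_set (\<lambda>p. s n *\<^sub>R F p) (cball 0 r)) 0"
    obtain x where x: "x \<in> Kn" "x \<in> sphere 0 r"
      using scaled_component_meets_sphere[OF F r chi ab s] unfolding Kn_def by blast
    have "connected_component E 0 0" using E0 by simp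
    then have "0 \<in> O1" using O(3) K(3) unfolding C_def by blast
    moreover have "0 \<in> Kn" using x(1) unfolding Kn_def
      by (metis connected_component_eq_empty connected_component_refl empty_iff mem_Collect_eq)
    moreover have "x \<notin> O1" using x(2) O1b by auto
    ultimately have "Kn \<inter> O1 \<noteq> {}" "Kn - O1 \<noteq> {}" using x(1) by blast+
    moreover have "connected Kn" by (simp add: Kn_def)
    ultimately have "Kn \<inter> frontier O1 \<noteq> {}" by (intro connected_Int_frontier)
    then show ?thesis using connected_component_subset unfolding Kn_def by blast
  qed
  then obtain p where p: "\<And>n. p n \<in> frontier O1" "\<And>n. p n \<in> staying_set (\<lambda>p. s n *\<^sub>R F p) (cball 0 r)"
    by metis
  obtain l \<rho> where l: "l \<in> frontier O1" "strict_mono \<rho>" "(p \<circ> \<rho>) \<longlonglongrightarrow> l"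
    using frc p(1) unfolding compact_def by metis
  have step: "x \<in> cball 0 r" if "(\<lambda>n. ((\<lambda>p. s (\<rho> n) *\<^sub>R F p) ^^ j) (p (\<rho> n))) \<longlonglongrightarrow> x" for x j
  proof (rule closed_sequentially[OF closed_cball _ that])
    show "((\<lambda>p. s (\<rho> n) *\<^sub>R F p) ^^ j) (p (\<rho> n)) \<in> cball 0 r" for n
      using p(2)[of "\<rho> n"] by (simp add: staying_set_def)
  qed
  \<comment> \<open>Membership in the ball and convergence of the iterates are proved together,
    because continuity of F is available on the ball.\<close>
  have "(F ^^ j) l \<in> cball 0 r \<and> (\<lambda>n. ((\<lambda>p. s (\<rho> n) *\<^sub>R F p) ^^ j) (p (\<rho> n))) \<longlonglongrightarrow> (F ^^ j) l" for j
  proof (induction j)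
    case 0
    have "(\<lambda>n. ((\<lambda>p. s (\<rho> n) *\<^sub>R F p) ^^ 0) (p (\<rho> n))) \<longlonglongrightarrow> l" using l(3) by (simp add: o_def)
    with step[OF this] show ?case by simp
  next
    case (Suc j)
    have "(\<lambda>n. F (((\<lambda>p. s (\<rho> n) *\<^sub>R F p) ^^ j) (p (\<rho> n)))) \<longlonglongrightarrow> F ((F ^^ j) l)"
    proof (rule continuous_on_tendsto_compose[OF Fc])
      show "\<forall>\<^sub>F n in sequentially. ((\<lambda>p. s (\<rho> n) *\<^sub>R F p) ^^ j) (p (\<rho> n)) \<in> cball 0 r"
        using p(2) by (simp add: staying_set_def)
    qed (use Suc in auto)
    moreover have "(\<lambda>n. s (\<rho> n)) \<longlonglongrightarrow> 1" using LIMSEQ_subseq_LIMSEQ[OF slim l(2)] by (simp add: o_def)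
    ultimately have "(\<lambda>n. s (\<rho> n) *\<^sub>R F (((\<lambda>p. s (\<rho> n) *\<^sub>R F p) ^^ j) (p (\<rho> n)))) \<longlonglongrightarrow> 1 *\<^sub>R F ((F ^^ j) l)"
      by (intro tendsto_scaleR)
    then have "(\<lambda>n. ((\<lambda>p. s (\<rho> n) *\<^sub>R F p) ^^ Suc j) (p (\<rho> n))) \<longlonglongrightarrow> (F ^^ Suc j) l" by simp
    with step[OF this] show ?case by blast
  qed
  then have "l \<in> E" by (simp add: E_def staying_set_def)
  then show False using l(1) fr by blast
qed

section \<open>Differentials of iterates at fixed points\<close>

lemma jacobian_add: "jacobian F x (v + w) = jacobian F x v + jacobian F x w"
  by (cases v; cases w) (simp add: jacobian_def algebra_simps)

lemma jacobian_0 [simp]: "jacobian F x 0 = 0"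
  by (simp add: jacobian_def zero_prod_def)

lemma charpoly2_eq_0_iff:
  "charpoly2 F x \<zeta> = 0 \<longleftrightarrow> (\<exists>p q. (p, q) \<noteq> (0, 0) \<and> jacobian F x (p, q) = (\<zeta> * p, \<zeta> * q))"
proof
  assume "charpoly2 F x \<zeta> = 0"
  then obtain p q where "(p, q) \<noteq> (0, 0)" "partial1 (fst \<circ> F) x * p + partial2 (fst \<circ> F) x * q = \<zeta> * p"
    "partial1 (snd \<circ> F) x * p + partial2 (snd \<circ> F) x * q = \<zeta> * q"
    unfolding charpoly2_def by (rule det2_zero_imp_kernel)
  then show "\<exists>p q. (p, q) \<noteq> (0, 0) \<and> jacobian F x (p, q) = (\<zeta> * p, \<zeta> * q)"
    unfolding jacobian_def by (intro exI[of _ p] exI[of _ q]) simp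
next
  assume "\<exists>p q. (p, q) \<noteq> (0, 0) \<and> jacobian F x (p, q) = (\<zeta> * p, \<zeta> * q)"
  then obtain p q where "(p, q) \<noteq> (0, 0)" "jacobian F x (p, q) = (\<zeta> * p, \<zeta> * q)" by blast
  then show "charpoly2 F x \<zeta> = 0"
    using det2_annihilates_kernel[of "partial1 (fst \<circ> F) x" p "partial2 (fst \<circ> F) x" q \<zeta> "partial1 (snd \<circ> F) x" "partial2 (snd \<circ> F) x"]
    by (auto simp: charpoly2_def jacobian_def)
qed

text \<open>If a vector of N and its image are dependent, the vector is an eigenvector. Otherwise
  the two span the plane, N is everything, and a root of the characteristic polynomial provides one.
  \<open>D\<close> is the determinant of the two vectors.\<close>

lemma invariant_subspace_eigenvector:
  assumes v: "(p, q) \<in> N" "(p, q) \<noteq> (0, 0)"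
    and add: "\<And>v w. v \<in> N \<Longrightarrow> w \<in> N \<Longrightarrow> v + w \<in> N" and sc: "\<And>t x y. (x, y) \<in> N \<Longrightarrow> (t * x, t * y) \<in> N"
    and inv: "\<And>v. v \<in> N \<Longrightarrow> jacobian F z v \<in> N"
  obtains \<xi> x y where "(x, y) \<in> N" "(x, y) \<noteq> (0, 0)" "jacobian F z (x, y) = (\<xi> * x, \<xi> * y)"
proof -
  obtain p' q' where Lv: "jacobian F z (p, q) = (p', q')" by (cases "jacobian F z (p, q)")
  define D where "D = p * q' - q * p'"
  show ?thesis
  proof (cases "D = 0")
    case True
    show ?thesis
    proof (cases "p = 0")
      case True
      then have "q \<noteq> 0" "p' = 0" using v(2) \<open>D = 0\<close> by (auto simp: D_def)
      then show ?thesis using that[of p q "q' / q"] v Lv True by simp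
    next
      case False
      then have "q' = p' / p * q" using \<open>D = 0\<close> by (simp add: D_def field_simps)
      then show ?thesis using that[of p q "p' / p"] v Lv False by simp
    qed
  next
    case False
    have all: "(x, y) \<in> N" for x y
    proof -
      define s t where "s = (x * q' - y * p') / D" and "t = (p * y - q * x) / D"
      have "D * (s * p + t * p') = D * x" "D * (s * q + t * q') = D * y"
        using False by (simp_all add: s_def t_def D_def[symmetric] distrib_left) (simp_all add: D_def algebra_simps)
      then have "(x, y) = (s * p, s * q) + (t * p', t * q')" using False by simp
      moreover have "(p', q') \<in> N" using inv[OF v(1)] Lv by simp
      ultimately show ?thesis using add sc v(1) by metis
    qed
    obtain \<alpha> \<beta> where "\<And>\<zeta>. charpoly2 F z \<zeta> = (\<zeta> - \<alpha>) * (\<zeta> - \<beta>)" using charpoly2_factor by metis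
    then have "charpoly2 F z \<alpha> = 0" by simp
    then show ?thesis unfolding charpoly2_eq_0_iff using that all by blast
  qed
qed

lemma jacobian_funpow_add: "(jacobian F x ^^ n) (v + w) = (jacobian F x ^^ n) v + (jacobian F x ^^ n) w"
  by (induction n) (simp_all add: jacobian_add)

lemma jacobian_funpow_scale:
  "(jacobian F x ^^ n) (t * p, t * q) = (t * fst ((jacobian F x ^^ n) (p, q)), t * snd ((jacobian F x ^^ n) (p, q)))"
proof (induction n)
  case (Suc n)
  then show ?case
    using jacobian_scale[of F x t "fst ((jacobian F x ^^ n) (p, q))" "snd ((jacobian F x ^^ n) (p, q))"] by simp
qed simp

lemma jacobian_funpow_eigen:
  assumes "jacobian F x (p, q) = (\<xi> * p, \<xi> * q)"
  shows "(jacobian F x ^^ n) (p, q) = (\<xi> ^ n * p, \<xi> ^ n * q)"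
proof (induction n)
  case (Suc n)
  have "jacobian F x (\<xi> ^ n * p, \<xi> ^ n * q) = (\<xi> ^ n * (\<xi> * p), \<xi> ^ n * (\<xi> * q))"
    unfolding jacobian_scale assms by simp
  with Suc show ?case by (simp add: mult_ac)
qed simp

text \<open>The eigenspace of the n-th power is invariant under the differential, so it contains an
  eigenvector of the differential itself.\<close>

lemma eigenvalue_of_jacobian_funpow:
  assumes e: "(jacobian F x ^^ n) (p, q) = (\<zeta> * p, \<zeta> * q)" "(p, q) \<noteq> (0, 0)"
  obtains \<xi> where "charpoly2 F x \<xi> = 0" "\<xi> ^ n = \<zeta>"
proof -
  define N where "N = {v. (jacobian F x ^^ n) v = (\<zeta> * fst v, \<zeta> * snd v)}"
  have "\<exists>\<xi> x' y'. (x', y') \<in> N \<and> (x', y') \<noteq> (0, 0) \<and> jacobian F x (x', y') = (\<xi> * x', \<xi> * y')"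
  proof (rule invariant_subspace_eigenvector[of p q N F x])
    show "(p, q) \<in> N" using e by (simp add: N_def)
    show "v + w \<in> N" if "v \<in> N" "w \<in> N" for v w
      using that by (simp add: N_def jacobian_funpow_add distrib_left)
    show "(t * x', t * y') \<in> N" if "(x', y') \<in> N" for t x' y'
      using that by (simp add: N_def jacobian_funpow_scale mult.left_commute)
    show "jacobian F x v \<in> N" if "v \<in> N" for v
    proof -
      have "(jacobian F x ^^ n) (jacobian F x v) = jacobian F x ((jacobian F x ^^ n) v)"
        by (metis funpow_swap1)
      also have "\<dots> = (\<zeta> * fst (jacobian F x v), \<zeta> * snd (jacobian F x v))"
        using that jacobian_scale[of F x \<zeta> "fst v" "snd v"] by (simp add: N_def)
      finally show ?thesis by (simp add: N_def)
    qed
  qed (use e in blast)+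
  then obtain \<xi> x' y' where v: "(x', y') \<in> N" "(x', y') \<noteq> (0, 0)" "jacobian F x (x', y') = (\<xi> * x', \<xi> * y')" by blast
  then have "(\<xi> ^ n * x', \<xi> ^ n * y') = (\<zeta> * x', \<zeta> * y')" using jacobian_funpow_eigen[OF v(3), of n] by (simp add: N_def)
  then have "\<xi> ^ n = \<zeta>" using v(2) by auto
  moreover have "charpoly2 F x \<xi> = 0" using v charpoly2_eq_0_iff by blast
  ultimately show ?thesis using that by blast
qed

text \<open>The kernel of the sum is invariant. For an eigenvector in it, 1 + \<xi> + ... +
  \<xi>^(n-1) = 0, so \<xi> is a nontrivial n-th root of unity.\<close>

lemma sum_jacobian_funpow_injective:
  assumes good: "\<And>\<xi>. charpoly2 F x \<xi> = 0 \<Longrightarrow> \<xi> ^ n = 1 \<Longrightarrow> \<xi> = 1" and n: "n \<ge> 1"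
    and v: "(\<Sum>i<n. (jacobian F x ^^ i) v) = 0"
  shows "v = 0"
proof (rule ccontr)
  assume nz: "v \<noteq> 0"
  define T where "T = (\<lambda>v. \<Sum>i<n. (jacobian F x ^^ i) v)"
  define N where "N = {v. T v = 0}"
  have "\<exists>\<xi> x' y'. (x', y') \<in> N \<and> (x', y') \<noteq> (0, 0) \<and> jacobian F x (x', y') = (\<xi> * x', \<xi> * y')"
  proof (rule invariant_subspace_eigenvector[of "fst v" "snd v" N F x])
    show "(fst v, snd v) \<in> N" using v by (simp add: N_def T_def)
    show "(fst v, snd v) \<noteq> (0, 0)" using nz by (simp add: zero_prod_def)
    show "v + w \<in> N" if "v \<in> N" "w \<in> N" for v w
      using that by (simp add: N_def T_def jacobian_funpow_add sum.distrib)
    show "(t * x', t * y') \<in> N" if "(x', y') \<in> N" for t x' y'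
    proof -
      have "T (t * x', t * y') = (t * fst (T (x', y')), t * snd (T (x', y')))"
        unfolding T_def jacobian_funpow_scale by (simp add: prod_eq_iff fst_sum snd_sum sum_distrib_left)
      then show ?thesis using that by (simp add: N_def zero_prod_def)
    qed
    show "jacobian F x v \<in> N" if "v \<in> N" for v
    proof -
      have Ls: "jacobian F x (\<Sum>i\<in>A. f i) = (\<Sum>i\<in>A. jacobian F x (f i))" if "finite A" for A :: "nat set" and f
        using that by (induction A) (simp_all add: jacobian_add jacobian_0)
      have "T (jacobian F x v) = jacobian F x (T v)"
        unfolding T_def by (simp add: Ls funpow_swap1)
      also have "\<dots> = 0" using that by (simp add: N_def)
      finally show ?thesis by (simp add: N_def)
    qed
  qed blast
  then obtain \<xi> x' y' where w: "(x', y') \<in> N" "(x', y') \<noteq> (0, 0)" "jacobian F x (x', y') = (\<xi> * x', \<xi> * y')" by blast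
  have "T (x', y') = ((\<Sum>i<n. \<xi> ^ i) * x', (\<Sum>i<n. \<xi> ^ i) * y')"
    unfolding T_def jacobian_funpow_eigen[OF w(3)] by (simp add: prod_eq_iff fst_sum snd_sum sum_distrib_right)
  then have s: "(\<Sum>i<n. \<xi> ^ i) = 0" using w(1,2) by (auto simp: N_def zero_prod_def)
  have "\<xi> ^ n - 1 = (\<xi> - 1) * (\<Sum>i<n. \<xi> ^ i)" by (rule power_diff_1_eq)
  then have "\<xi> ^ n = 1" using s by simp
  moreover have "charpoly2 F x \<xi> = 0" using w charpoly2_eq_0_iff by blast
  ultimately have "\<xi> = 1" using good by blast
  then show False using s n by simp
qed

section \<open>Holomorphic local inverses and isolated fixed points\<close>

lemma bounded_linear_matrix2:
  "bounded_linear (\<lambda>(h, k). (a * h + b * k :: complex, c * h + d * k :: complex))"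
  unfolding split_def by (intro bounded_linear_intros)

lemma matrix2_left_inverse:
  fixes a b c d :: complex
  assumes "a * d - b * c \<noteq> 0"
  shows "(\<lambda>(h, k). (d / (a * d - b * c) * h + (- b / (a * d - b * c)) * k, (- c / (a * d - b * c)) * h + a / (a * d - b * c) * k))
     ((\<lambda>(h, k). (a * h + b * k, c * h + d * k)) v) = v"
proof (cases v)
  case (Pair h k)
  define D where "D = a * d - b * c"
  have D: "D \<noteq> 0" using assms by (simp add: D_def)
  have "d / D * (a * h + b * k) + (- b / D) * (c * h + d * k) = (D * h) / D"
    by (simp add: D_def add_divide_distrib[symmetric] diff_divide_distrib[symmetric] algebra_simps)
  moreover have "(- c / D) * (a * h + b * k) + a / D * (c * h + d * k) = (D * k) / D"
    by (simp add: D_def add_divide_distrib[symmetric] diff_divide_distrib[symmetric] algebra_simps)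
  ultimately show ?thesis using D by (simp add: Pair D_def[symmetric])
qed

lemma jacobian_det_ne_0:
  assumes "\<And>v. jacobian F z v = 0 \<Longrightarrow> v = 0"
  shows "partial1 (fst \<circ> F) z * partial2 (snd \<circ> F) z - partial2 (fst \<circ> F) z * partial1 (snd \<circ> F) z \<noteq> 0"
proof
  assume "partial1 (fst \<circ> F) z * partial2 (snd \<circ> F) z - partial2 (fst \<circ> F) z * partial1 (snd \<circ> F) z = 0"
  then have "charpoly2 F z 0 = 0" by (simp add: charpoly2_def)
  then obtain p q where "(p, q) \<noteq> (0, 0)" "jacobian F z (p, q) = (0 * p, 0 * q)" unfolding charpoly2_eq_0_iff by blast
  then show False using assms[of "(p, q)"] by (auto simp: zero_prod_def)
qed

text \<open>The real inverse function theorem yields g. Its derivative is the inverse of an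
  invertible complex matrix, hence complex linear.\<close>

lemma holomorphic_local_inverse:
  fixes S :: "complex \<times> complex \<Rightarrow> complex \<times> complex"
  assumes D: "open D" "z \<in> D" and S: "holomorphic_map_on S D" and inj: "\<And>v. jacobian S z v = 0 \<Longrightarrow> v = 0"
  obtains U V g where "open U" "U \<subseteq> D" "z \<in> U" "open V" "homeomorphism U V S g" "holomorphic_map_on g V"
proof -
  have ap: "blinfun_apply (Blinfun (jacobian S x)) = jacobian S x" for x
    unfolding jacobian_def by (rule bounded_linear_Blinfun_apply[OF bounded_linear_matrix2])
  define a b c d where "a = partial1 (fst \<circ> S) z" and "b = partial2 (fst \<circ> S) z"
    and "c = partial1 (snd \<circ> S) z" and "d = partial2 (snd \<circ> S) z"
  define I where "I = (\<lambda>(h, k). (d / (a * d - b * c) * h + (- b / (a * d - b * c)) * k, (- c / (a * d - b * c)) * h + a / (a * d - b * c) * k))"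
  have det: "a * d - b * c \<noteq> 0" unfolding a_def b_def c_def d_def by (rule jacobian_det_ne_0[OF inj])
  have apI: "blinfun_apply (Blinfun I) = I"
    unfolding I_def by (rule bounded_linear_Blinfun_apply[OF bounded_linear_matrix2])
  have "I (jacobian S z v) = v" for v
    using matrix2_left_inverse[OF det, of v] by (simp add: I_def jacobian_def a_def b_def c_def d_def)
  then have inv: "Blinfun I o\<^sub>L Blinfun (jacobian S z) = id_blinfun"
    by (intro blinfun_eqI) (simp add: apI ap)
  have cont: "continuous_on D (\<lambda>x. Blinfun (jacobian S x))"
  proof (rule continuous_on_blinfun_componentwise)
    fix i :: "complex \<times> complex"
    have h: "holomorphic2_on (fst \<circ> S) D" "holomorphic2_on (snd \<circ> S) D" using S by (auto simp: holomorphic_map_on_def)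
    show "continuous_on D (\<lambda>x. blinfun_apply (Blinfun (jacobian S x)) i)"
      unfolding ap unfolding jacobian_def split_def
      by (intro continuous_intros holomorphic2_on_imp_continuous_on holomorphic2_partial1 holomorphic2_partial2 D h)
  qed
  obtain U V g g' where U: "open U" "U \<subseteq> D" "z \<in> U" "open V" "S z \<in> V" "homeomorphism U V S g"
    "\<And>y. y \<in> V \<Longrightarrow> (g has_derivative (g' y)) (at y)"
    "\<And>y. y \<in> V \<Longrightarrow> g' y = inv (blinfun_apply (Blinfun (jacobian S (g y))))"
    "\<And>y. y \<in> V \<Longrightarrow> bij (blinfun_apply (Blinfun (jacobian S (g y))))"
  proof (rule inverse_function_theorem[OF D(1) _ cont D(2) inv])
    show "(S has_derivative blinfun_apply (Blinfun (jacobian S x))) (at x)" if "x \<in> D" for x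
      unfolding ap using holomorphic_map_has_derivative[OF D(1) S that] .
  qed (rule that)
  have "holomorphic_map_on g V"
  proof (rule holomorphic_map_onI)
    fix y assume y: "y \<in> V"
    define a b c d where "a = partial1 (fst \<circ> S) (g y)" and "b = partial2 (fst \<circ> S) (g y)"
      and "c = partial1 (snd \<circ> S) (g y)" and "d = partial2 (snd \<circ> S) (g y)"
    define I where "I = (\<lambda>(h, k). (d / (a * d - b * c) * h + (- b / (a * d - b * c)) * k, (- c / (a * d - b * c)) * h + a / (a * d - b * c) * k))"
    have bij: "bij (jacobian S (g y))" using U(9)[OF y] by (simp add: ap)
    have "v = 0" if "jacobian S (g y) v = 0" for v
      using injD[OF bij_is_inj[OF bij], of v 0] that by simp
    then have det: "a * d - b * c \<noteq> 0" unfolding a_def b_def c_def d_def by (rule jacobian_det_ne_0)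
    have left: "I (jacobian S (g y) v) = v" for v
      using matrix2_left_inverse[OF det, of v] by (simp add: I_def jacobian_def a_def b_def c_def d_def)
    have "inv (jacobian S (g y)) = I"
    proof
      fix w
      obtain v where "w = jacobian S (g y) v" using bij by (metis bij_pointE)
      then show "inv (jacobian S (g y)) w = I w" using left bij by (simp add: bij_is_inj)
    qed
    then have "(g has_derivative I) (at y)" using U(7,8)[OF y] by (simp add: ap)
    then show "\<exists>a b c d. (g has_derivative (\<lambda>(h, k). (a * h + b * k, c * h + d * k))) (at y)"
      unfolding I_def by blast
  qed
  then show ?thesis using that U(1-4,6) by blast
qed

lemma holomorphic_map_on_diff_id:
  assumes "open D" "holomorphic_map_on G D"
  shows "holomorphic_map_on (\<lambda>x. G x - x) D"
    and "x \<in> D \<Longrightarrow> jacobian (\<lambda>x. G x - x) x v = jacobian G x v - v"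
proof -
  have der: "((\<lambda>x. G x - x) has_derivative (\<lambda>v. jacobian G x v - v)) (at x)" if "x \<in> D" for x
    using holomorphic_map_has_derivative[OF assms that] by (intro derivative_intros)
  have eq: "(\<lambda>v. jacobian G x v - v) = (\<lambda>(h, k). ((partial1 (fst \<circ> G) x - 1) * h + partial2 (fst \<circ> G) x * k,
     partial1 (snd \<circ> G) x * h + (partial2 (snd \<circ> G) x - 1) * k))" for x
    by (auto simp: fun_eq_iff jacobian_def algebra_simps)
  show h: "holomorphic_map_on (\<lambda>x. G x - x) D"
  proof (rule holomorphic_map_onI)
    fix x assume "x \<in> D"
    from der[OF this] show "\<exists>a b c d. ((\<lambda>x. G x - x) has_derivative (\<lambda>(h, k). (a * h + b * k, c * h + d * k))) (at x)"
      unfolding eq by blast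
  qed
  show "jacobian (\<lambda>x. G x - x) x v = jacobian G x v - v" if "x \<in> D"
    using fun_cong[OF has_derivative_unique[OF holomorphic_map_has_derivative[OF assms(1) h that] der[OF that]], of v] .
qed

text \<open>If 1 is not an eigenvalue, then G - id has an injective differential at z, is locally
  injective there, and z is isolated among its zeros.\<close>

lemma eigenvalue_1_of_nonisolated_fixed_point:
  assumes D: "open D" "z \<in> D" and G: "holomorphic_map_on G D" and lim: "z islimpt {x. G x = x}" and z: "G z = z"
  shows "charpoly2 G z 1 = 0"
proof (rule ccontr)
  assume no: "charpoly2 G z 1 \<noteq> 0"
  have inj: "v = 0" if "jacobian (\<lambda>x. G x - x) z v = 0" for v
  proof (rule ccontr)
    assume "v \<noteq> 0"
    moreover have "jacobian G z (fst v, snd v) = (1 * fst v, 1 * snd v)"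
      using that holomorphic_map_on_diff_id(2)[OF D(1) G D(2)] by simp
    ultimately show False using no charpoly2_eq_0_iff[of G z 1] by (metis prod.collapse zero_prod_def)
  qed
  obtain U V g where U: "open U" "z \<in> U" "homeomorphism U V (\<lambda>x. G x - x) g"
    using holomorphic_local_inverse[OF D holomorphic_map_on_diff_id(1)[OF D(1) G] inj] by metis
  obtain x where x: "G x = x" "x \<in> U" "x \<noteq> z" using lim U(1,2) unfolding islimpt_def by blast
  have "g (G x - x) = x" "g (G z - z) = z" using U(3) x(2) U(2) unfolding homeomorphism_def by blast+
  then show False using x z by simp
qed

section \<open>Eigenvalues along curves of fixed points\<close>

lemma holomorphic2_on_const: "holomorphic2_on (\<lambda>_. c) U"
proof -
  have "((\<lambda>_. c) has_derivative (\<lambda>(h, k). 0 * h + 0 * k)) (at p)" for p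
    by (rule has_derivative_eq_rhs[OF has_derivative_const]) auto
  then show ?thesis unfolding holomorphic2_on_def by blast
qed

lemma holomorphic2_on_fst: "holomorphic2_on fst U" and holomorphic2_on_snd: "holomorphic2_on snd U"
proof -
  have "(fst has_derivative (\<lambda>(h, k). 1 * h + 0 * k)) (at p)" "(snd has_derivative (\<lambda>(h, k). 0 * h + 1 * k)) (at p)"
    for p :: "complex \<times> complex"
    by (rule has_derivative_eq_rhs[OF bounded_linear_imp_has_derivative[OF bounded_linear_fst]]; auto)
       (rule has_derivative_eq_rhs[OF bounded_linear_imp_has_derivative[OF bounded_linear_snd]]; auto)
  then show "holomorphic2_on fst U" "holomorphic2_on snd U" unfolding holomorphic2_on_def by blast+
qed

lemma holomorphic2_on_diff:
  assumes "holomorphic2_on f U" "holomorphic2_on g U" shows "holomorphic2_on (\<lambda>x. f x - g x) U"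
  unfolding holomorphic2_on_def
proof
  fix p assume "p \<in> U"
  with assms obtain a b c d where "(f has_derivative (\<lambda>(h, k). a * h + b * k)) (at p)" "(g has_derivative (\<lambda>(h, k). c * h + d * k)) (at p)"
    unfolding holomorphic2_on_def by blast
  from has_derivative_diff[OF this]
  have "((\<lambda>x. f x - g x) has_derivative (\<lambda>(h, k). (a - c) * h + (b - d) * k)) (at p)"
    by (rule has_derivative_eq_rhs) (auto simp: fun_eq_iff algebra_simps)
  then show "\<exists>a b. ((\<lambda>x. f x - g x) has_derivative (\<lambda>(h, k). a * h + b * k)) (at p)" by blast
qed

lemma holomorphic2_on_mult:
  assumes "holomorphic2_on f U" "holomorphic2_on g U" shows "holomorphic2_on (\<lambda>x. f x * g x) U"
  unfolding holomorphic2_on_def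
proof
  fix p assume "p \<in> U"
  with assms obtain a b c d where "(f has_derivative (\<lambda>(h, k). a * h + b * k)) (at p)" "(g has_derivative (\<lambda>(h, k). c * h + d * k)) (at p)"
    unfolding holomorphic2_on_def by blast
  from has_derivative_mult[OF this]
  have "((\<lambda>x. f x * g x) has_derivative (\<lambda>(h, k). (f p * c + a * g p) * h + (f p * d + b * g p) * k)) (at p)"
    by (rule has_derivative_eq_rhs) (auto simp: fun_eq_iff algebra_simps)
  then show "\<exists>a b. ((\<lambda>x. f x * g x) has_derivative (\<lambda>(h, k). a * h + b * k)) (at p)" by blast
qed

lemma charpoly2_holomorphic2:
  assumes "open D" "holomorphic_map_on G D" shows "holomorphic2_on (\<lambda>x. charpoly2 G x \<zeta>) D"
  unfolding charpoly2_def using assms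
  by (intro holomorphic2_on_diff holomorphic2_on_mult holomorphic2_on_const holomorphic2_partial1 holomorphic2_partial2)
     (auto simp: holomorphic_map_on_def)

lemma charpoly2_root_of_1_and_det:
  assumes "charpoly2 G x 1 = 0" "charpoly2 G x 0 = \<zeta>" shows "charpoly2 G x \<zeta> = 0"
proof -
  obtain \<alpha> \<beta> where ab: "\<And>\<zeta>. charpoly2 G x \<zeta> = (\<zeta> - \<alpha>) * (\<zeta> - \<beta>)" using charpoly2_factor by metis
  then have "\<alpha> = 1 \<or> \<beta> = 1" "\<alpha> * \<beta> = \<zeta>" using assms by auto
  then show ?thesis unfolding ab by auto
qed

lemma charpoly2_det_of_roots:
  assumes "charpoly2 G x 1 = 0" "charpoly2 G x \<zeta> = 0" "\<zeta> \<noteq> 1" shows "charpoly2 G x 0 = \<zeta>"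
proof -
  obtain \<alpha> \<beta> where ab: "\<And>\<zeta>. charpoly2 G x \<zeta> = (\<zeta> - \<alpha>) * (\<zeta> - \<beta>)" using charpoly2_factor by metis
  then have "\<alpha> = 1 \<or> \<beta> = 1" "\<alpha> = \<zeta> \<or> \<beta> = \<zeta>" using assms by auto
  then show ?thesis unfolding ab using assms(3) by auto
qed

text \<open>
  If \<open>\<zeta> \<noteq> 1\<close> then the fixed points form a smooth curve near \<open>z\<close>, along which the determinant is
  holomorphic and unimodular, hence constant.
\<close>

lemma eigenvalue_constant_on_fixed_curve:
  fixes G :: "complex \<times> complex \<Rightarrow> complex \<times> complex"
  assumes D: "open D" "z \<in> D" and G: "holomorphic_map_on G D" and z: "G z = z" and lim: "z islimpt {x. G x = x}"
    and \<zeta>: "\<zeta> \<noteq> 1" "charpoly2 G z \<zeta> = 0" and uni: "\<And>x. x \<in> D \<Longrightarrow> G x = x \<Longrightarrow> norm (charpoly2 G x 0) = 1"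
  obtains W where "open W" "z \<in> W" "\<And>x. x \<in> W \<Longrightarrow> G x = x \<Longrightarrow> charpoly2 G x \<zeta> = 0"
proof -
  have one: "charpoly2 G z 1 = 0" by (rule eigenvalue_1_of_nonisolated_fixed_point[OF D G lim z])
  define e where "e = (\<lambda>x. G x - x)"
  have he: "holomorphic_map_on e D" unfolding e_def by (rule holomorphic_map_on_diff_id(1)[OF D(1) G])
  have je: "jacobian e z v = jacobian G z v - v" for v unfolding e_def by (rule holomorphic_map_on_diff_id(2)[OF D(1) G D(2)])
  obtain p q where pq: "(p, q) \<noteq> (0, 0)" "jacobian G z (p, q) = (\<zeta> * p, \<zeta> * q)" using \<zeta>(2) charpoly2_eq_0_iff by blast
  \<comment> \<open>So one of the two components of G - id has a nonzero gradient at z. It is called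
    k1 below, and k1 = 0 is the smooth curve.\<close>
  have "jacobian e z (p, q) \<noteq> 0"
  proof
    assume "jacobian e z (p, q) = 0"
    then have "\<zeta> * p = p" "\<zeta> * q = q" by (auto simp: je pq(2) zero_prod_def)
    then show False using pq(1) \<zeta>(1) by auto
  qed
  then have "(partial1 (fst \<circ> e) z, partial2 (fst \<circ> e) z) \<noteq> (0, 0) \<or> (partial1 (snd \<circ> e) z, partial2 (snd \<circ> e) z) \<noteq> (0, 0)"
    by (auto simp: jacobian_def zero_prod_def)
  moreover have "holomorphic2_on (fst \<circ> e) D" "holomorphic2_on (snd \<circ> e) D" using he by (auto simp: holomorphic_map_on_def)
  moreover have "G x = x \<longleftrightarrow> (fst \<circ> e) x = 0 \<and> (snd \<circ> e) x = 0" for x by (auto simp: e_def prod_eq_iff)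
  ultimately obtain k1 k2 where k: "(partial1 k1 z, partial2 k1 z) \<noteq> (0, 0)" "holomorphic2_on k1 D" "holomorphic2_on k2 D"
    "\<And>x. G x = x \<longleftrightarrow> k1 x = 0 \<and> k2 x = 0" by metis
  define A B where "A = partial1 k1 z" and "B = partial2 k1 z"
  have AB: "A \<noteq> 0 \<or> B \<noteq> 0" using k(1) by (auto simp: A_def B_def)
  \<comment> \<open>Conjugate coefficients make l independent of the differential of k1: the
    determinant of the pair is, up to sign, |A|^2 + |B|^2. So l is a parameter on the curve.\<close>
  define l where "l = (\<lambda>x :: complex \<times> complex. cnj A * snd x - cnj B * fst x)"
  define \<Phi> where "\<Phi> = (\<lambda>x. (l x, k1 x))"
  have hl: "holomorphic2_on l D" unfolding l_def
    by (intro holomorphic2_on_diff holomorphic2_on_mult holomorphic2_on_const holomorphic2_on_fst holomorphic2_on_snd)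
  have h\<Phi>: "holomorphic_map_on \<Phi> D" using hl k(2) by (simp add: holomorphic_map_on_def \<Phi>_def o_def)
  have dl: "(l has_derivative (\<lambda>(h, k). (- cnj B) * h + cnj A * k)) (at z)"
    unfolding l_def by (rule has_derivative_eq_rhs, (rule derivative_intros)+) (auto simp: fun_eq_iff)
  have "(\<Phi> has_derivative (\<lambda>v. ((\<lambda>(h, k). (- cnj B) * h + cnj A * k) v, (\<lambda>(h, k). A * h + B * k) v))) (at z)"
    unfolding \<Phi>_def A_def B_def using dl holomorphic2_has_derivative[OF D(1) k(2) D(2)]
    by (intro has_derivative_Pair) (auto simp: A_def B_def)
  then have "jacobian \<Phi> z = (\<lambda>v. ((\<lambda>(h, k). (- cnj B) * h + cnj A * k) v, (\<lambda>(h, k). A * h + B * k) v))"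
    by (rule has_derivative_unique[OF holomorphic_map_has_derivative[OF D(1) h\<Phi> D(2)]])
  then have j\<Phi>: "jacobian \<Phi> z (h, k) = (cnj A * k - cnj B * h, A * h + B * k)" for h k by simp
  have inj: "v = 0" if "jacobian \<Phi> z v = 0" for v
  proof -
    obtain h k where v: "v = (h, k)" by (cases v)
    have 1: "cnj A * k = cnj B * h" and 2: "A * h = - (B * k)"
      using that by (auto simp: v j\<Phi> zero_prod_def add_eq_0_iff)
    have "(A * cnj A + B * cnj B) * h = cnj A * (A * h) + B * (cnj B * h)" by (simp add: algebra_simps)
    also have "\<dots> = 0" unfolding 2 1[symmetric] by simp
    finally have h0: "(A * cnj A + B * cnj B) * h = 0" .
    have "(A * cnj A + B * cnj B) * k = A * (cnj A * k) + cnj B * (B * k)" by (simp add: algebra_simps)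
    also have "\<dots> = cnj B * (A * h + B * k)" unfolding 1 by (simp add: algebra_simps)
    also have "\<dots> = 0" unfolding 2 by simp
    finally have k0: "(A * cnj A + B * cnj B) * k = 0" .
    have "A * cnj A + B * cnj B = of_real ((norm A)\<^sup>2 + (norm B)\<^sup>2)" by (simp flip: complex_norm_square)
    then have "A * cnj A + B * cnj B \<noteq> 0" using AB by (metis of_real_eq_0_iff sum_power2_eq_zero_iff norm_eq_zero)
    then show ?thesis using h0 k0 by (simp add: v zero_prod_def)
  qed
  obtain U V \<Psi> where UV: "open U" "U \<subseteq> D" "z \<in> U" "open V" "homeomorphism U V \<Phi> \<Psi>" "holomorphic_map_on \<Psi> V"
    using holomorphic_local_inverse[OF D h\<Phi> inj] by metis
  have \<Psi>\<Phi>: "\<Psi> (\<Phi> x) = x" "\<Phi> x \<in> V" if "x \<in> U" for x using UV(5) that by (auto simp: homeomorphism_def)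
  have \<Phi>\<Psi>: "\<Phi> (\<Psi> y) = y" "\<Psi> y \<in> U" if "y \<in> V" for y using UV(5) that by (auto simp: homeomorphism_def)
  define t0 where "t0 = l z"
  have \<Phi>z: "\<Phi> z = (t0, 0)" using z k(4)[of z] by (simp add: \<Phi>_def t0_def)
  then have "(t0, 0) \<in> V" using \<Psi>\<Phi>(2)[OF UV(3)] by simp
  then obtain \<epsilon> where \<epsilon>: "\<epsilon> > 0" "cball t0 \<epsilon> \<times> cball 0 \<epsilon> \<subseteq> V" using open_contains_bidisc[OF UV(4)] by blast
  have inV: "(t, 0) \<in> V" if "t \<in> ball t0 \<epsilon>" for t using that \<epsilon> by (intro subsetD[OF \<epsilon>(2)]) auto
  define c where "c = (\<lambda>t. \<Psi> (t, 0))"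
  have cU: "c t \<in> U" "l (c t) = t" "k1 (c t) = 0" if "t \<in> ball t0 \<epsilon>" for t
    using \<Phi>\<Psi>[OF inV[OF that]] by (auto simp: c_def \<Phi>_def)
  define W where "W = U \<inter> l -` ball t0 \<epsilon>"
  have lc: "continuous_on U l" using holomorphic2_on_imp_continuous_on[OF hl] UV(2) continuous_on_subset by blast
  have W: "open W" "z \<in> W" unfolding W_def
    using continuous_open_preimage[OF lc UV(1) open_ball] UV(3) \<epsilon>(1) by (auto simp: t0_def)
  have Wc: "x = c (l x)" if "x \<in> W" "G x = x" for x
  proof -
    have "\<Phi> x = (l x, 0)" using that k(4)[of x] by (simp add: \<Phi>_def)
    then show ?thesis using \<Psi>\<Phi>(1)[of x] that(1) by (simp add: W_def c_def)
  qed
  have hol: "(\<lambda>t. f (c t)) holomorphic_on ball t0 \<epsilon>" if f: "holomorphic2_on f D" for f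
  proof -
    have "holomorphic2_on (f \<circ> \<Psi>) V"
      by (rule holomorphic2_compose_map[OF f UV(6)]) (use \<Phi>\<Psi>(2) UV(2) in blast)
    then have "(\<lambda>t. (f \<circ> \<Psi>) (t, 0)) holomorphic_on ball t0 \<epsilon>"
      by (rule holomorphic_slice1) (use inV in auto)
    then show ?thesis by (simp add: c_def)
  qed
  define T where "T = {t \<in> ball t0 \<epsilon>. k2 (c t) = 0}"
  have limT: "t0 islimpt T"
    unfolding islimpt_approachable
  proof (intro allI impI)
    fix e' :: real assume e': "e' > 0"
    have o: "open (U \<inter> l -` ball t0 (min e' \<epsilon>))" by (rule continuous_open_preimage[OF lc UV(1) open_ball])
    have zi: "z \<in> U \<inter> l -` ball t0 (min e' \<epsilon>)" using UV(3) e' \<epsilon>(1) by (simp add: t0_def)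
    obtain x where x: "G x = x" "x \<in> U \<inter> l -` ball t0 (min e' \<epsilon>)" "x \<noteq> z"
      using lim[unfolded islimpt_def, rule_format, OF zi o] by (elim bexE conjE) (simp only: mem_Collect_eq)
    have xW: "x \<in> W" using x(2) by (auto simp: W_def)
    have "l x \<noteq> t0"
    proof
      assume "l x = t0"
      then have "x = c t0" using Wc[OF xW x(1)] by simp
      moreover have "z = c t0" using Wc[OF W(2) z] by (simp add: t0_def)
      ultimately show False using x(3) by simp
    qed
    moreover have "l x \<in> T" using xW Wc[OF xW x(1)] x(1) k(4)[of x] by (simp add: T_def W_def)
    moreover have "dist (l x) t0 < e'" using x(2) by (simp add: dist_commute)
    ultimately show "\<exists>x'\<in>T. x' \<noteq> t0 \<and> dist x' t0 < e'" by blast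
  qed
  \<comment> \<open>The other component vanishes at parameters accumulating at t0, hence along the
    whole curve, which therefore consists of fixed points.\<close>
  have k2: "k2 (c t) = 0" if "t \<in> ball t0 \<epsilon>" for t
  proof (rule analytic_continuation[OF hol[OF k(3)] open_ball connected_ball _ _ limT _ that])
    show "T \<subseteq> ball t0 \<epsilon>" "t0 \<in> ball t0 \<epsilon>" using \<epsilon>(1) by (auto simp: T_def)
  qed (simp add: T_def)
  have fixc: "G (c t) = c t" if "t \<in> ball t0 \<epsilon>" for t
    using k(4)[of "c t"] cU(3)[OF that] k2[OF that] by simp
  have one_c: "charpoly2 G (c t) 1 = 0" if t: "t \<in> ball t0 \<epsilon>" for t
  proof (rule eigenvalue_1_of_nonisolated_fixed_point[OF D(1) _ G _ fixc[OF t]])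
    show "c t \<in> D" using cU(1)[OF t] UV(2) by blast
    show "c t islimpt {x. G x = x}"
      unfolding islimpt_def
    proof (intro allI impI)
      fix O' assume O': "c t \<in> O'" "open O'"
      have "continuous_on (ball t0 \<epsilon>) c" unfolding c_def
        by (rule continuous_on_compose2[OF holomorphic_map_on_imp_continuous_on[OF UV(6)]]) (use inV in \<open>auto intro!: continuous_intros\<close>)
      then have o: "open (ball t0 \<epsilon> \<inter> c -` O')" by (rule continuous_open_preimage[OF _ open_ball O'(2)])
      have "t \<in> ball t0 \<epsilon> \<inter> c -` O'" using t O'(1) by (simp only: Int_iff vimage_eq)
      then have "t islimpt (ball t0 \<epsilon> \<inter> c -` O')"
        by (intro interior_limit_point) (simp only: interior_open[OF o])
      from this[unfolded islimpt_def, rule_format, OF UNIV_I open_UNIV]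
      obtain t' where t': "t' \<in> ball t0 \<epsilon> \<inter> c -` O'" "t' \<noteq> t" by (elim bexE conjE)
      then have "c t' \<noteq> c t" using cU(2)[of t'] cU(2)[OF t] by (metis IntD1)
      moreover have "G (c t') = c t'" "c t' \<in> O'" using t' fixc by auto
      ultimately show "\<exists>y\<in>{x. G x = x}. y \<in> O' \<and> y \<noteq> c t" by (intro bexI[of _ "c t'"]) auto
    qed
  qed
  have det: "charpoly2 G (c t) 0 = \<zeta>" if t: "t \<in> ball t0 \<epsilon>" for t
  proof -
    have t0: "t0 \<in> ball t0 \<epsilon>" using \<epsilon>(1) by simp
    have n1: "norm (charpoly2 G (c t) 0) = 1" if "t \<in> ball t0 \<epsilon>" for t
      using uni[of "c t"] cU(1)[OF that] UV(2) fixc[OF that] by blast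
    have "(\<lambda>t. charpoly2 G (c t) 0) constant_on ball t0 \<epsilon>"
      by (rule maximum_modulus_principle[OF hol[OF charpoly2_holomorphic2[OF D(1) G]] open_ball connected_ball open_ball order_refl t0])
         (use n1 t0 in simp)
    then have "charpoly2 G (c t) 0 = charpoly2 G (c t0) 0" using t t0 unfolding constant_on_def by metis
    also have "c t0 = z" using Wc[OF W(2) z] by (simp add: t0_def)
    also have "charpoly2 G z 0 = \<zeta>" by (rule charpoly2_det_of_roots[OF one \<zeta>(2,1)])
    finally show ?thesis .
  qed
  have "charpoly2 G x \<zeta> = 0" if "x \<in> W" "G x = x" for x
  proof -
    have t: "l x \<in> ball t0 \<epsilon>" using that(1) by (simp add: W_def)
    show ?thesis using charpoly2_root_of_1_and_det[OF one_c[OF t] det[OF t]] Wc[OF that] by simp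
  qed
  then show ?thesis using that W by blast
qed

section \<open>Continua of periodic points\<close>

lemma jacobian_iterate_fixed_point:
  assumes D: "open D" "z \<in> D" and G: "holomorphic_map_on G D" and z: "G z = z"
    and D': "open D'" "z \<in> D'" "holomorphic_map_on (G ^^ j) D'"
  shows "jacobian (G ^^ j) z = jacobian G z ^^ j"
proof -
  have "((G ^^ i) has_derivative (jacobian G z ^^ i)) (at z)" for i
  proof (induction i)
    case (Suc i)
    have "(G ^^ i) z = z" using z by (induction i) auto
    then have "(G has_derivative jacobian G z) (at ((G ^^ i) z))"
      using holomorphic_map_has_derivative[OF D(1) G D(2)] by simp
    from diff_chain_at[OF Suc this] show ?case by (simp add: o_def)
  qed (simp add: id_def)
  from has_derivative_unique[OF holomorphic_map_has_derivative[OF D'(1,3,2)] this] show ?thesis .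
qed

lemma holomorphic_map_on_sum:
  assumes D: "open D" and f: "\<And>i. i \<in> I \<Longrightarrow> holomorphic_map_on (f i) D" and I: "finite I"
  shows "holomorphic_map_on (\<lambda>x. \<Sum>i\<in>I. f i x) D"
    and "x \<in> D \<Longrightarrow> jacobian (\<lambda>x. \<Sum>i\<in>I. f i x) x v = (\<Sum>i\<in>I. jacobian (f i) x v)"
proof -
  have der: "((\<lambda>x. \<Sum>i\<in>I. f i x) has_derivative (\<lambda>v. \<Sum>i\<in>I. jacobian (f i) x v)) (at x)" if "x \<in> D" for x
    by (intro has_derivative_sum holomorphic_map_has_derivative[OF D _ that] f)
  have eq: "(\<lambda>v. \<Sum>i\<in>I. jacobian (f i) x v) = (\<lambda>(h, k).
     ((\<Sum>i\<in>I. partial1 (fst \<circ> f i) x) * h + (\<Sum>i\<in>I. partial2 (fst \<circ> f i) x) * k,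
      (\<Sum>i\<in>I. partial1 (snd \<circ> f i) x) * h + (\<Sum>i\<in>I. partial2 (snd \<circ> f i) x) * k))" for x
    by (auto simp: fun_eq_iff jacobian_def prod_eq_iff fst_sum snd_sum sum.distrib sum_distrib_right)
  show h: "holomorphic_map_on (\<lambda>x. \<Sum>i\<in>I. f i x) D"
  proof (rule holomorphic_map_onI)
    fix x assume "x \<in> D"
    from der[OF this] show "\<exists>a b c d. ((\<lambda>x. \<Sum>i\<in>I. f i x) has_derivative (\<lambda>(h, k). (a * h + b * k, c * h + d * k))) (at x)"
      unfolding eq by blast
  qed
  show "jacobian (\<lambda>x. \<Sum>i\<in>I. f i x) x v = (\<Sum>i\<in>I. jacobian (f i) x v)" if "x \<in> D"
    using fun_cong[OF has_derivative_unique[OF holomorphic_map_has_derivative[OF D h that] der[OF that]], of v] .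
qed

text \<open>
  The sum of the iterates is locally injective at \<open>z\<close>, and it takes the same value at \<open>x\<close> and \<open>G x\<close>
  if \<open>G ^^ j\<close> fixes \<open>x\<close>.
\<close>

lemma fixed_points_of_iterate_locally:
  assumes D: "open D" "z \<in> D" and G: "\<And>i. i \<le> j \<Longrightarrow> holomorphic_map_on (G ^^ i) D" and z: "G z = z" and j: "j \<ge> 1"
    and good: "\<And>\<xi>. charpoly2 G z \<xi> = 0 \<Longrightarrow> \<xi> ^ j = 1 \<Longrightarrow> \<xi> = 1"
  shows "\<forall>\<^sub>F x in nhds z. (G ^^ j) x = x \<longrightarrow> G x = x"
proof -
  define T where "T = (\<lambda>x. \<Sum>i<j. (G ^^ i) x)"
  have G1: "holomorphic_map_on G D" using G[of 1] j by simp
  have hT: "holomorphic_map_on T D" unfolding T_def by (rule holomorphic_map_on_sum(1)[OF D(1) G]) auto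
  have inj: "v = 0" if "jacobian T z v = 0" for v
  proof (rule sum_jacobian_funpow_injective[OF good j])
    have "jacobian T z v = (\<Sum>i<j. jacobian (G ^^ i) z v)"
      unfolding T_def by (rule holomorphic_map_on_sum(2)[OF D(1) G _ D(2)]) auto
    also have "\<dots> = (\<Sum>i<j. (jacobian G z ^^ i) v)"
      by (intro sum.cong refl) (use jacobian_iterate_fixed_point[OF D G1 z D G] in auto)
    finally show "(\<Sum>i<j. (jacobian G z ^^ i) v) = 0" using that by simp
  qed
  obtain U V g where U: "open U" "U \<subseteq> D" "z \<in> U" "homeomorphism U V T g"
    by (rule holomorphic_local_inverse[OF D hT inj])
  have "continuous_on D G" by (rule holomorphic_map_on_imp_continuous_on[OF G1])
  then have "open (U \<inter> G -` U)" using U continuous_open_preimage continuous_on_subset by metis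
  then have "\<forall>\<^sub>F x in nhds z. x \<in> U \<inter> G -` U" by (rule eventually_nhds_in_open) (use U(3) z in auto)
  then show ?thesis
  proof eventually_elim
    case (elim x)
    show ?case
    proof
      assume fx: "(G ^^ j) x = x"
      have "T (G x) = (\<Sum>i<j. (G ^^ Suc i) x)" by (simp add: T_def funpow_swap1)
      also have "\<dots> = (\<Sum>i<Suc j. (G ^^ i) x) - x" by (simp only: sum.lessThan_Suc_shift) simp
      also have "\<dots> = T x" using fx by (simp add: T_def)
      finally have "T (G x) = T x" .
      then show "G x = x" using U(4) elim unfolding homeomorphism_def by (metis IntD1 IntD2 vimage_eq)
    qed
  qed
qed

text \<open>
  An eigenvalue of modulus less than 1 would give a strong stable curve, whose points have infinite
  forward orbits.
\<close>

lemma norm_eigenvalue_ge_1: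
  assumes S: "open S" and H: "holomorphic_map_on H S" and fin: "\<And>q. finite (forward_orbit H S q)"
    and z: "z \<in> iterate_domain H S n" "(H ^^ n) z = z" and n: "n \<ge> 1"
    and inj: "\<And>v. jacobian (H ^^ n) z v = 0 \<Longrightarrow> v = 0" and \<zeta>: "charpoly2 (H ^^ n) z \<zeta> = 0"
  shows "norm \<zeta> \<ge> 1"
proof -
  obtain \<alpha> \<beta> where ab: "\<And>\<zeta>. charpoly2 (H ^^ n) z \<zeta> = (\<zeta> - \<alpha>) * (\<zeta> - \<beta>)" "norm \<alpha> \<le> norm \<beta>"
    using charpoly2_factor by metis
  have "\<alpha> \<noteq> 0"
  proof
    assume "\<alpha> = 0"
    then have "charpoly2 (H ^^ n) z 0 = 0" using ab(1)[of 0] by simp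
    then obtain p q where "(p, q) \<noteq> (0, 0)" "jacobian (H ^^ n) z (p, q) = (0 * p, 0 * q)" unfolding charpoly2_eq_0_iff by blast
    then show False using inj[of "(p, q)"] by (auto simp: zero_prod_def)
  qed
  then have "\<not> norm \<alpha> < 1"
    using infinite_orbit_near_contracting_periodic_point[OF S H z n ab(1) _ _ ab(2)] fin by auto
  moreover have "\<zeta> = \<alpha> \<or> \<zeta> = \<beta>" using \<zeta> unfolding ab(1) by auto
  ultimately show ?thesis using ab(2) by auto
qed

text \<open>The lower bound on eigenvalues applies to the inverse map too. The differential of its
  n-th iterate at z inverts that of \<open>F ^^ n\<close>, so 1/\<zeta> also has modulus at least
  1.\<close>

lemma norm_eigenvalue_periodic_point:
  assumes F: "biholomorphism F U V" and S: "open S" "S \<subseteq> U" "S \<subseteq> V"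
    and fin: "\<And>q. finite (forward_orbit F S q)" "\<And>q. finite (forward_orbit (inv_into U F) S q)"
    and z: "z \<in> iterate_domain F S n" "(F ^^ n) z = z" and n: "n \<ge> 1" and \<zeta>: "charpoly2 (F ^^ n) z \<zeta> = 0"
  shows "norm \<zeta> = 1"
proof -
  define f where "f = inv_into U F"
  have bij: "bij_betw F U V" and hF: "holomorphic_map_on F S" and hf: "holomorphic_map_on f S"
    using F S holomorphic_map_on_subset by (auto simp: biholomorphism_def f_def)
  have fF: "f (F x) = x" if "x \<in> S" for x
    using bij S(2) that by (auto simp: f_def bij_betw_def)
  have inv: "(f ^^ i) ((F ^^ i) x) = x" if "x \<in> iterate_domain F S i" for x i
    using that
  proof (induction i)
    case (Suc i)
    then have "(F ^^ i) x \<in> S" "x \<in> iterate_domain F S i" by (auto simp: iterate_domain_def)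
    then show ?case using Suc.IH by (simp only: funpow_Suc_right[of _ f] o_apply funpow.simps(2)[of _ F] fF)
  qed simp
  \<comment> \<open>The backward orbit of z runs through the same cycle in reverse, so it stays in
    S.\<close>
  have orb: "(f ^^ i) z = (F ^^ (n - i)) z" if "i \<le> n" for i
  proof -
    have "(F ^^ i) ((F ^^ (n - i)) z) = (F ^^ (i + (n - i))) z" by (simp only: funpow_add o_apply)
    also have "\<dots> = z" using that z(2) by simp
    finally have e: "(F ^^ i) ((F ^^ (n - i)) z) = z" .
    have "(F ^^ (n - i)) z \<in> iterate_domain F S i" unfolding iterate_domain_def
    proof clarify
      fix k assume "k < i"
      then have "(F ^^ (k + (n - i))) z \<in> S" using z(1) that by (auto simp: iterate_domain_def)
      then show "(F ^^ k) ((F ^^ (n - i)) z) \<in> S" by (simp only: funpow_add o_apply)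
    qed
    from inv[OF this] show ?thesis unfolding e .
  qed
  have zf: "z \<in> iterate_domain f S n" "(f ^^ n) z = z"
  proof -
    show "(f ^^ n) z = z" using orb[of n] by simp
    show "z \<in> iterate_domain f S n" unfolding iterate_domain_def
    proof clarify
      fix i assume i: "i < n"
      show "(f ^^ i) z \<in> S"
      proof (cases "i = 0")
        case True
        then show ?thesis using z(1) n by (auto simp: iterate_domain_def)
      next
        case False
        then show ?thesis using z(1) i orb[of i] by (auto simp: iterate_domain_def)
      qed
    qed
  qed
  have DF: "open (iterate_domain F S n)" "holomorphic_map_on (F ^^ n) (iterate_domain F S n)"
    and Df: "open (iterate_domain f S n)" "holomorphic_map_on (f ^^ n) (iterate_domain f S n)"
    using iterate_holomorphic[OF S(1) hF] iterate_holomorphic[OF S(1) hf] by auto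
  have jj: "jacobian (f ^^ n) z (jacobian (F ^^ n) z v) = v" for v
  proof -
    have "((f ^^ n) \<circ> (F ^^ n) has_derivative (jacobian (f ^^ n) z \<circ> jacobian (F ^^ n) z)) (at z)"
      using diff_chain_at[OF holomorphic_map_has_derivative[OF DF z(1)]] holomorphic_map_has_derivative[OF Df zf(1)] z(2)
      by metis
    moreover have "((f ^^ n) \<circ> (F ^^ n) has_derivative (\<lambda>v. v)) (at z)"
      by (rule has_derivative_transform_within_open[OF has_derivative_ident DF(1) z(1)]) (simp add: inv)
    ultimately have "jacobian (f ^^ n) z \<circ> jacobian (F ^^ n) z = (\<lambda>v. v)" by (rule has_derivative_unique)
    from fun_cong[OF this, of v] show ?thesis by simp
  qed
  have injF: "v = 0" if "jacobian (F ^^ n) z v = 0" for v using jj[of v] that by simp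
  have ge: "norm \<zeta> \<ge> 1" by (rule norm_eigenvalue_ge_1[OF S(1) hF fin(1) z n injF \<zeta>])
  \<comment> \<open>By \<open>jj\<close> the differential of the inverse iterate is a left inverse.
    The adjugate yields a preimage of v under the differential of \<open>F ^^ n\<close>, and
    \<open>jj\<close> shows that this preimage is 0.\<close>
  have injf: "v = 0" if v: "jacobian (f ^^ n) z v = 0" for v
  proof -
    define a b c d where "a = partial1 (fst \<circ> (F ^^ n)) z" and "b = partial2 (fst \<circ> (F ^^ n)) z"
      and "c = partial1 (snd \<circ> (F ^^ n)) z" and "d = partial2 (snd \<circ> (F ^^ n)) z"
    have det: "a * d - b * c \<noteq> 0" unfolding a_def b_def c_def d_def by (rule jacobian_det_ne_0[OF injF])
    define D where "D = a * d - b * c"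
    have D: "D \<noteq> 0" using det by (simp add: D_def)
    obtain h k where hk: "v = (h, k)" by (cases v)
    have "a * (d * h - b * k) + b * (a * k - c * h) = D * h" "c * (d * h - b * k) + d * (a * k - c * h) = D * k"
      by (simp_all add: D_def algebra_simps)
    moreover have "jacobian (F ^^ n) z (x / D, y / D) = ((a * x + b * y) / D, (c * x + d * y) / D)" for x y
      unfolding jacobian_def a_def[symmetric] b_def[symmetric] c_def[symmetric] d_def[symmetric]
      by (simp add: add_divide_distrib)
    ultimately have "jacobian (F ^^ n) z ((d * h - b * k) / D, (a * k - c * h) / D) = (D * h / D, D * k / D)" by simp
    then have w: "jacobian (F ^^ n) z ((d * h - b * k) / D, (a * k - c * h) / D) = v" using D by (simp add: hk)
    then have "((d * h - b * k) / D, (a * k - c * h) / D) = 0" using jj v by metis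
    then show ?thesis using w by simp
  qed
  obtain p q where pq: "(p, q) \<noteq> (0, 0)" "jacobian (F ^^ n) z (p, q) = (\<zeta> * p, \<zeta> * q)" using \<zeta> charpoly2_eq_0_iff by blast
  have \<zeta>0: "\<zeta> \<noteq> 0" using ge by auto
  have "(\<zeta> * fst (jacobian (f ^^ n) z (p, q)), \<zeta> * snd (jacobian (f ^^ n) z (p, q))) = (p, q)"
    using jj[of "(p, q)"] unfolding pq(2) jacobian_scale .
  then have "jacobian (f ^^ n) z (p, q) = (1 / \<zeta> * p, 1 / \<zeta> * q)"
    using \<zeta>0 by (auto simp: prod_eq_iff field_simps)
  then have "charpoly2 (f ^^ n) z (1 / \<zeta>) = 0" using pq(1) charpoly2_eq_0_iff by blast
  then have "norm (1 / \<zeta>) \<ge> 1"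
    using norm_eigenvalue_ge_1[OF S(1) hf fin(2)[folded f_def] zf n injf] by blast
  then show ?thesis using ge \<zeta>0 by (simp add: norm_divide field_simps)
qed

text \<open>
  The points of a continuum of periodic points on which \<open>F ^^ fact n\<close> is the identity and its
  differential has no eigenvalue that is a nontrivial root of unity: these sets increase with \<open>n\<close>
  and each is closed, and open in the later ones, so that one of them is the whole continuum.
\<close>

definition periodic_stratum :: "(complex \<times> complex \<Rightarrow> complex \<times> complex) \<Rightarrow> (complex \<times> complex) set \<Rightarrow> nat \<Rightarrow> (complex \<times> complex) set" where
  "periodic_stratum F C n = {x \<in> C. (F ^^ fact n) x = x \<and>
     (\<forall>\<zeta> j. charpoly2 (F ^^ fact n) x \<zeta> = 0 \<longrightarrow> j \<ge> 1 \<longrightarrow> \<zeta> ^ j = 1 \<longrightarrow> \<zeta> = 1)}"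

text \<open>Unimodularity is asked of all periodic points with orbit in S and not only of those in
  C, because the curve of fixed points through a point of C may leave C.\<close>

locale periodic_continuum =
  fixes F :: "complex \<times> complex \<Rightarrow> complex \<times> complex" and S C :: "(complex \<times> complex) set"
  assumes S: "open S" and F: "holomorphic_map_on F S"
    and C: "compact C" and CS: "\<And>x n. x \<in> C \<Longrightarrow> (F ^^ n) x \<in> S"
    and periodic: "\<And>x. x \<in> C \<Longrightarrow> \<exists>k\<ge>1. (F ^^ k) x = x"
    and unimodular: "\<And>x n \<zeta>. n \<ge> 1 \<Longrightarrow> x \<in> iterate_domain F S n \<Longrightarrow> (F ^^ n) x = x \<Longrightarrow> charpoly2 (F ^^ n) x \<zeta> = 0 \<Longrightarrow> norm \<zeta> = 1"
begin

lemma domain: "open (iterate_domain F S n)" "holomorphic_map_on (F ^^ n) (iterate_domain F S n)"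
  and C_domain: "x \<in> C \<Longrightarrow> x \<in> iterate_domain F S n"
  using iterate_holomorphic[OF S F] CS by (auto simp: iterate_domain_def)

lemma domain_mono: "m \<le> n \<Longrightarrow> iterate_domain F S n \<subseteq> iterate_domain F S m"
  by (auto simp: iterate_domain_def)

lemma iterate_fixed: "(F ^^ m) x = x \<Longrightarrow> m dvd n \<Longrightarrow> (F ^^ n) x = x"
proof -
  assume x: "(F ^^ m) x = x" and "m dvd n"
  then obtain j where n: "n = m * j" by (elim dvdE)
  have "((F ^^ m) ^^ j) x = x" using x by (induction j) auto
  then show ?thesis by (simp add: n funpow_mult)
qed

lemma jacobian_iterate_dvd:
  assumes x: "x \<in> C" "(F ^^ m) x = x"
  shows "jacobian (F ^^ (m * j)) x = jacobian (F ^^ m) x ^^ j"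
proof -
  have "holomorphic_map_on ((F ^^ m) ^^ j) (iterate_domain F S (m * j))"
    using domain(2)[of "m * j"] by (simp add: funpow_mult)
  from jacobian_iterate_fixed_point[OF domain(1) C_domain[OF x(1)] domain(2) x(2) domain(1) C_domain[OF x(1)] this]
  show ?thesis by (simp add: funpow_mult)
qed

lemma eigenvalue_iterate_dvdD:
  assumes x: "x \<in> C" "(F ^^ m) x = x" and \<zeta>: "charpoly2 (F ^^ (m * j)) x \<zeta> = 0"
  obtains \<xi> where "charpoly2 (F ^^ m) x \<xi> = 0" "\<xi> ^ j = \<zeta>"
proof -
  obtain p q where "(p, q) \<noteq> (0, 0)" "(jacobian (F ^^ m) x ^^ j) (p, q) = (\<zeta> * p, \<zeta> * q)"
    using \<zeta> unfolding charpoly2_eq_0_iff jacobian_iterate_dvd[OF x] by blast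
  then show ?thesis using eigenvalue_of_jacobian_funpow that by metis
qed

lemma eigenvalue_iterate_dvdI:
  assumes x: "x \<in> C" "(F ^^ m) x = x" and \<xi>: "charpoly2 (F ^^ m) x \<xi> = 0"
  shows "charpoly2 (F ^^ (m * j)) x (\<xi> ^ j) = 0"
  using \<xi> jacobian_funpow_eigen unfolding charpoly2_eq_0_iff jacobian_iterate_dvd[OF x] by blast

lemma fact_multiple: "n \<le> m \<Longrightarrow> \<exists>j\<ge>1. fact m = fact n * (j::nat)"
proof -
  assume "n \<le> m"
  then have "(fact n :: nat) dvd fact m" by (rule fact_dvd)
  then obtain j where j: "fact m = fact n * (j::nat)" by (elim dvdE)
  moreover have "j \<ge> 1" using j fact_nonzero[of m, where 'a = nat] by (cases j) auto
  ultimately show ?thesis by blast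
qed

text \<open>Factorials make the later exponent a multiple of the earlier one. Eigenvalues of the
  later iterate are then powers of those of the earlier one, and such a power can be a root of unity
  only if its base is, hence only if the base is 1.\<close>

lemma periodic_stratum_mono:
  assumes nm: "n \<le> m" shows "periodic_stratum F C n \<subseteq> periodic_stratum F C m"
proof
  fix x assume "x \<in> periodic_stratum F C n"
  then have x: "x \<in> C" "(F ^^ fact n) x = x"
    and g: "\<And>\<zeta> j. charpoly2 (F ^^ fact n) x \<zeta> = 0 \<Longrightarrow> j \<ge> 1 \<Longrightarrow> \<zeta> ^ j = 1 \<Longrightarrow> \<zeta> = 1"
    by (auto simp: periodic_stratum_def)
  obtain J :: nat where J: "J \<ge> 1" "(fact m :: nat) = fact n * J" using fact_multiple[OF nm] by blast
  have "\<zeta> = 1" if z: "charpoly2 (F ^^ fact m) x \<zeta> = 0" "j \<ge> 1" "\<zeta> ^ j = 1" for \<zeta> j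
  proof -
    obtain \<xi> where xi: "charpoly2 (F ^^ fact n) x \<xi> = 0" "\<xi> ^ J = \<zeta>"
      using eigenvalue_iterate_dvdD[OF x, of J \<zeta>] z(1) unfolding J(2) by metis
    have "\<xi> ^ (J * j) = 1" using xi(2) z(3) by (simp add: power_mult)
    then have "\<xi> = 1" using g[OF xi(1), of "J * j"] J(1) z(2) by simp
    then show ?thesis using xi(2) by simp
  qed
  moreover have "(F ^^ fact m) x = x" by (rule iterate_fixed[OF x(2)]) (simp add: J(2))
  ultimately show "x \<in> periodic_stratum F C m" using x(1) by (auto simp: periodic_stratum_def)
qed

text \<open>Take the period k of x and exponents a, b that send the eigenvalues of
  \<open>F ^^ k\<close> to 1, each if it is a root of unity at all. For an iterate whose exponent is
  divisible by k a b, every eigenvalue that is a root of unity equals 1.\<close>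

lemma periodic_stratum_cover: "C \<subseteq> (\<Union>n. periodic_stratum F C n)"
proof
  fix x assume x: "x \<in> C"
  obtain k where k: "k \<ge> 1" "(F ^^ k) x = x" using periodic[OF x] by auto
  obtain \<alpha> \<beta> where ab: "\<And>\<zeta>. charpoly2 (F ^^ k) x \<zeta> = (\<zeta> - \<alpha>) * (\<zeta> - \<beta>)" using charpoly2_factor by metis
  have ord: "\<exists>a\<ge>1. \<forall>j\<ge>1. \<xi> ^ j = 1 \<longrightarrow> \<xi> ^ a = 1" for \<xi> :: complex
    by (cases "\<exists>a\<ge>1. \<xi> ^ a = 1") (blast, metis order_refl)
  obtain a b where a: "a \<ge> 1" "\<And>j. j \<ge> 1 \<Longrightarrow> \<alpha> ^ j = 1 \<Longrightarrow> \<alpha> ^ a = 1" and b: "b \<ge> 1" "\<And>j. j \<ge> 1 \<Longrightarrow> \<beta> ^ j = 1 \<Longrightarrow> \<beta> ^ b = 1"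
    using ord[of \<alpha>] ord[of \<beta>] by metis
  define n where "n = k * (a * b)"
  have "n \<ge> 1" using k a b by (simp add: n_def)
  then have "n dvd fact n" by (rule dvd_fact) simp
  then obtain t :: nat where "(fact n :: nat) = n * t" by (elim dvdE)
  then have t: "(fact n :: nat) = k * (a * b * t)" by (simp only: n_def mult.assoc)
  have "\<zeta> = 1" if z: "charpoly2 (F ^^ fact n) x \<zeta> = 0" "j \<ge> 1" "\<zeta> ^ j = 1" for \<zeta> j
  proof -
    obtain \<xi> where xi: "charpoly2 (F ^^ k) x \<xi> = 0" "\<xi> ^ (a * b * t) = \<zeta>"
      using eigenvalue_iterate_dvdD[OF x k(2), of "a * b * t" \<zeta>] z(1) unfolding t by metis
    have r: "\<xi> ^ (a * b * t * j) = 1" using xi(2) z(3) by (simp add: power_mult)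
    have "fact n \<noteq> (0::nat)" by simp
    then have "a * b * t * j \<ge> 1" using z(2) unfolding t by (simp add: Suc_le_eq)
    moreover have "\<xi> = \<alpha> \<or> \<xi> = \<beta>" using xi(1) unfolding ab by auto
    ultimately have "\<xi> ^ a = 1 \<or> \<xi> ^ b = 1" using a(2) b(2) r by blast
    then have "\<xi> ^ (a * b * t) = 1"
    proof
      assume "\<xi> ^ a = 1"
      then show ?thesis by (simp add: power_mult)
    next
      assume "\<xi> ^ b = 1"
      then show ?thesis by (simp only: mult.commute[of a b] power_mult) simp
    qed
    then show ?thesis using xi(2) by simp
  qed
  moreover have "(F ^^ fact n) x = x" by (rule iterate_fixed[OF k(2)]) (simp add: t)
  ultimately have "x \<in> periodic_stratum F C n" using x by (auto simp: periodic_stratum_def)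
  then show "x \<in> (\<Union>n. periodic_stratum F C n)" by blast
qed

text \<open>If a nontrivial root of unity were an eigenvalue at a limit point, then by
  \<open>eigenvalue_constant_on_fixed_curve\<close> it would be one at all fixed points nearby, in
  particular at points of the stratum.\<close>

lemma periodic_stratum_closed: "closed (periodic_stratum F C n)"
  unfolding closed_limpt
proof (intro allI impI)
  fix z assume lim: "z islimpt periodic_stratum F C n"
  define N :: nat where "N = fact n"
  define G where "G = F ^^ N"
  define D where "D = iterate_domain F S N"
  have N1: "N \<ge> 1" by (simp add: N_def fact_ge_1)
  have D: "open D" and G: "holomorphic_map_on G D" using domain[of N] by (auto simp: D_def G_def)
  have sub: "periodic_stratum F C n \<subseteq> {x \<in> C. G x = x}" by (auto simp: periodic_stratum_def G_def N_def)
  have "z islimpt C" by (rule islimpt_subset[OF lim]) (use sub in auto)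
  then have zC: "z \<in> C" using compact_imp_closed[OF C] closed_limpt[of C] by blast
  then have zD: "z \<in> D" using C_domain by (simp add: D_def)
  have Gc: "continuous_on C G"
    by (rule continuous_on_subset[OF holomorphic_map_on_imp_continuous_on[OF G]]) (use C_domain in \<open>auto simp: D_def\<close>)
  have "closed {x \<in> C. G x - x = 0}"
    by (rule continuous_closed_preimage_constant[OF _ compact_imp_closed[OF C]]) (intro continuous_intros Gc)
  then have "closed {x \<in> C. G x = x}" by simp
  then have Gz: "G z = z" using islimpt_subset[OF lim sub] closed_limpt[of "{x \<in> C. G x = x}"] by blast
  have lim': "z islimpt {x. G x = x}" by (rule islimpt_subset[OF lim]) (use sub in auto)
  have uni: "norm (charpoly2 G x 0) = 1" if "x \<in> D" "G x = x" for x
  proof -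
    obtain \<alpha> \<beta> where ab: "\<And>\<zeta>. charpoly2 G x \<zeta> = (\<zeta> - \<alpha>) * (\<zeta> - \<beta>)" using charpoly2_factor by metis
    have "norm \<zeta> = 1" if "charpoly2 G x \<zeta> = 0" for \<zeta>
      using unimodular[OF N1, of x \<zeta>] \<open>x \<in> D\<close> \<open>G x = x\<close> that by (simp add: D_def G_def)
    from this[of \<alpha>] this[of \<beta>] show ?thesis unfolding ab by (simp add: norm_mult)
  qed
  have "\<zeta> = 1" if \<zeta>: "charpoly2 G z \<zeta> = 0" "j \<ge> 1" "\<zeta> ^ j = 1" for \<zeta> j
  proof (rule ccontr)
    assume ne: "\<zeta> \<noteq> 1"
    obtain W where W: "open W" "z \<in> W" "\<And>x. x \<in> W \<Longrightarrow> G x = x \<Longrightarrow> charpoly2 G x \<zeta> = 0"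
      by (rule eigenvalue_constant_on_fixed_curve[OF D zD G Gz lim' ne \<zeta>(1) uni]) (assumption | rule that; assumption)+
    obtain x where x: "x \<in> periodic_stratum F C n" "x \<in> W" using lim W(1,2) unfolding islimpt_def by metis
    then have "charpoly2 G x \<zeta> = 0" using W(3) sub by blast
    then show False using x(1) \<zeta>(2,3) ne unfolding periodic_stratum_def G_def N_def by blast
  qed
  then show "z \<in> periodic_stratum F C n" using zC Gz by (auto simp: periodic_stratum_def G_def N_def)
qed

text \<open>Near a point of the earlier stratum, \<open>fixed_points_of_iterate_locally\<close>
  turns fixed points of the later iterate into fixed points of the earlier one. The eigenvalue
  condition persists by continuity, since finitely many values have to be avoided.\<close>

lemma periodic_stratum_open:
  assumes nm: "n \<le> m" shows "openin (top_of_set (periodic_stratum F C m)) (periodic_stratum F C n)"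
proof -
  obtain J :: nat where J: "J \<ge> 1" "(fact m :: nat) = fact n * J" using fact_multiple[OF nm] by blast
  define G where "G = F ^^ fact n"
  \<comment> \<open>At a point of the later stratum that G fixes, the J-th power of an eigenvalue of
    G is an eigenvalue of the later iterate. If it is a root of unity it is 1, so R contains all
    values to be excluded.\<close>
  define R where "R = {\<zeta>::complex. \<zeta> ^ J = 1 \<and> \<zeta> \<noteq> 1}"
  have finR: "finite R"
    by (rule finite_subset[OF _ finite_roots_unity[OF J(1)]]) (auto simp: R_def)
  have loc: "\<exists>A. open A \<and> z \<in> A \<and> A \<inter> periodic_stratum F C m \<subseteq> periodic_stratum F C n" if z: "z \<in> periodic_stratum F C n" for z
  proof -
    have zC: "z \<in> C" "G z = z" and g: "\<And>\<zeta> j. charpoly2 G z \<zeta> = 0 \<Longrightarrow> j \<ge> 1 \<Longrightarrow> \<zeta> ^ j = 1 \<Longrightarrow> \<zeta> = 1"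
      using z by (auto simp: periodic_stratum_def G_def)
    have hol: "holomorphic_map_on (G ^^ i) (iterate_domain F S (fact n * J))" if "i \<le> J" for i
    proof -
      have "fact n * i \<le> fact n * J" using that by simp
      then show ?thesis
        using holomorphic_map_on_subset[OF domain(2) domain_mono] by (simp add: G_def funpow_mult)
    qed
    have "\<forall>\<^sub>F x in nhds z. (G ^^ J) x = x \<longrightarrow> G x = x"
      by (rule fixed_points_of_iterate_locally[OF domain(1) C_domain[OF zC(1)] hol zC(2) J(1) g[OF _ J(1)]])
    moreover have "\<forall>\<^sub>F x in nhds z. \<forall>\<zeta>\<in>R. charpoly2 G x \<zeta> \<noteq> 0"
    proof (rule eventually_ball_finite[OF finR], intro ballI)
      fix \<zeta> assume "\<zeta> \<in> R"
      then have ne: "charpoly2 G z \<zeta> \<noteq> 0" using g[of \<zeta> J] J(1) by (auto simp: R_def)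
      have "continuous_on (iterate_domain F S (fact n)) (\<lambda>x. charpoly2 G x \<zeta>)"
        unfolding G_def by (rule holomorphic2_on_imp_continuous_on[OF charpoly2_holomorphic2[OF domain]])
      then have "isCont (\<lambda>x. charpoly2 G x \<zeta>) z"
        using domain(1) C_domain[OF zC(1)] continuous_on_eq_continuous_at by blast
      then have "((\<lambda>x. charpoly2 G x \<zeta>) \<longlongrightarrow> charpoly2 G z \<zeta>) (nhds z)"
        unfolding isCont_def by (rule tendsto_at_iff_tendsto_nhds[THEN iffD1])
      then show "\<forall>\<^sub>F x in nhds z. charpoly2 G x \<zeta> \<noteq> 0" using ne by (rule tendsto_imp_eventually_ne)
    qed
    ultimately have "\<forall>\<^sub>F x in nhds z. ((G ^^ J) x = x \<longrightarrow> G x = x) \<and> (\<forall>\<zeta>\<in>R. charpoly2 G x \<zeta> \<noteq> 0)"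
      by (rule eventually_conj)
    then obtain A where A: "open A" "z \<in> A" "\<And>x. x \<in> A \<Longrightarrow> ((G ^^ J) x = x \<longrightarrow> G x = x) \<and> (\<forall>\<zeta>\<in>R. charpoly2 G x \<zeta> \<noteq> 0)"
      unfolding eventually_nhds by blast
    have "A \<inter> periodic_stratum F C m \<subseteq> periodic_stratum F C n"
    proof
      fix x assume x: "x \<in> A \<inter> periodic_stratum F C m"
      then have xC: "x \<in> C" and xm: "(F ^^ fact m) x = x"
        and gm: "\<And>\<zeta> j. charpoly2 (F ^^ fact m) x \<zeta> = 0 \<Longrightarrow> j \<ge> 1 \<Longrightarrow> \<zeta> ^ j = 1 \<Longrightarrow> \<zeta> = 1"
        by (auto simp: periodic_stratum_def)
      have "(G ^^ J) x = x" using xm by (simp add: G_def funpow_mult J(2))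
      then have Gx: "G x = x" using A(3) x by blast
      have "\<zeta> = 1" if \<zeta>: "charpoly2 G x \<zeta> = 0" "j \<ge> 1" "\<zeta> ^ j = 1" for \<zeta> j
      proof (rule ccontr)
        assume ne: "\<zeta> \<noteq> 1"
        have "charpoly2 (F ^^ fact m) x (\<zeta> ^ J) = 0"
          unfolding J(2) by (rule eigenvalue_iterate_dvdI[OF xC]) (use Gx \<zeta>(1) in \<open>simp_all add: G_def\<close>)
        moreover have "(\<zeta> ^ J) ^ j = 1" using \<zeta>(3) by (metis power_commutes power_mult power_one mult.commute)
        ultimately have "\<zeta> ^ J = 1" using gm \<zeta>(2) by blast
        then have "\<zeta> \<in> R" using ne by (simp add: R_def)
        then show False using A(3) x \<zeta>(1) by blast
      qed
      then show "x \<in> periodic_stratum F C n" using xC Gx by (auto simp: periodic_stratum_def G_def)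
    qed
    with A(1,2) show ?thesis by blast
  qed
  show ?thesis
    unfolding openin_subopen[of _ "periodic_stratum F C n"]
  proof
    fix z assume z: "z \<in> periodic_stratum F C n"
    obtain A where A: "open A" "z \<in> A" "A \<inter> periodic_stratum F C m \<subseteq> periodic_stratum F C n" using loc[OF z] by blast
    have "openin (top_of_set (periodic_stratum F C m)) (periodic_stratum F C m \<inter> A)" using A(1) by (rule openin_open_Int)
    then show "\<exists>T. openin (top_of_set (periodic_stratum F C m)) T \<and> z \<in> T \<and> T \<subseteq> periodic_stratum F C n"
      using A(2,3) z periodic_stratum_mono[OF nm] by blast
  qed
qed

theorem common_period:
  assumes "connected C" "C \<noteq> {}"
  shows "\<exists>N\<ge>1. \<forall>x\<in>C. (F ^^ N) x = x"
proof -
  obtain n where "C \<subseteq> periodic_stratum F C n"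
    using continuum_subset_of_increasing_union[OF C assms periodic_stratum_cover periodic_stratum_closed periodic_stratum_mono periodic_stratum_open]
    by blast
  then show ?thesis by (intro exI[of _ "fact n"]) (auto simp: periodic_stratum_def fact_ge_1)
qed

end

section \<open>Maps with finite orbits\<close>

lemma forward_orbit_mono: "A \<subseteq> B \<Longrightarrow> forward_orbit F A p \<subseteq> forward_orbit F B p"
  by (auto simp: forward_orbit_def)

lemma forward_orbit_empty: "p \<notin> A \<Longrightarrow> forward_orbit F A p = {}"
  by (auto simp: forward_orbit_def dest: spec[of _ 0])

lemma finite_forward_orbits:
  assumes "finite_orbits_in F U A" "S \<subseteq> A"
  shows "finite (forward_orbit F S p)" "finite (forward_orbit (inv_into U F) S p)"
proof -
  have "finite (forward_orbit F S p) \<and> finite (forward_orbit (inv_into U F) S p)"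
  proof (cases "p \<in> A")
    case True
    then have "finite (orbit_in F U A p)" using assms(1) by (simp add: finite_orbits_in_def)
    then show ?thesis
      using forward_orbit_mono[OF assms(2), of F p] forward_orbit_mono[OF assms(2), of "inv_into U F" p]
      unfolding orbit_in_def by (meson finite_UnI finite_subset finite_Un)
  next
    case False
    then have "p \<notin> S" using assms(2) by blast
    then show ?thesis by (simp add: forward_orbit_empty)
  qed
  then show "finite (forward_orbit F S p)" "finite (forward_orbit (inv_into U F) S p)" by auto
qed

text \<open>A finite orbit repeats a value, and injectivity cancels the common iterates: the point
  is periodic and not merely preperiodic.\<close>

lemma periodic_of_finite_forward_orbit:
  assumes inj: "inj_on F U" and x: "\<And>n. (F ^^ n) x \<in> S" "S \<subseteq> U" and fin: "finite (forward_orbit F S x)"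
  shows "\<exists>k\<ge>1. (F ^^ k) x = x"
proof -
  have "range (\<lambda>n. (F ^^ n) x) \<subseteq> forward_orbit F S x" using x(1) by (auto simp: forward_orbit_def)
  then have "\<not> inj (\<lambda>n. (F ^^ n) x)" using fin finite_subset finite_imageD infinite_UNIV_nat by blast
  then obtain i j where ij: "(F ^^ i) x = (F ^^ j) x" "i < j" unfolding inj_def by (metis linorder_neqE_nat)
  have "(F ^^ (j - i)) x = x"
    using ij
  proof (induction i arbitrary: j)
    case (Suc i)
    then obtain j' where j': "j = Suc j'" by (cases j) auto
    have "F ((F ^^ i) x) = F ((F ^^ j') x)" using Suc.prems(1) j' by simp
    then have "(F ^^ i) x = (F ^^ j') x" using inj x by (meson inj_onD subsetD)
    then show ?case using Suc.IH[of j'] Suc.prems(2) j' by simp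
  qed simp
  then show ?thesis using ij(2) by (intro exI[of _ "j - i"]) auto
qed

theorem finite_orbits_imp_root_of_unity_eigenvalue:
  assumes F: "local_diffeo F U V" and S: "open S" "0 \<in> S" "S \<subseteq> U" "S \<subseteq> V"
    and fin: "\<And>q. finite (forward_orbit F S q)" "\<And>q. finite (forward_orbit (inv_into U F) S q)"
    and chi: "\<And>\<zeta>. charpoly2 F 0 \<zeta> = (\<zeta> - \<alpha>) * (\<zeta> - \<beta>)"
  shows "\<exists>k\<ge>1. \<alpha> ^ k = 1 \<or> \<beta> ^ k = 1"
proof -
  have bih: "biholomorphism F U V" and F0: "F 0 = 0" using F by (auto simp: local_diffeo_def)
  have inj: "inj_on F U" and hF: "holomorphic_map_on F S"
    using bih S(3) holomorphic_map_on_subset by (auto simp: biholomorphism_def bij_betw_def)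
  note uni = norm_eigenvalue_periodic_point[OF bih S(1,3,4) fin]
  have dom0: "0 \<in> iterate_domain F S 1" using S(2) by (simp add: iterate_domain_def)
  have "norm \<zeta> = 1" if "charpoly2 F 0 \<zeta> = 0" for \<zeta>
    using uni[OF dom0, of \<zeta>] F0 that by simp
  then have ab: "norm \<alpha> = 1" "norm \<beta> = 1" using chi by auto
  obtain r where r: "r > 0" "cball 0 r \<subseteq> S" using S(1,2) open_contains_cball by blast
  define E where "E = staying_set F (cball 0 r)"
  define C where "C = connected_component_set E 0"
  have "C \<inter> sphere 0 r \<noteq> {}"
    unfolding C_def E_def
    by (rule component_of_staying_set_meets_sphere_unimodular[OF F r(1) _ chi ab]) (use r S in blast)
  then obtain y where y: "y \<in> C" "y \<in> sphere 0 r" by blast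
  have Fc: "continuous_on (cball 0 r) F"
    using holomorphic_map_on_imp_continuous_on[OF hF] r(2) continuous_on_subset by blast
  have E: "closed E" "E \<subseteq> cball 0 r"
    unfolding E_def by (rule closed_staying_set[OF Fc closed_cball], rule staying_set_subset)
  have CE: "C \<subseteq> E" unfolding C_def by (rule connected_component_subset)
  have "closed C" unfolding C_def by (rule closed_connected_component[OF E(1)])
  then have C: "compact C" using bounded_subset[OF bounded_cball order_trans[OF CE E(2)]] by (simp add: compact_eq_bounded_closed)
  have C0: "0 \<in> C" using y(1) unfolding C_def
    by (metis connected_component_eq_empty connected_component_refl empty_iff mem_Collect_eq)
  have CS: "(F ^^ n) x \<in> S" if "x \<in> C" for x n
  proof -
    have "x \<in> staying_set F (cball 0 r)" using that CE by (auto simp: E_def)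
    then have "(F ^^ n) x \<in> cball 0 r" unfolding staying_set_def by blast
    then show ?thesis using r(2) by blast
  qed
  interpret periodic_continuum F S C
  proof
    show "\<exists>k\<ge>1. (F ^^ k) x = x" if "x \<in> C" for x
      by (rule periodic_of_finite_forward_orbit[OF inj CS[OF that] S(3) fin(1)])
  qed (use S hF C CS uni in auto)
  have conn: "connected C" by (simp add: C_def)
  have "C \<noteq> {}" using C0 by blast
  from common_period[OF conn this] obtain N where N: "N \<ge> 1" "\<And>x. x \<in> C \<Longrightarrow> (F ^^ N) x = x"
    by blast
  \<comment> \<open>A nondegenerate continuum has no isolated point, so 0 is a limit of fixed points
    of \<open>F ^^ N\<close>, and 1 is an eigenvalue there. It is the N-th power of an eigenvalue of
    F at 0.\<close>
  have "0 islimpt C"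
  proof (rule connected_imp_perfect[OF _ C0])
    show "connected C" by (rule conn)
    have "y \<noteq> 0" using y(2) r(1) by auto
    then show "C \<noteq> {x}" for x using y(1) C0 by auto
  qed
  then have lim: "0 islimpt {x. (F ^^ N) x = x}" by (rule islimpt_subset) (use N in auto)
  have "charpoly2 (F ^^ N) 0 1 = 0"
    by (rule eigenvalue_1_of_nonisolated_fixed_point[OF domain(1) C_domain[OF C0] domain(2) lim N(2)[OF C0]])
  then obtain \<xi> where "charpoly2 F 0 \<xi> = 0" "\<xi> ^ N = 1"
    using eigenvalue_iterate_dvdD[OF C0, of 1 N 1] F0 by auto
  then show ?thesis using chi N(1) by (intro exI[of _ N]) auto
qed

theorem corollary7:
  fixes F :: "complex \<times> complex \<Rightarrow> complex \<times> complex"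
    and \<Gamma> :: "complex fps fps set"
    and \<mu> :: complex
  assumes "diff_germ F"
    and "irreducible_formal_curve \<Gamma>"
    and "invariant_curve F \<Gamma>"
    and "is_multiplier F \<Gamma> \<mu>"
    and "bruno_number \<mu>"
  shows "\<not> finite_orbits_property F"
proof
  assume "finite_orbits_property F"
  then obtain G U V A where G: "local_diffeo G U V" and ev: "\<forall>\<^sub>F p in nhds 0. G p = F p"
    and A: "A \<subseteq> U \<inter> V" "0 \<in> interior A" "finite_orbits_in G U A"
    unfolding finite_orbits_property_def represents_germ_def by blast
  define S where "S = interior A"
  have S: "open S" "0 \<in> S" "S \<subseteq> A" "S \<subseteq> U" "S \<subseteq> V" using A interior_subset[of A] by (auto simp: S_def)
  have hG: "holomorphic_map_on G S"
    using G S(4) holomorphic_map_on_subset by (auto simp: local_diffeo_def biholomorphism_def)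
  note fin = finite_forward_orbits[OF A(3) S(3)]
  have tay: "taylor2 (fst \<circ> F) = taylor2 (fst \<circ> G)" "taylor2 (snd \<circ> F) = taylor2 (snd \<circ> G)"
    by (rule taylor2_cong; use ev in eventually_elim; simp)+
  obtain \<gamma> h where \<gamma>: "puiseux_parametrization \<Gamma> \<gamma>" and h: "formal_diffeo h" "\<mu> = h $ 1"
    and eq: "germ_along F \<gamma> = (fst \<gamma> oo h, snd \<gamma> oo h)"
    using assms(4) unfolding is_multiplier_def by blast
  obtain u v where uv: "\<gamma> = (u, v)" by (cases \<gamma>)
  \<comment> \<open>One entry of a Puiseux pair is a positive power of t, hence nonzero.\<close>
  have uv0: "u $ 0 = 0" "v $ 0 = 0" "u \<noteq> 0 \<or> v \<noteq> 0"
    using \<gamma> unfolding puiseux_parametrization_def primitive_pair_def uv by auto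
  have "norm \<mu> = 1 \<and> (\<forall>e\<ge>1. \<mu> ^ e \<noteq> 1)"
    by (rule bruno_number_divisor_data[OF assms(5)]) blast
  then have \<mu>: "norm \<mu> = 1" "\<And>e. e \<ge> 1 \<Longrightarrow> \<mu> ^ e \<noteq> 1" by auto
  \<comment> \<open>The nonresonance required by \<open>formal_schroeder\<close>: \<mu>^k = \<mu>
    would make \<mu> a root of unity.\<close>
  have nr: "(h $ 1) ^ k \<noteq> h $ 1" if "k \<ge> 2" for k
  proof
    assume "(h $ 1) ^ k = h $ 1"
    moreover have "\<mu> ^ k = \<mu> * \<mu> ^ (k - 1)" using that by (simp flip: power_Suc)
    moreover have "\<mu> \<noteq> 0" using \<mu>(1) by auto
    ultimately have "\<mu> ^ (k - 1) = 1" unfolding h(2)[symmetric] by simp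
    moreover have "k - 1 \<ge> 1" using that by simp
    ultimately show False using \<mu>(2) by blast
  qed
  have eqs: "subst1 (taylor2 (fst \<circ> G)) u v = u oo h" "subst1 (taylor2 (snd \<circ> G)) u v = v oo h"
    using eq unfolding germ_along_def uv by (simp_all add: tay)
  obtain fu fv where f: "fu $ 0 = 0" "fv $ 0 = 0" "fu \<noteq> 0 \<or> fv \<noteq> 0"
    "\<And>k. subst1 (taylor2 (fst \<circ> G)) fu fv $ k = (h $ 1) ^ k * fu $ k"
    "\<And>k. subst1 (taylor2 (snd \<circ> G)) fu fv $ k = (h $ 1) ^ k * fv $ k"
    by (rule linearized_formal_curve[OF uv0 _ _ nr eqs]) (use h(1) in \<open>auto simp: formal_diffeo_def\<close>)
  obtain d where d: "d \<ge> 1" and d0: "charpoly2 G 0 (\<mu> ^ d) = 0"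
    using linearized_curve_tangent_eigenvalue[OF f]
    unfolding charpoly2_def h(2) taylor2_linear_coeffs(2,3) by blast
  obtain \<alpha> \<beta> where ab: "\<And>\<zeta>. charpoly2 G 0 \<zeta> = (\<zeta> - \<alpha>) * (\<zeta> - \<beta>)" using charpoly2_factor by metis
  then have "\<mu> ^ d = \<alpha> \<or> \<mu> ^ d = \<beta>" using d0 by auto
  \<comment> \<open>Put the tangent eigenvalue first. As \<mu>^d is not a root of unity, the
    alternative given by finiteness of orbits falls on \<beta>'.\<close>
  then obtain \<beta>' where chi: "\<And>\<zeta>. charpoly2 G 0 \<zeta> = (\<zeta> - \<mu> ^ d) * (\<zeta> - \<beta>')" using ab by (metis mult.commute)
  obtain k where k: "k \<ge> 1" "(\<mu> ^ d) ^ k = 1 \<or> \<beta>' ^ k = 1"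
    using finite_orbits_imp_root_of_unity_eigenvalue[OF G S(1,2,4,5) fin chi] by blast
  have "(\<mu> ^ d) ^ k \<noteq> 1" using \<mu>(2)[of "d * k"] d k(1) by (simp add: power_mult)
  then have "\<beta>' ^ k = 1" using k(2) by blast
  then show False
    using infinite_orbit_on_bruno_curve[OF S(1,2) hG assms(5) f(1-3) f(4,5)[folded h(2)] chi k(1)] fin(1) by blast
qed

end
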